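(* Let $n\ge 0$ and let $\Gamma=(\gamma_1,\dots,\gamma_{n+1})$ be any ordered collection of non-zero integers (possibly with repetitions), and put $K=\gamma_1+\dots+\gamma_{n+1}$. Then $\Phi_\Gamma\in\mathcal{A}_n$ satisfies $\langle\Phi_\Gamma,\mathrm{AP}_1\rangle=0$ and $\langle\Phi_\Gamma,\mathrm{AP}_2^{(n-2),2}\rangle=0$ for all relators of these types, and $\Phi_\Gamma$ is an arrow diagram formula for virtual knots: the function $\mathtt{G}\mapsto\langle S(\Phi_\Gamma),I(\mathtt{G})\rangle$ on Gauss diagrams with global marking $K$ is invariant under all $\mathrm{R}_1$, $\mathrm{R}_2$ and $\mathrm{R}_3$ moves.
   Context: **Diagrams.** Fix $K\in\mathbb{Z}$ (global marking). A Gauss diagram of degree $n$ is an oriented circle (drawn counterclockwise) marked with $K$, together with $n$ abstract oriented chords ("arrows", only endpoints matter) having $2n$ distinct endpoints, each arrow equipped with a sign $\pm1$ and an integer marking, up to oriented homeomorphisms of the circle. An arrow diagram is the same without signs. $\mathcal{G}_n,\mathcal{G}$ (resp. $\mathcal{A}_n,\mathcal{A}$) are the $\mathbb{Q}$-vector spaces freely generated by Gauss (resp. arrow) diagrams of degree $n$, of any degree. **Pairings.** $(\,,)$ is the scalar product making diagrams orthonormal. $\operatorname{Aut}(D)$ is the group of rotations leaving $D$ unchanged. $\langle D,D'\rangle=|\operatorname{Aut}(D)|\,(D,D')$ for diagrams, extended bilinearly. **Maps.** $I:\mathcal{G}\to\mathcal{G}$ is linear and sends a Gauss diagram to the sum of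 its subdiagrams (over all subsets of arrows). For an arrow diagram $A$ with arrows numbered $1,\dots,n$, $S(A)=\sum_{\sigma\in\{\pm1\}^n}\big(\prod_i\sigma(i)\big)A^\sigma$, where $A^\sigma$ gives sign $\sigma(i)$ to arrow $i$; extended linearly. **Triangle condition.** For three disjoint small intervals $1,2,3$ of the circle, arrows $1\to2$, $1\to3$, $2\to3$ (tail on the first, head on the second) with markings $m_{12},m_{13},m_{23}$ satisfy the triangle condition if $m_{13}=m_{12}+m_{23}-K$ when $1,2,3$ appear in this cyclic order along the orientation, and $m_{13}=m_{12}+m_{23}$ when they appear in the cyclic order $1,3,2$. **R-moves on Gauss diagrams.** $\mathrm{R}_1$: add/delete an arrow of any sign with consecutive endpoints, with marking $0$ if the oriented arc from head to tail contains no other endpoint, or marking $K$ if the oriented arc from tail to head contains no other endpoint. $\mathrm{R}_2$: add/delete two arrows with opposite signs and the same marking, whose tails are consecutive on the circle and whose heads are consecutive on the circle (any orders). $\mathrm{R}_3$: in a diagram containing three disjoint intervals $1,2,3$ (in either cyclic order) and three arrows $1\to2$, $1\to3$, $2\to3$ whose markings satisfy the triangle condition, with signs $(\varepsilon,-\varepsilon,\varepsilon)$ respectively ($\varepsilon=\pm1$), no other endpoint lying on the intervals, exchange the configuration "on 1 the endpoint of $1\to2$ precedes that of $1\to3$; on 2 that of $2\to3$ precedes that of $1\to2$; on 3 that of $1\to3$ precedes that of $2\to3$" with the configuration where the order is reversed on all three intervals. Signs and markings are unchanged. **Relators.** $\mathrm{AP}_1$: any arrow diagram containing an arrow whose head-to-tail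 oriented arc has no other endpoint and whose marking is $0$, or whose tail-to-head oriented arc has no other endpoint and whose marking is $K$. $\mathrm{AP}_2^{(n-2),2}$: any arrow diagram of degree $n$ containing two arrows with the same marking, consecutive tails and consecutive heads. **Planar chains.** A naked arrow diagram is an arrow diagram with all markings forgotten (arrow directions are kept), up to oriented homeomorphism of the circle. It is planar if no two of its arrows intersect (as chords of the disc). A chain presentation of a planar naked arrow diagram with $n$ arrows is a bijective numbering of its $n+1$ internal regions (components of the disc minus the chords) by $1,\dots,n+1$ such that the numbering increases when one goes from the left to the right of any arrow (the left of an arrow is the side bounded by the oriented arc of the circle from its head to its tail). $U_n$ is the sum of all planar isotopy classes of chain presentations of naked arrow diagrams with $n$ arrows. Given $\Gamma=(\gamma_1,\dots,\gamma_{n+1})$, each chain presentation yields an arrow diagram by marking each arrow with the sum of the $\gamma_i$'s whose index $i$ is located (as the number of a region) to the left of that arrow, and marking the circle with $\sum_i\gamma_i$. $\Phi_\Gamma\in\mathcal{A}_n$ is the image of $U_n$ under this substitution (coinciding diagrams are added with multiplicity). *)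

theory Defs
  imports "HOL-Analysis.Analysis" "HOL-Library.Poly_Mapping"
begin

text \<open>
  The global marking \<open>K\<close> is one integer fixed for all diagrams, so it is not stored in a diagram;
  it is a parameter of the moves and relators that refer to it.
\<close>

section \<open>Diagrams up to rotation\<close>

text \<open>
  An arrow is a triple (tail, head, label).  A diagram with \<open>n\<close> arrows is drawn with its \<open>2n\<close>
  endpoints at the \<open>2n\<close>-th roots of unity, numbered \<open>0, \<dots>, 2n - 1\<close> counterclockwise.  Every
  diagram has such a position, unique up to rotation, so diagrams up to oriented homeomorphism of
  the circle are the sets of arrows below up to rotation.  Labels are pairs (sign, marking) for
  Gauss diagrams, markings for arrow diagrams, and trivial for naked arrow diagrams.
\<close>

type_synonym 'l arrow = "nat \<times> nat \<times> 'l"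

definition endpoints :: "'l arrow set \<Rightarrow> nat set" where
  "endpoints D = (\<Union>(t, h, l)\<in>D. {t, h})"

text \<open>The \<open>n\<close> arrows cover \<open>2n\<close> positions, which forces the \<open>2n\<close> endpoints to be distinct.\<close>

definition wf_diag :: "'l arrow set \<Rightarrow> bool" where
  "wf_diag D \<longleftrightarrow> finite D \<and> endpoints D = {..<2 * card D}"

definition relabel :: "(nat \<Rightarrow> nat) \<Rightarrow> 'l arrow set \<Rightarrow> 'l arrow set" where
  "relabel f D = (\<lambda>(t, h, l). (f t, f h, l)) ` D"

definition rot :: "nat \<Rightarrow> 'l arrow set \<Rightarrow> 'l arrow set" where
  "rot r D = relabel (\<lambda>x. (x + r) mod (2 * card D)) D"

definition rot_equiv :: "'l arrow set \<Rightarrow> 'l arrow set \<Rightarrow> bool" where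
  "rot_equiv D D' \<longleftrightarrow> wf_diag D \<and> wf_diag D' \<and> (\<exists>r. D' = rot r D)"

lemma endpoints_relabel: "endpoints (relabel f D) = f ` endpoints D"
  unfolding endpoints_def relabel_def by (simp add: image_UN case_prod_unfold)

lemma relabel_relabel: "relabel f (relabel g D) = relabel (f \<circ> g) D"
  unfolding relabel_def by (simp add: image_image case_prod_unfold)

lemma endpointsI:
  assumes "(t, h, l) \<in> D"
  shows "t \<in> endpoints D" "h \<in> endpoints D"
  using assms unfolding endpoints_def by blast+

lemma relabel_cong:
  assumes "\<And>x. x \<in> endpoints D \<Longrightarrow> f x = g x"
  shows "relabel f D = relabel g D"
  unfolding relabel_def by (rule image_cong) (auto simp: assms endpointsI)

lemma relabel_id:
  assumes "\<And>x. x \<in> endpoints D \<Longrightarrow> f x = x"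
  shows "relabel f D = D"
proof -
  have "relabel f D = relabel id D"
    by (rule relabel_cong) (simp add: assms)
  then show ?thesis by (simp add: relabel_def)
qed

lemma inj_on_relabel:
  assumes "inj_on f (endpoints D)"
  shows "inj_on (\<lambda>(t, h, l). (f t, f h, l)) D"
  by (rule inj_onI) (auto dest!: inj_onD[OF assms] intro: endpointsI)

lemma card_relabel: "inj_on f (endpoints D) \<Longrightarrow> card (relabel f D) = card D"
  unfolding relabel_def by (rule card_image[OF inj_on_relabel])

lemma inj_on_add_mod: "inj_on (\<lambda>x. (x + r) mod m) {..<m::nat}"
proof (rule inj_onI)
  fix x y assume xy: "x \<in> {..<m}" "y \<in> {..<m}" "(x + r) mod m = (y + r) mod m"
  then have "(int x + int r) mod int m = (int y + int r) mod int m"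
    by (metis of_nat_add zmod_int)
  from mod_diff_cong[OF this refl, of "int r"] show "x = y" using xy(1,2) by simp
qed

lemma image_add_mod: "(\<lambda>x. (x + r) mod m) ` {..<m::nat} = {..<m}"
  by (rule card_subset_eq) (auto simp: card_image[OF inj_on_add_mod])

lemma
  assumes "wf_diag D"
  shows card_rot: "card (rot r D) = card D" and wf_rot: "wf_diag (rot r D)"
proof -
  have e: "endpoints D = {..<2 * card D}" "finite D" using assms by (auto simp: wf_diag_def)
  show c: "card (rot r D) = card D"
    unfolding rot_def by (rule card_relabel) (simp add: e inj_on_add_mod)
  show "wf_diag (rot r D)"
    unfolding wf_diag_def c unfolding rot_def endpoints_relabel e(1) image_add_mod
    using e by (auto simp: relabel_def)
qed

lemma rot_rot: "wf_diag D \<Longrightarrow> rot r (rot s D) = rot (s + r) D"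
  by (subst rot_def, simp only: card_rot, unfold rot_def relabel_relabel)
     (rule relabel_cong, simp add: mod_add_left_eq add.assoc)

lemma rot_0: "wf_diag D \<Longrightarrow> rot 0 D = D"
  unfolding rot_def by (rule relabel_id) (auto simp: wf_diag_def)

lemma rot_full: "wf_diag D \<Longrightarrow> rot (2 * card D * k) D = D"
  unfolding rot_def by (rule relabel_id) (auto simp: wf_diag_def)

lemma rot_inverse:
  assumes "wf_diag D"
  shows "rot ((2 * card D - 1) * r) (rot r D) = D"
proof (cases "card D")
  case 0
  then have "D = {}" using assms by (auto simp: wf_diag_def)
  then show ?thesis by (simp add: rot_def relabel_def)
next
  case (Suc n)
  then have "r + (2 * card D - 1) * r = 2 * card D * r" by (simp add: algebra_simps)
  then show ?thesis by (simp add: rot_rot assms rot_full)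
qed

lemma part_equivp_rot_equiv: "part_equivp rot_equiv"
proof (rule part_equivpI)
  show "\<exists>x. rot_equiv x x"
    by (rule exI[of _ "{}"]) (auto simp: rot_equiv_def wf_diag_def endpoints_def rot_def relabel_def)
  show "symp rot_equiv"
    by (rule sympI) (use rot_inverse in \<open>fastforce simp: rot_equiv_def\<close>)
  show "transp rot_equiv"
    by (rule transpI) (auto simp: rot_equiv_def rot_rot)
qed

quotient_type 'l diagram = "'l arrow set" / partial: rot_equiv
  by (rule part_equivp_rot_equiv)

lemma rot_equiv_induct [consumes 1, case_names refl step]:
  assumes "rot_equiv D D'" and "P D"
    and "\<And>D. wf_diag D \<Longrightarrow> P D \<Longrightarrow> P (rot 1 D)"
  shows "P D'"
proof -
  from assms obtain r where r: "wf_diag D" "D' = rot r D" by (auto simp: rot_equiv_def)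
  have "P (rot r D)"
  proof (induction r)
    case 0 then show ?case using assms r by (simp add: rot_0)
  next
    case (Suc r) then show ?case using assms(3)[OF wf_rot[OF r(1)]] by (simp add: rot_rot r)
  qed
  then show ?thesis using r by simp
qed

lift_definition diagram_degree :: "'l diagram \<Rightarrow> nat" is card
  by (auto simp: rot_equiv_def card_rot)

text \<open>
  The order of the group of rotations of a diagram: the multiples of a \<open>2n\<close>-th of a turn that fix
  it.  The maximum gives the empty diagram the trivial group.
\<close>

lift_definition aut :: "'l diagram \<Rightarrow> nat" is
  "\<lambda>D. card {r. r < max 1 (2 * card D) \<and> rot r D = D}"
proof -
  fix D D' :: "'l arrow set" assume "rot_equiv D D'"
  then obtain s where s: "wf_diag D" "D' = rot s D" by (auto simp: rot_equiv_def)
  have "rot r D' = D' \<longleftrightarrow> rot r D = D" for r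
  proof
    assume "rot r D' = D'"
    then have "rot ((2 * card D - 1) * s) (rot (s + r) D) = D"
      using s rot_inverse[OF s(1), of s] by (simp add: rot_rot)
    moreover have "rot ((2 * card D - 1) * s) (rot (s + r) D) = rot r (rot ((2 * card D - 1) * s) (rot s D))"
      by (simp add: rot_rot s wf_rot add_ac)
    ultimately show "rot r D = D" by (simp only: rot_inverse s)
  next
    assume "rot r D = D"
    then have "rot s (rot r D) = rot s D" by simp
    then show "rot r D' = D'" using s by (simp add: rot_rot add.commute)
  qed
  then show "card {r. r < max 1 (2 * card D) \<and> rot r D = D} =
      card {r. r < max 1 (2 * card D') \<and> rot r D' = D'}"
    using s by (simp add: card_rot)
qed

datatype asign = Positive | Negative

fun sign_val :: "asign \<Rightarrow> rat" where
  "sign_val Positive = 1"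
| "sign_val Negative = -1"

fun opposite :: "asign \<Rightarrow> asign" where
  "opposite Positive = Negative"
| "opposite Negative = Positive"

type_synonym gauss_diagram = "(asign \<times> int) diagram"
type_synonym arrow_diagram = "int diagram"


section \<open>Free vector spaces and pairings\<close>

definition lin_ext :: "('a \<Rightarrow> 'b \<Rightarrow>\<^sub>0 rat) \<Rightarrow> ('a \<Rightarrow>\<^sub>0 rat) \<Rightarrow> ('b \<Rightarrow>\<^sub>0 rat)" where
  "lin_ext f x = (\<Sum>d\<in>Poly_Mapping.keys x. Poly_Mapping.map ((*) (Poly_Mapping.lookup x d)) (f d))"

definition scalar :: "('a \<Rightarrow>\<^sub>0 rat) \<Rightarrow> ('a \<Rightarrow>\<^sub>0 rat) \<Rightarrow> rat" where
  "scalar x y = (\<Sum>d\<in>Poly_Mapping.keys x \<inter> Poly_Mapping.keys y. Poly_Mapping.lookup x d * Poly_Mapping.lookup y d)"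

definition pairing :: "('l diagram \<Rightarrow>\<^sub>0 rat) \<Rightarrow> ('l diagram \<Rightarrow>\<^sub>0 rat) \<Rightarrow> rat" where
  "pairing x y = (\<Sum>d\<in>Poly_Mapping.keys x. \<Sum>d'\<in>Poly_Mapping.keys y.
     Poly_Mapping.lookup x d * Poly_Mapping.lookup y d' *
       (of_nat (aut d) * scalar (Poly_Mapping.single d 1) (Poly_Mapping.single d' 1)))"


section \<open>The maps I and S\<close>

text \<open>Renumber the remaining endpoints consecutively after arrows have been deleted.\<close>

definition std :: "'l arrow set \<Rightarrow> 'l arrow set" where
  "std B = relabel (\<lambda>x. card {e \<in> endpoints B. e < x}) B"

lemma endpoints_mono: "B \<subseteq> D \<Longrightarrow> endpoints B \<subseteq> endpoints D"
  unfolding endpoints_def by blast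

lemma endpoints_Un: "endpoints (B \<union> C) = endpoints B \<union> endpoints C"
  unfolding endpoints_def by blast

lemma card_endpoints_le: "finite B \<Longrightarrow> card (endpoints B) \<le> 2 * card B"
proof (induction rule: finite_induct)
  case (insert a B)
  obtain t h l where a: "a = (t, h, l)" by (cases a) auto
  have "card (endpoints (insert a B)) \<le> card {t, h} + card (endpoints B)"
    using card_Un_le[of "{t, h}" "endpoints B"] by (simp add: endpoints_def a)
  moreover have "card {t, h} \<le> 2" by (simp add: card_insert_if)
  ultimately show ?case using insert by simp
qed (simp add: endpoints_def)

lemma card_endpoints_sub:
  assumes "wf_diag D" "B \<subseteq> D"
  shows "card (endpoints B) = 2 * card B"
proof -
  have f: "finite D" "finite B" "finite (D - B)"
    using assms finite_subset by (auto simp: wf_diag_def)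
  have "2 * card D = card (endpoints D)" using assms by (simp add: wf_diag_def)
  also have "endpoints D = endpoints B \<union> endpoints (D - B)"
    using assms(2) by (metis Diff_partition endpoints_Un)
  also have "card \<dots> \<le> card (endpoints B) + card (endpoints (D - B))" by (rule card_Un_le)
  finally have "2 * card D \<le> card (endpoints B) + card (endpoints (D - B))" .
  moreover have "card D = card B + card (D - B)"
    using card_Diff_subset[OF f(2) assms(2)] card_mono[OF f(1) assms(2)] by simp
  ultimately show ?thesis
    using card_endpoints_le[OF f(2)] card_endpoints_le[OF f(3)] by simp
qed

lemma rank_strict_mono:
  assumes "finite (E :: nat set)" "x \<in> E" "x < y"
  shows "card {e \<in> E. e < x} < card {e \<in> E. e < y}"
  by (rule psubset_card_mono) (use assms in auto)

lemma inj_on_rank: "finite (E :: nat set) \<Longrightarrow> inj_on (\<lambda>x. card {e \<in> E. e < x}) E"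
proof (rule inj_onI)
  fix x y assume *: "finite E" "x \<in> E" "y \<in> E" "card {e \<in> E. e < x} = card {e \<in> E. e < y}"
  show "x = y"
    by (rule linorder_cases[of x y])
       (use rank_strict_mono[OF *(1,2), of y] rank_strict_mono[OF *(1,3), of x] *(4) in simp_all)
qed

lemma finite_endpoints: "finite B \<Longrightarrow> finite (endpoints B)"
  unfolding endpoints_def by auto

lemma
  assumes "wf_diag D" "B \<subseteq> D"
  shows card_std: "card (std B) = card B" and wf_std: "wf_diag (std B)"
proof -
  have f: "finite B" "finite (endpoints B)"
    using assms finite_subset finite_endpoints by (auto simp: wf_diag_def)
  show c: "card (std B) = card B"
    unfolding std_def by (rule card_relabel[OF inj_on_rank[OF f(2)]])
  have "endpoints (std B) = (\<lambda>x. card {e \<in> endpoints B. e < x}) ` endpoints B"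
    by (simp add: std_def endpoints_relabel)
  also have "\<dots> = {..<card (endpoints B)}"
  proof (rule card_subset_eq)
    show "(\<lambda>x. card {e \<in> endpoints B. e < x}) ` endpoints B \<subseteq> {..<card (endpoints B)}"
      using f(2) by (auto intro!: psubset_card_mono)
    show "card ((\<lambda>x. card {e \<in> endpoints B. e < x}) ` endpoints B) = card {..<card (endpoints B)}"
      by (simp add: card_image[OF inj_on_rank[OF f(2)]])
  qed simp
  finally show "wf_diag (std B)"
    unfolding wf_diag_def c card_endpoints_sub[OF assms] using f by (auto simp: std_def relabel_def)
qed

lemma rot_equiv_std_rot1:
  assumes D: "wf_diag D" and B: "B \<subseteq> D"
  shows "rot_equiv (std B) (std (relabel (\<lambda>x. (x + 1) mod (2 * card D)) B))"
proof -
  define m f E where "m = 2 * card D" and "f = (\<lambda>x. (x + 1) mod m)" and "E = endpoints B"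
  have E: "E \<subseteq> {..<m}" "finite E"
    using endpoints_mono[OF B] D finite_subset unfolding E_def m_def wf_diag_def by auto
  have cE: "card E = 2 * card B" unfolding E_def by (rule card_endpoints_sub[OF D B])
  have f_eq: "f x = (if x = m - 1 then 0 else Suc x)" if "x \<in> E" for x
    using that E by (auto simp: f_def mod_Suc)
  have *: "std (relabel f B) = relabel (\<lambda>x. card {e \<in> f ` E. e < f x}) B"
    by (simp add: std_def endpoints_relabel relabel_relabel E_def comp_def)
  have "std (relabel f B) = std B \<or> std (relabel f B) = rot 1 (std B)"
  proof (cases "m - 1 \<in> E")
    case False
    then have f: "f x = Suc x" if "x \<in> E" for x using f_eq[OF that] that by auto
    have "card {e \<in> f ` E. e < f x} = card {e \<in> E. e < x}" if "x \<in> E" for x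
    proof -
      have "{e \<in> f ` E. e < f x} = Suc ` {e \<in> E. e < x}" using that f by auto
      then show ?thesis by (simp add: card_image)
    qed
    then have "std (relabel f B) = std B"
      unfolding * unfolding std_def E_def[symmetric] by (intro relabel_cong) (simp add: E_def)
    then show ?thesis ..
  next
    case True
    have pos: "card E > 0" using True E(2) card_gt_0_iff by blast
    have "card {e \<in> f ` E. e < f x} = (card {e \<in> E. e < x} + 1) mod card E" if x: "x \<in> E" for x
    proof (cases "x = m - 1")
      case eq: True
      have "{e \<in> E. e < x} = E - {x}" using E(1) eq by force
      then show ?thesis using f_eq[OF x] eq E(2) x pos by (simp add: card_Diff_singleton)
    next
      case neq: False
      then have "x < m - 1" using x E(1) by force
      then have "{e \<in> f ` E. e < f x} = insert 0 (Suc ` {e \<in> E. e < x})"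
        using True f_eq f_eq[OF x] by (auto simp: image_iff split: if_splits)
      then have "card {e \<in> f ` E. e < f x} = Suc (card {e \<in> E. e < x})"
        using E(2) by (simp add: card_image card_insert_if image_iff)
      moreover have "Suc (card {e \<in> E. e < x}) < card E"
      proof -
        have "insert x {e \<in> E. e < x} \<subset> E" using True x \<open>x < m - 1\<close> by auto
        from psubset_card_mono[OF E(2) this] show ?thesis using E(2) by simp
      qed
      ultimately show ?thesis by simp
    qed
    then have "std (relabel f B) = rot 1 (std B)"
      unfolding * rot_def card_std[OF D B] unfolding std_def relabel_relabel E_def[symmetric]
      by (intro relabel_cong) (simp add: E_def cE[unfolded E_def])
    then show ?thesis ..
  qed
  then show ?thesis
    unfolding f_def m_def rot_equiv_def using wf_std[OF D B] wf_rot[OF wf_std[OF D B]]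
    by (metis rot_0)
qed

lemma relabel_image: "(\<lambda>(t, h, l). (f t, f h, l)) ` B = relabel f B"
  by (simp add: relabel_def)

lift_definition I_diagram :: "'l diagram \<Rightarrow> ('l diagram \<Rightarrow>\<^sub>0 rat)" is
  "\<lambda>D. \<Sum>B\<in>Pow D. Poly_Mapping.single (abs_diagram (std B)) 1"
proof -
  fix D D' :: "'l arrow set" assume "rot_equiv D D'"
  then show "(\<Sum>B\<in>Pow D. Poly_Mapping.single (abs_diagram (std B)) (1::rat)) =
      (\<Sum>B\<in>Pow D'. Poly_Mapping.single (abs_diagram (std B)) 1)"
  proof (induction rule: rot_equiv_induct)
    case (step C)
    define f where "f = (\<lambda>x. (x + 1) mod (2 * card C))"
    define g where "g = (\<lambda>(t, h, l :: 'l). (f t, f h, l))"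
    have inj: "inj_on g C"
      unfolding g_def by (rule inj_on_relabel)
        (use step in \<open>simp add: wf_diag_def f_def inj_on_add_mod[of 1, simplified]\<close>)
    have "(\<Sum>B\<in>Pow (rot 1 C). Poly_Mapping.single (abs_diagram (std B)) (1::rat)) =
        (\<Sum>B\<in>image g ` Pow C. Poly_Mapping.single (abs_diagram (std B)) 1)"
      by (simp only: image_Pow_surj[OF refl] rot_def f_def g_def relabel_def)
    also have "\<dots> = (\<Sum>B\<in>Pow C. Poly_Mapping.single (abs_diagram (std (g ` B))) 1)"
      by (subst sum.reindex) (auto intro: inj_on_image_Pow inj)
    also have "\<dots> = (\<Sum>B\<in>Pow C. Poly_Mapping.single (abs_diagram (std B)) 1)"
    proof (rule sum.cong)
      fix B assume "B \<in> Pow C"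
      then have "rot_equiv (std B) (std (g ` B))"
        unfolding g_def relabel_image f_def using rot_equiv_std_rot1[OF step(1)] by blast
      then have "abs_diagram (std B) = abs_diagram (std (g ` B))"
        by (meson Quotient_rel_abs Quotient_diagram)
      then show "Poly_Mapping.single (abs_diagram (std (g ` B))) (1::rat) =
          Poly_Mapping.single (abs_diagram (std B)) 1" by simp
    qed simp
    finally show ?case using step by simp
  qed simp
qed

definition I_map :: "('l diagram \<Rightarrow>\<^sub>0 rat) \<Rightarrow> ('l diagram \<Rightarrow>\<^sub>0 rat)" where
  "I_map = lin_ext I_diagram"

definition add_signs :: "(int arrow \<Rightarrow> asign) \<Rightarrow> int arrow set \<Rightarrow> (asign \<times> int) arrow set" where
  "add_signs \<sigma> A = (\<lambda>(t, h, m). (t, h, \<sigma> (t, h, m), m)) ` A"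

lemma card_add_signs: "card (add_signs \<sigma> A) = card A"
  unfolding add_signs_def by (rule card_image) (auto simp: inj_on_def)

lemma wf_add_signs: "wf_diag A \<Longrightarrow> wf_diag (add_signs \<sigma> A)"
  unfolding wf_diag_def card_add_signs by (simp add: add_signs_def endpoints_def case_prod_unfold)

lift_definition S_diagram :: "arrow_diagram \<Rightarrow> (gauss_diagram \<Rightarrow>\<^sub>0 rat)" is
  "\<lambda>A. \<Sum>\<sigma>\<in>PiE A (\<lambda>_. UNIV).
     Poly_Mapping.single (abs_diagram (add_signs \<sigma> A)) (\<Prod>a\<in>A. sign_val (\<sigma> a))"
proof -
  fix D D' :: "int arrow set" assume "rot_equiv D D'"
  then show "(\<Sum>\<sigma>\<in>PiE D (\<lambda>_. UNIV).
        Poly_Mapping.single (abs_diagram (add_signs \<sigma> D)) (\<Prod>a\<in>D. sign_val (\<sigma> a))) =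
      (\<Sum>\<sigma>\<in>PiE D' (\<lambda>_. UNIV).
        Poly_Mapping.single (abs_diagram (add_signs \<sigma> D')) (\<Prod>a\<in>D'. sign_val (\<sigma> a)))"
  proof (induction rule: rot_equiv_induct)
    case (step C)
    define f where "f = (\<lambda>x. (x + 1) mod (2 * card C))"
    define g where "g = (\<lambda>(t, h, l :: int). (f t, f h, l))"
    have inj: "inj_on g C"
      unfolding g_def by (rule inj_on_relabel)
        (use step in \<open>simp add: wf_diag_def f_def inj_on_add_mod[of 1, simplified]\<close>)
    have C': "rot 1 C = g ` C" by (simp only: rot_def f_def g_def relabel_def)
    have "(\<Sum>\<sigma>\<in>PiE (g ` C) (\<lambda>_. UNIV).
        Poly_Mapping.single (abs_diagram (add_signs \<sigma> (g ` C))) (\<Prod>a\<in>g ` C. sign_val (\<sigma> a))) =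
      (\<Sum>\<sigma>\<in>PiE C (\<lambda>_. UNIV).
        Poly_Mapping.single (abs_diagram (add_signs \<sigma> C)) (\<Prod>a\<in>C. sign_val (\<sigma> a)))"
    proof (rule sum.reindex_bij_witness[where j = "\<lambda>\<sigma>. restrict (\<sigma> \<circ> g) C"
          and i = "\<lambda>\<sigma>. restrict (\<sigma> \<circ> inv_into C g) (g ` C)"])
      let ?h = "inv_into C g"
      show "restrict (restrict (\<sigma> \<circ> g) C \<circ> ?h) (g ` C) = \<sigma>"
        if \<sigma>: "\<sigma> \<in> PiE (g ` C) (\<lambda>_. UNIV)" for \<sigma> :: "int arrow \<Rightarrow> asign"
      proof (rule extensionalityI[of _ "g ` C"])
        fix x assume "x \<in> g ` C"
        then show "(restrict (restrict (\<sigma> \<circ> g) C \<circ> ?h) (g ` C)) x = \<sigma> x" by (elim imageE) (simp add: inv_into_f_f[OF inj])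
      qed (use \<sigma> in \<open>simp_all only: PiE_iff restrict_extensional\<close>)
      show "restrict (restrict (\<sigma> \<circ> ?h) (g ` C) \<circ> g) C = \<sigma>"
        if \<sigma>: "\<sigma> \<in> PiE (C) (\<lambda>_. UNIV)" for \<sigma> :: "int arrow \<Rightarrow> asign"
      proof (rule extensionalityI[of _ "C"])
        fix x assume "x \<in> C"
        then show "(restrict (restrict (\<sigma> \<circ> ?h) (g ` C) \<circ> g) C) x = \<sigma> x" by (simp add: inv_into_f_f[OF inj])
      qed (use \<sigma> in \<open>simp_all only: PiE_iff restrict_extensional\<close>)
      fix \<sigma> :: "int arrow \<Rightarrow> asign" assume "\<sigma> \<in> PiE (g ` C) (\<lambda>_. UNIV)"
      have "add_signs \<sigma> (g ` C) = relabel f (add_signs (restrict (\<sigma> \<circ> g) C) C)"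
        unfolding add_signs_def relabel_def image_image
        by (rule image_cong) (auto simp: g_def)
      also have "\<dots> = rot 1 (add_signs (restrict (\<sigma> \<circ> g) C) C)"
        by (simp add: rot_def card_add_signs f_def)
      finally have "rot_equiv (add_signs (restrict (\<sigma> \<circ> g) C) C) (add_signs \<sigma> (g ` C))"
        using step(1) by (auto simp: rot_equiv_def intro: wf_add_signs wf_rot)
      then have "abs_diagram (add_signs (restrict (\<sigma> \<circ> g) C) C) =
          abs_diagram (add_signs \<sigma> (g ` C))"
        by (meson Quotient_rel_abs Quotient_diagram)
      moreover have "(\<Prod>a\<in>g ` C. sign_val (\<sigma> a)) = (\<Prod>a\<in>C. sign_val (restrict (\<sigma> \<circ> g) C a))"
        by (simp add: prod.reindex[OF inj])
      ultimately show "Poly_Mapping.single (abs_diagram (add_signs (restrict (\<sigma> \<circ> g) C) C))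
            (\<Prod>a\<in>C. sign_val (restrict (\<sigma> \<circ> g) C a)) =
          Poly_Mapping.single (abs_diagram (add_signs \<sigma> (g ` C))) (\<Prod>a\<in>g ` C. sign_val (\<sigma> a))"
        by simp
    qed auto
    then show ?case using step C' by simp
  qed simp
qed

definition S_map :: "(arrow_diagram \<Rightarrow>\<^sub>0 rat) \<Rightarrow> (gauss_diagram \<Rightarrow>\<^sub>0 rat)" where
  "S_map = lin_ext S_diagram"


section \<open>Moves and relators\<close>

text \<open>Number of steps from position \<open>p\<close> to position \<open>q\<close> along the orientation (\<open>p, q < m\<close>).\<close>

definition steps :: "nat \<Rightarrow> nat \<Rightarrow> nat \<Rightarrow> nat" where
  "steps m p q = (q + m - p) mod m"

definition next_pos :: "nat \<Rightarrow> nat \<Rightarrow> nat" where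
  "next_pos m p = (p + 1) mod m"

definition consecutive :: "nat \<Rightarrow> nat \<Rightarrow> nat \<Rightarrow> bool" where
  "consecutive m p q \<longleftrightarrow> q = next_pos m p \<or> p = next_pos m q"

definition isolated :: "int \<Rightarrow> nat \<Rightarrow> nat \<Rightarrow> nat \<Rightarrow> int \<Rightarrow> bool" where
  "isolated K m t h mk \<longleftrightarrow> (t = next_pos m h \<and> mk = 0) \<or> (h = next_pos m t \<and> mk = K)"

definition R1 :: "int \<Rightarrow> gauss_diagram \<Rightarrow> gauss_diagram \<Rightarrow> bool" where
  "R1 K G G' \<longleftrightarrow> (\<exists>D t h \<epsilon> mk. wf_diag D \<and> (t, h, \<epsilon>, mk) \<in> D \<and>
     isolated K (2 * card D) t h mk \<and>
     G = abs_diagram D \<and> G' = abs_diagram (std (D - {(t, h, \<epsilon>, mk)})))"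

definition R2 :: "gauss_diagram \<Rightarrow> gauss_diagram \<Rightarrow> bool" where
  "R2 G G' \<longleftrightarrow> (\<exists>D t h t' h' \<epsilon> mk. wf_diag D \<and>
     (t, h, \<epsilon>, mk) \<in> D \<and> (t', h', opposite \<epsilon>, mk) \<in> D \<and>
     consecutive (2 * card D) t t' \<and> consecutive (2 * card D) h h' \<and>
     G = abs_diagram D \<and>
     G' = abs_diagram (std (D - {(t, h, \<epsilon>, mk), (t', h', opposite \<epsilon>, mk)})))"

text \<open>
  The intervals 1, 2, 3 of the third move contain exactly the two endpoints \<open>p, p'\<close> (respectively
  \<open>q, q'\<close> and \<open>r, r'\<close>), in this order.
\<close>

definition triangle :: "int \<Rightarrow> nat \<Rightarrow> nat \<Rightarrow> nat \<Rightarrow> nat \<Rightarrow> int \<Rightarrow> int \<Rightarrow> int \<Rightarrow> bool" where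
  "triangle K m p q r m12 m13 m23 \<longleftrightarrow>
     (if steps m p q < steps m p r then m13 = m12 + m23 - K else m13 = m12 + m23)"

definition R3 :: "int \<Rightarrow> gauss_diagram \<Rightarrow> gauss_diagram \<Rightarrow> bool" where
  "R3 K G G' \<longleftrightarrow> (\<exists>D D' B m p p' q q' r r' \<epsilon> m12 m13 m23.
     wf_diag D \<and> wf_diag D' \<and> m = 2 * card D \<and>
     p' = next_pos m p \<and> q' = next_pos m q \<and> r' = next_pos m r \<and>
     distinct [p, p', q, q', r, r'] \<and>
     triangle K m p q r m12 m13 m23 \<and>
     D = B \<union> {(p, q', \<epsilon>, m12), (p', r, opposite \<epsilon>, m13), (q, r', \<epsilon>, m23)} \<and>
     D' = B \<union> {(p', q, \<epsilon>, m12), (p, r', opposite \<epsilon>, m13), (q', r, \<epsilon>, m23)} \<and>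
     G = abs_diagram D \<and> G' = abs_diagram D')"

definition AP1 :: "int \<Rightarrow> arrow_diagram \<Rightarrow> bool" where
  "AP1 K A \<longleftrightarrow> (\<exists>D t h mk. wf_diag D \<and> (t, h, mk) \<in> D \<and>
     isolated K (2 * card D) t h mk \<and> A = abs_diagram D)"

definition AP2 :: "nat \<Rightarrow> arrow_diagram \<Rightarrow> bool" where
  "AP2 n A \<longleftrightarrow> diagram_degree A = n \<and> (\<exists>D t h t' h' mk. wf_diag D \<and>
     (t, h, mk) \<in> D \<and> (t', h', mk) \<in> D \<and> (t, h) \<noteq> (t', h') \<and>
     consecutive (2 * card D) t t' \<and> consecutive (2 * card D) h h' \<and>
     A = abs_diagram D)"

section \<open>Planar chains\<close>

definition pt :: "nat \<Rightarrow> nat \<Rightarrow> complex" where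
  "pt m k = cis (2 * pi * real k / real m)"

definition chord :: "nat \<Rightarrow> 'l arrow \<Rightarrow> complex set" where
  "chord m a = (case a of (t, h, l) \<Rightarrow> closed_segment (pt m t) (pt m h))"

text \<open>The open arc of the unit circle running counterclockwise from position \<open>p\<close> to position \<open>q\<close>.\<close>

definition circle_arc :: "nat \<Rightarrow> nat \<Rightarrow> nat \<Rightarrow> complex set" where
  "circle_arc m p q =
     {pt m p * cis \<theta> | \<theta>. 0 < \<theta> \<and> \<theta> < 2 * pi * real (steps m p q) / real m}"

text \<open>The part of the disc cut off by the chord of an arrow and bounded by a given arc.\<close>

definition side :: "nat \<Rightarrow> 'l arrow \<Rightarrow> complex set \<Rightarrow> complex set" where
  "side m a C = (\<Union>w\<in>C. connected_component_set (cball 0 1 - chord m a) w)"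

definition left_side :: "nat \<Rightarrow> 'l arrow \<Rightarrow> complex set" where
  "left_side m a = (case a of (t, h, l) \<Rightarrow> side m a (circle_arc m h t))"

definition right_side :: "nat \<Rightarrow> 'l arrow \<Rightarrow> complex set" where
  "right_side m a = (case a of (t, h, l) \<Rightarrow> side m a (circle_arc m t h))"

definition regions :: "'l arrow set \<Rightarrow> complex set set" where
  "regions D = components (cball 0 1 - (\<Union>a\<in>D. chord (2 * card D) a))"

definition planar :: "'l arrow set \<Rightarrow> bool" where
  "planar D \<longleftrightarrow>
     (\<forall>a\<in>D. \<forall>b\<in>D. a \<noteq> b \<longrightarrow> chord (2 * card D) a \<inter> chord (2 * card D) b = {})"

text \<open>Only the values of \<open>\<nu>\<close> on \<open>regions D\<close> are meaningful; see \<open>pres_equiv\<close>.\<close>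

definition chain_presentation :: "unit arrow set \<times> (complex set \<Rightarrow> nat) \<Rightarrow> bool" where
  "chain_presentation = (\<lambda>(D, \<nu>). wf_diag D \<and> planar D \<and>
     bij_betw \<nu> (regions D) {1..card D + 1} \<and>
     (\<forall>a\<in>D. \<forall>P\<in>regions D. \<forall>Q\<in>regions D.
        P \<subseteq> left_side (2 * card D) a \<and> Q \<subseteq> right_side (2 * card D) a \<and>
        chord (2 * card D) a \<subseteq> closure P \<and> chord (2 * card D) a \<subseteq> closure Q
        \<longrightarrow> \<nu> P < \<nu> Q))"

text \<open>
  Planar isotopy.  With the endpoints placed at roots of unity, two chain presentations are
  isotopic iff a rotation of the disc carries one to the other, regions and numbers included.
\<close>

definition pres_equiv ::
  "unit arrow set \<times> (complex set \<Rightarrow> nat) \<Rightarrow> unit arrow set \<times> (complex set \<Rightarrow> nat) \<Rightarrow> bool" where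
  "pres_equiv = (\<lambda>(D, \<nu>) (D', \<nu>'). chain_presentation (D, \<nu>) \<and> chain_presentation (D', \<nu>') \<and>
     (\<exists>r. D' = rot r D \<and>
        (\<forall>P\<in>regions D. \<nu>' ((*) (pt (2 * card D) r) ` P) = \<nu> P)))"

lemma pt_0 [simp]: "pt m 0 = 1"
  by (simp add: pt_def)

lemma pt_nonzero [simp]: "pt m k \<noteq> 0"
  by (simp add: pt_def)

lemma norm_pt [simp]: "norm (pt m k) = 1"
  by (simp add: pt_def)

lemma pt_add: "pt m (j + k) = pt m j * pt m k"
  by (simp add: pt_def cis_mult add_divide_distrib distrib_left)

lemma pt_mult [simp]: "pt m (m * k) = 1"
proof (cases "m = 0")
  case False
  then have "2 * pi * real (m * k) / real m = 2 * pi * of_int (int k)" by simp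
  then show ?thesis by (simp add: pt_def cis_multiple_2pi)
qed (simp add: pt_def)

lemma pt_mod [simp]: "pt m (k mod m) = pt m k"
  using pt_add[of m "m * (k div m)" "k mod m"] by simp

lemma chord_rot: "chord m ((t + r) mod m, (h + r) mod m, l) = (*) (pt m r) ` chord m (t, h, l')"
proof -
  have "linear ((*) (pt m r))" by (intro bounded_linear.linear bounded_linear_mult_right)
  from closed_segment_linear_image[OF this, of "pt m t" "pt m h"] show ?thesis
    by (simp add: chord_def pt_add mult.commute)
qed

lemma connected_component_mult:
  assumes "norm (c :: complex) = 1"
  shows "connected_component_set ((*) c ` S) (c * w) = (*) c ` connected_component_set S w"
proof -
  have 1: "connected_component ((*) d ` T) (d * x) (d * y)"
    if xy: "connected_component T x y" for d x y :: complex and T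
  proof -
    obtain A where A: "connected A" "A \<subseteq> T" "x \<in> A" "y \<in> A"
      using xy unfolding connected_component_def by blast
    have "connected ((*) d ` A)"
      by (rule connected_continuous_image[OF _ A(1)]) (intro continuous_intros)
    then show ?thesis
      unfolding connected_component_def using A(2-4) by blast
  qed
  have c: "c \<noteq> 0" using assms by auto
  show ?thesis
  proof (intro equalityI subsetI)
    fix z assume "z \<in> connected_component_set ((*) c ` S) (c * w)"
    from 1[OF this[simplified], of "inverse c"] have "connected_component S w (inverse c * z)"
      using c by (simp add: image_image mult.assoc[symmetric])
    then show "z \<in> (*) c ` connected_component_set S w"
      using c by (auto intro!: image_eqI[of _ _ "inverse c * z"])
  qed (use 1 in auto)
qed

lemma disc_mult: "norm (c :: complex) = 1 \<Longrightarrow> (*) c ` (cball 0 1 - S) = cball 0 1 - (*) c ` S"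
proof -
  assume c: "norm c = 1"
  then have nz: "c \<noteq> 0" by auto
  have "(*) c ` cball 0 1 = cball 0 1"
  proof (intro equalityI subsetI)
    fix z :: complex assume "z \<in> cball 0 1"
    then show "z \<in> (*) c ` cball 0 1"
      using c nz by (intro image_eqI[of _ _ "z / c"]) (auto simp: norm_divide)
  qed (use c in \<open>auto simp: norm_mult\<close>)
  then show ?thesis using nz by (simp add: image_set_diff inj_on_def)
qed

lemma int_steps:
  assumes "p < m"
  shows "int (steps m p q) = (int q - int p) mod int m"
proof -
  have "int (q + m - p) = (int q - int p) + int m" using assms by simp
  then show ?thesis unfolding steps_def zmod_int by (metis mod_add_self2)
qed

lemma steps_mod:
  assumes "p < m"
  shows "steps m ((p + r) mod m) ((q + r) mod m) = steps m p q"
proof -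
  have "int (steps m ((p + r) mod m) ((q + r) mod m)) = int (steps m p q)"
    using assms by (simp add: int_steps zmod_int mod_diff_eq)
  then show ?thesis by simp
qed

lemma circle_arc_rot:
  assumes "p < m"
  shows "circle_arc m ((p + r) mod m) ((q + r) mod m) = (*) (pt m r) ` circle_arc m p q"
  unfolding circle_arc_def steps_mod[OF assms] setcompr_eq_image image_image
  by (simp add: pt_add mult_ac)

lemma side_rot:
  "side m ((t + r) mod m, (h + r) mod m, l) ((*) (pt m r) ` C) = (*) (pt m r) ` side m (t, h, l') C"
  unfolding side_def chord_rot[of m t r h l l'] disc_mult[OF norm_pt, symmetric]
  by (simp add: connected_component_mult image_UN)

lemma sides_rot:
  assumes "t < m" "h < m"
  shows "left_side m ((t + r) mod m, (h + r) mod m, l) = (*) (pt m r) ` left_side m (t, h, l)"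
    and "right_side m ((t + r) mod m, (h + r) mod m, l) = (*) (pt m r) ` right_side m (t, h, l)"
  unfolding left_side_def right_side_def by (simp_all add: circle_arc_rot assms side_rot[where l' = l])

lemma regions_rot:
  assumes "wf_diag D"
  shows "regions (rot r D) = image ((*) (pt (2 * card D) r)) ` regions D"
proof -
  let ?m = "2 * card D" let ?c = "pt ?m r"
  have "(\<Union>a\<in>rot r D. chord ?m a) = (\<Union>a\<in>D. (*) ?c ` chord ?m a)"
    unfolding rot_def relabel_def image_image
  proof (rule arg_cong[where f = Union], rule image_cong[OF refl])
    fix a assume "a \<in> D"
    obtain t h l where a: "a = (t, h, l)" by (cases a) auto
    show "chord ?m (case a of (t, h, l) \<Rightarrow> ((t + r) mod ?m, (h + r) mod ?m, l)) = (*) ?c ` chord ?m a"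
      by (simp only: a prod.case chord_rot[of _ _ _ _ _ l])
  qed
  also have "\<dots> = (*) ?c ` (\<Union>a\<in>D. chord ?m a)" by (rule image_UN[symmetric])
  finally show ?thesis
    unfolding regions_def card_rot[OF assms]
    by (auto simp: disc_mult[symmetric] components_def connected_component_mult image_image)
qed

lemma pres_equiv_iff:
  "pres_equiv (D, \<nu>) (D', \<nu>') \<longleftrightarrow>
     chain_presentation (D, \<nu>) \<and> chain_presentation (D', \<nu>') \<and>
     (\<exists>r. D' = rot r D \<and> (\<forall>P\<in>regions D. \<nu>' ((*) (pt (2 * card D) r) ` P) = \<nu> P))"
  by (simp add: pres_equiv_def)

lemma chain_wf: "chain_presentation (D, \<nu>) \<Longrightarrow> wf_diag D"
  by (simp add: chain_presentation_def)

lemma pt_inverse: "pt m ((m - 1) * r) * pt m r = 1"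
proof (cases m)
  case 0
  then show ?thesis by (simp add: pt_def)
next
  case (Suc k)
  then have "(m - 1) * r + r = m * r" by (simp add: algebra_simps)
  then show ?thesis by (metis pt_add pt_mult)
qed

lemma part_equivp_pres_equiv: "part_equivp pres_equiv"
proof (rule part_equivpI)
  have "components (cball (0 :: complex) 1) = {cball 0 1}"
    by (simp add: components_eq_sing_iff convex_connected)
  then have "chain_presentation ({}, \<lambda>_. 1)"
    by (simp add: chain_presentation_def wf_diag_def endpoints_def planar_def regions_def bij_betw_def)
  then show "\<exists>x. pres_equiv x x"
    by (intro exI[of _ "({}, \<lambda>_. 1)"])
       (auto simp: pres_equiv_iff rot_def relabel_def)
  show "symp pres_equiv"
  proof (rule sympI, clarify)
    fix D \<nu> D' \<nu>' assume "pres_equiv (D, \<nu>) (D', \<nu>')"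
    then obtain r where *: "chain_presentation (D, \<nu>)" "chain_presentation (D', \<nu>')"
      "D' = rot r D" "\<And>P. P \<in> regions D \<Longrightarrow> \<nu>' ((*) (pt (2 * card D) r) ` P) = \<nu> P"
      by (auto simp: pres_equiv_iff)
    note wf = chain_wf[OF *(1)]
    let ?m = "2 * card D" let ?s = "(?m - 1) * r"
    have "\<nu> ((*) (pt ?m ?s) ` P') = \<nu>' P'" if P': "P' \<in> regions D'" for P'
    proof -
      obtain P where P: "P \<in> regions D" "P' = (*) (pt ?m r) ` P"
        using P' by (auto simp: *(3) regions_rot[OF wf])
      have "(*) (pt ?m ?s) ` P' = P"
        by (simp only: P(2) image_image mult.assoc[symmetric] pt_inverse) simp
      then show ?thesis by (simp add: *(4)[OF P(1)] P(2))
    qed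
    moreover have "D = rot ?s D'" by (simp only: *(3) rot_inverse[OF wf])
    moreover have "card D' = card D" by (simp only: *(3) card_rot[OF wf])
    ultimately show "pres_equiv (D', \<nu>') (D, \<nu>)"
      unfolding pres_equiv_iff using *(1,2) by (intro conjI exI[of _ ?s]) simp_all
  qed
  show "transp pres_equiv"
  proof (rule transpI, clarify)
    fix D1 \<nu>1 D2 \<nu>2 D3 \<nu>3
    assume "pres_equiv (D1, \<nu>1) (D2, \<nu>2)" "pres_equiv (D2, \<nu>2) (D3, \<nu>3)"
    then obtain r s where *: "chain_presentation (D1, \<nu>1)" "chain_presentation (D3, \<nu>3)"
      "D2 = rot r D1" "\<And>P. P \<in> regions D1 \<Longrightarrow> \<nu>2 ((*) (pt (2 * card D1) r) ` P) = \<nu>1 P"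
      "D3 = rot s D2" "\<And>P. P \<in> regions D2 \<Longrightarrow> \<nu>3 ((*) (pt (2 * card D2) s) ` P) = \<nu>2 P"
      by (auto simp: pres_equiv_iff)
    note wf = chain_wf[OF *(1)]
    let ?m = "2 * card D1"
    have m: "card D2 = card D1" by (simp only: *(3) card_rot[OF wf])
    have "\<nu>3 ((*) (pt ?m (r + s)) ` P) = \<nu>1 P" if P: "P \<in> regions D1" for P
    proof -
      have "(*) (pt ?m (r + s)) ` P = (*) (pt ?m s) ` (*) (pt ?m r) ` P"
        by (simp add: image_image pt_add mult_ac)
      moreover have "(*) (pt ?m r) ` P \<in> regions D2" using P by (simp add: *(3) regions_rot[OF wf])
      ultimately show ?thesis using *(4)[OF P] *(6) m by simp
    qed
    moreover have "D3 = rot (r + s) D1" by (simp only: *(3,5) rot_rot[OF wf])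
    ultimately show "pres_equiv (D1, \<nu>1) (D3, \<nu>3)"
      unfolding pres_equiv_iff using *(1,2) by blast
  qed
qed

quotient_type chain = "unit arrow set \<times> (complex set \<Rightarrow> nat)" / partial: pres_equiv
  by (rule part_equivp_pres_equiv)

lift_definition chain_degree :: "chain \<Rightarrow> nat" is "\<lambda>(D, \<nu>). card D"
  by (auto simp: pres_equiv_iff) (metis card_rot chain_wf)

definition substitute ::
  "(nat \<Rightarrow> int) \<Rightarrow> unit arrow set \<times> (complex set \<Rightarrow> nat) \<Rightarrow> int arrow set" where
  "substitute \<gamma> = (\<lambda>(D, \<nu>).
     (\<lambda>(t, h, u). (t, h, \<Sum>P | P \<in> regions D \<and> P \<subseteq> left_side (2 * card D) (t, h, u). \<gamma> (\<nu> P))) ` D)"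

lemma card_substitute: "card (substitute \<gamma> (D, \<nu>)) = card D"
  unfolding substitute_def by (simp, rule card_image) (auto simp: inj_on_def)

lemma wf_substitute: "wf_diag D \<Longrightarrow> wf_diag (substitute \<gamma> (D, \<nu>))"
  unfolding wf_diag_def card_substitute
  by (simp add: substitute_def endpoints_def case_prod_unfold)

lemma wf_diag_less: "wf_diag D \<Longrightarrow> (t, h, l) \<in> D \<Longrightarrow> t < 2 * card D \<and> h < 2 * card D"
  using endpointsI[of t h l D] by (simp add: wf_diag_def)

lift_definition chain_diagram :: "(nat \<Rightarrow> int) \<Rightarrow> chain \<Rightarrow> arrow_diagram" is substitute
proof clarify
  fix \<gamma> :: "nat \<Rightarrow> int" and D \<nu> D' \<nu>' assume "pres_equiv (D, \<nu>) (D', \<nu>')"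
  then obtain r where *: "chain_presentation (D, \<nu>)" "chain_presentation (D', \<nu>')"
    "D' = rot r D" "\<And>P. P \<in> regions D \<Longrightarrow> \<nu>' ((*) (pt (2 * card D) r) ` P) = \<nu> P"
    by (auto simp: pres_equiv_iff)
  note wf = chain_wf[OF *(1)]
  let ?m = "2 * card D" let ?c = "pt ?m r"
  have m: "card D' = card D" by (simp only: *(3) card_rot[OF wf])
  have inj: "inj ((`) ((*) ?c))" by (rule injI) (simp add: inj_image_eq_iff inj_on_def)
  have sum: "(\<Sum>P | P \<in> regions D' \<and> P \<subseteq> left_side ?m ((t + r) mod ?m, (h + r) mod ?m, u). \<gamma> (\<nu>' P)) =
      (\<Sum>P | P \<in> regions D \<and> P \<subseteq> left_side ?m (t, h, u). \<gamma> (\<nu> P))"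
    if th: "(t, h, u) \<in> D" for t h and u :: unit
  proof -
    have "(*) ?c ` P \<subseteq> (*) ?c ` Q \<longleftrightarrow> P \<subseteq> Q" for P Q
      by (rule inj_image_subset_iff) (simp add: inj_on_def)
    then have "{P. P \<in> regions D' \<and> P \<subseteq> left_side ?m ((t + r) mod ?m, (h + r) mod ?m, u)} =
        (`) ((*) ?c) ` {P. P \<in> regions D \<and> P \<subseteq> left_side ?m (t, h, u)}"
      using wf_diag_less[OF wf th] by (auto simp: *(3) regions_rot[OF wf] sides_rot)
    then show ?thesis
      using *(4) by (simp add: sum.reindex[OF inj_on_subset[OF inj subset_UNIV]])
  qed
  define F where "F = (\<lambda>t h (u :: unit). \<Sum>P | P \<in> regions D \<and> P \<subseteq> left_side ?m (t, h, u). \<gamma> (\<nu> P))"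
  define F' where "F' = (\<lambda>t h (u :: unit). \<Sum>P | P \<in> regions D' \<and> P \<subseteq> left_side ?m (t, h, u). \<gamma> (\<nu>' P))"
  have F: "F' ((t + r) mod ?m) ((h + r) mod ?m) u = F t h u" if "(t, h, u) \<in> D" for t h u
    unfolding F_def F'_def by (rule sum[OF that])
  have "substitute \<gamma> (D', \<nu>') = (\<lambda>(t, h, u). (t, h, F' t h u)) ` D'"
    by (simp only: substitute_def prod.case m F'_def)
  also have "\<dots> = (\<lambda>(t, h, u). (t, h, F' t h u)) ` (\<lambda>(t, h, l). ((t + r) mod ?m, (h + r) mod ?m, l)) ` D"
    by (simp only: *(3) rot_def relabel_def)
  also have "\<dots> = (\<lambda>(t, h, l). ((t + r) mod ?m, (h + r) mod ?m, l)) ` (\<lambda>(t, h, u). (t, h, F t h u)) ` D"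
    unfolding image_image by (rule image_cong) (auto simp: F)
  also have "(\<lambda>(t, h, u). (t, h, F t h u)) ` D = substitute \<gamma> (D, \<nu>)"
    by (simp only: substitute_def prod.case F_def)
  finally have "substitute \<gamma> (D', \<nu>') = rot r (substitute \<gamma> (D, \<nu>))"
    by (simp only: rot_def relabel_def card_substitute)
  then show "rot_equiv (substitute \<gamma> (D, \<nu>)) (substitute \<gamma> (D', \<nu>'))"
    unfolding rot_equiv_def using wf_rot[OF wf_substitute[OF wf]] wf_substitute[OF wf] by metis
qed

lemma chain_presentation_cong:
  assumes "\<And>P. P \<in> regions D \<Longrightarrow> \<nu> P = \<nu>' P"
  shows "chain_presentation (D, \<nu>) \<longleftrightarrow> chain_presentation (D, \<nu>')"
  unfolding chain_presentation_def using assms by (simp cong: bij_betw_cong)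

text \<open>The sum defining \<open>U n\<close> is finite.\<close>

lemma finite_chains: "finite {c. chain_degree c = n}"
proof (rule finite_subset)
  define \<D> where "\<D> = {D :: unit arrow set. D \<subseteq> {..<2 * n} \<times> {..<2 * n} \<times> UNIV \<and> finite (regions D)}"
  show "finite (abs_chain ` (SIGMA D:\<D>. PiE (regions D) (\<lambda>_. {1..n + 1})))"
    unfolding \<D>_def by (intro finite_imageI finite_SigmaI finite_PiE) auto
  show "{c. chain_degree c = n} \<subseteq> abs_chain ` (SIGMA D:\<D>. PiE (regions D) (\<lambda>_. {1..n + 1}))"
  proof (rule subsetI, drule CollectD)
    fix c assume n: "chain_degree c = n"
    obtain D \<nu> where c: "c = abs_chain (D, \<nu>)" "pres_equiv (D, \<nu>) (D, \<nu>)"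
      by (metis Quotient_chain Quotient_rep_reflp Quotient_abs_rep surj_pair)
    then have chain: "chain_presentation (D, \<nu>)" by (simp add: pres_equiv_iff)
    note wf = chain_wf[OF chain]
    have deg: "card D = n" using n chain_degree.abs_eq[OF c(2)] by (simp add: c(1))
    have bij: "bij_betw \<nu> (regions D) {1..n + 1}" using chain deg by (simp add: chain_presentation_def)
    define \<nu>' where "\<nu>' = restrict \<nu> (regions D)"
    have "chain_presentation (D, \<nu>')"
      using chain chain_presentation_cong[of D \<nu> \<nu>'] by (simp add: \<nu>'_def)
    then have "pres_equiv (D, \<nu>) (D, \<nu>')"
      unfolding pres_equiv_iff using chain
      by (intro conjI exI[of _ 0]) (simp_all add: rot_0[OF wf] \<nu>'_def)
    then have "c = abs_chain (D, \<nu>')"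
      unfolding c(1) by (meson Quotient_rel_abs Quotient_chain)
    moreover have "D \<in> \<D>"
      using wf_diag_less[OF wf] deg bij bij_betw_finite[OF bij] by (auto simp: \<D>_def)
    moreover have "\<nu>' \<in> PiE (regions D) (\<lambda>_. {1..n + 1})"
      using bij by (auto simp: \<nu>'_def bij_betw_def)
    ultimately show "c \<in> abs_chain ` (SIGMA D:\<D>. PiE (regions D) (\<lambda>_. {1..n + 1}))"
      by blast
  qed
qed

definition U :: "nat \<Rightarrow> (chain \<Rightarrow>\<^sub>0 rat)" where
  "U n = (\<Sum>c | chain_degree c = n. Poly_Mapping.single c 1)"

text \<open>
  The integers \<open>\<gamma> 1, \<dots>, \<gamma> (n + 1)\<close> form the collection \<open>\<Gamma>\<close>; the global marking of the
  resulting diagrams is their sum.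
\<close>

definition Phi :: "nat \<Rightarrow> (nat \<Rightarrow> int) \<Rightarrow> (arrow_diagram \<Rightarrow>\<^sub>0 rat)" where
  "Phi n \<gamma> = lin_ext (\<lambda>c. Poly_Mapping.single (chain_diagram \<gamma> c) 1) (U n)"

definition arrow_space :: "nat \<Rightarrow> (arrow_diagram \<Rightarrow>\<^sub>0 rat) set" where
  "arrow_space n = {x. \<forall>A\<in>Poly_Mapping.keys x. diagram_degree A = n}"

end

theory Submission
  imports Defs
begin

text \<open>
  For one fixed drawing of an arrow diagram \<open>A\<close>, let \<open>N A\<close> be the number of numberings of its regions
  that are chain presentations and reproduce the markings of \<open>A\<close>.  Pairing the sum of chains with
  \<open>A\<close> counts classes of such presentations, weighted by the number of rotations that preserve \<open>A\<close>.  Rotations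
  act on the presentations of the fixed drawing, and the action is free: if a nontrivial rotation maps
  every region to itself, then, the regions being convex, the centre of the disc lies in every region, so that
  there is only one region and no arrow (\<open>rot_free\<close>).  The pairing with \<open>A\<close> is therefore \<open>N A\<close> itself (\<open>pairing_Phi\<close>).
  Summing over signs and over subdiagrams, the function in question sends a Gauss diagram \<open>D\<close> to a
  state sum: the sum, over the sets \<open>B\<close> of \<open>n\<close> arrows of \<open>D\<close>, of the product of the signs in \<open>B\<close>
  times \<open>N B\<close> (\<open>state_sum\<close>).

  The number \<open>N A\<close> is combinatorial.  A chord is the trace of a line on the disc, so the regions are
  the convex cells of an arrangement of lines, and a region is determined by the set of arrows that
  have it on their left.  In a planar drawing these are the sets belonging to the arcs of the circle,
  and the two regions along an arrow are those whose sets differ in that arrow alone.  This rewrites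
  \<open>N\<close> as \<open>chain_count\<close> (\<open>card_presentations\<close>), which depends only on the cyclic order of the endpoints.

  Now the relators and moves.  An arrow with consecutive endpoints cuts off one region, with some number
  \<open>i\<close>; its marking is \<open>\<gamma> i\<close> or \<open>K - \<gamma> i\<close> and therefore, as \<open>\<gamma> i\<close> is not \<open>0\<close>, never \<open>0\<close> respectively
  \<open>K\<close> (\<open>chain_count_isolated\<close>).
  Between two parallel arrows lies one strip, and their markings differ by its weight \<open>\<gamma> i\<close>, which is
  not \<open>0\<close> (\<open>chain_count_parallel\<close>).  So states with such arrows vanish, and the states with one of the two
  arrows of a second move cancel in pairs.

  In a third move, any two of the three arrows cross on one side, and on the other side the three arrows
  bound a triangle.  A state with all three arrows around the triangle vanishes, because the triangle
  condition would force the region in the middle to have weight \<open>0\<close>.  In a state with two of them, the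
  triangle is merged with the region behind the missing arrow.  So the three kinds of states have the same
  regions, and by the triangle condition the same marking conditions; they differ in the order of the
  numbers of the three regions \<open>X\<close>, \<open>Y\<close>, \<open>Z\<close> around the triangle.  One kind requires, say, \<open>Z < X\<close> and
  \<open>Z < Y\<close>, the others \<open>Z < X < Y\<close> and \<open>Z < Y < X\<close>, and the first kind is counted with the opposite sign
  (\<open>three_pairs\<close>, \<open>R3_local\<close>).
\<close>

section \<open>Regions of an arrow diagram as sets of arrows\<close>

text \<open>
  Gap \<open>k\<close> of the circle lies just before position \<open>k\<close>; gap \<open>0\<close> and all gaps beyond the last position are
  the same arc.  The condition says that the gap lies on the arc from the head \<open>h\<close> to the tail \<open>t\<close>, which bounds
  the left side of the arrow.
\<close>

definition gap_left :: "nat \<Rightarrow> nat \<Rightarrow> nat \<Rightarrow> bool" where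
  "gap_left t h k \<longleftrightarrow> (if h < t then h < k \<and> k \<le> t else \<not> (t < k \<and> k \<le> h))"

text \<open>
  The region at a gap, recorded by the tails of the arrows that have it on their left.  Tails identify
  the arrows whatever their labels are, so that signed, marked and naked diagrams have the same regions.
\<close>

definition reg :: "'l arrow set \<Rightarrow> nat \<Rightarrow> nat set" where
  "reg B k = {t. \<exists>h l. (t, h, l) \<in> B \<and> gap_left t h k}"

definition regs :: "'l arrow set \<Rightarrow> nat set set" where
  "regs B = range (reg B)"

text \<open>
  Away from the endpoints of the first arrow, a position \<open>k\<close> is on the same side as gap \<open>k\<close>.
\<close>

definition noncrossing :: "'l arrow set \<Rightarrow> bool" where
  "noncrossing B \<longleftrightarrow> (\<forall>t h l t' h' l'. (t, h, l) \<in> B \<longrightarrow> (t', h', l') \<in> B \<longrightarrow>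
     (t, h) \<noteq> (t', h') \<longrightarrow> gap_left t h t' = gap_left t h h')"

text \<open>
  The pairs of regions along one arrow, the region on the left first.
\<close>

definition neighbours :: "nat set set \<Rightarrow> (nat set \<times> nat set) set" where
  "neighbours T = {(R, R'). R \<in> T \<and> R' \<in> T \<and> (\<exists>t\<in>R. R' = R - {t})}"

definition marking_conds :: "int arrow set \<Rightarrow> (nat set set \<times> int) set" where
  "marking_conds B = (\<lambda>(t, h, mk). ({R \<in> regs B. t \<in> R}, mk)) ` B"

text \<open>
  Chain presentations in the abstract: numberings of a set of regions that increase along \<open>Ord\<close> and give
  prescribed weights to certain sets of regions.  Regions are of arbitrary type here: they will be pieces of
  the disc, sets of tails, and nodes common to several diagrams.
\<close>

definition numberings ::
  "(nat \<Rightarrow> int) \<Rightarrow> nat \<Rightarrow> 'r set \<Rightarrow> ('r \<times> 'r) set \<Rightarrow> ('r set \<times> int) set \<Rightarrow> ('r \<Rightarrow> nat) set" where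
  "numberings \<gamma> N T Ord M = {\<nu> \<in> T \<rightarrow>\<^sub>E {1..N}. bij_betw \<nu> T {1..N} \<and>
     (\<forall>(x, y)\<in>Ord. \<nu> x < \<nu> y) \<and> (\<forall>(S, w)\<in>M. (\<Sum>x\<in>S. \<gamma> (\<nu> x)) = w)}"

definition chain_count :: "(nat \<Rightarrow> int) \<Rightarrow> int arrow set \<Rightarrow> nat" where
  "chain_count \<gamma> B = (if noncrossing B
     then card (numberings \<gamma> (card B + 1) (regs B) (neighbours (regs B)) (marking_conds B)) else 0)"

lemma numberings_reindex:
  assumes g: "bij_betw g T T'" and sub: "Ord \<subseteq> T \<times> T" "\<And>S w. (S, w) \<in> M \<Longrightarrow> S \<subseteq> T"
    and \<nu>: "\<nu> \<in> numberings \<gamma> N T' (map_prod g g ` Ord) ((\<lambda>(S, w). (g ` S, w)) ` M)"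
  shows "restrict (\<nu> \<circ> g) T \<in> numberings \<gamma> N T Ord M"
proof -
  have b: "bij_betw \<nu> T' {1..N}" using \<nu> by (simp add: numberings_def)
  have "bij_betw (\<nu> \<circ> g) T {1..N}" using g b by (rule bij_betw_trans)
  then have b2: "bij_betw (restrict (\<nu> \<circ> g) T) T {1..N}" by (simp cong: bij_betw_cong)
  have "(\<Sum>x\<in>S. \<gamma> (restrict (\<nu> \<circ> g) T x)) = w" if "(S, w) \<in> M" for S w
  proof -
    have "inj_on g S" using g sub(2)[OF that] by (meson bij_betw_def inj_on_subset)
    then have "(\<Sum>x\<in>S. \<gamma> (restrict (\<nu> \<circ> g) T x)) = (\<Sum>x\<in>g ` S. \<gamma> (\<nu> x))"
      using sub(2)[OF that] by (subst sum.reindex) (auto intro!: sum.cong)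
    then show ?thesis using \<nu> that by (force simp: numberings_def)
  qed
  then show ?thesis using b2 \<nu> sub(1) bij_betwE[OF b2]
    unfolding numberings_def by fastforce
qed

text \<open>
  The count only sees the regions up to a bijection that carries order and weight conditions along.  Every
  comparison of two diagrams below is an instance.
\<close>

lemma card_numberings_transfer:
  assumes g: "bij_betw g T T'" and sub: "Ord \<subseteq> T \<times> T" "\<And>S w. (S, w) \<in> M \<Longrightarrow> S \<subseteq> T"
  shows "card (numberings \<gamma> N T' (map_prod g g ` Ord) ((\<lambda>(S, w). (g ` S, w)) ` M)) =
    card (numberings \<gamma> N T Ord M)"
proof -
  let ?h = "inv_into T g" let ?O = "map_prod g g ` Ord" let ?M = "(\<lambda>(S, w). (g ` S, w)) ` M"
  have inj: "inj_on g T" and im: "g ` T = T'" using g by (auto simp: bij_betw_def)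
  have h: "bij_betw ?h T' T" by (rule bij_betw_inv_into[OF g])
  have hh: "?h ` g ` S = S" if "S \<subseteq> T" for S using inv_into_image_cancel[OF inj that] .
  have O: "map_prod ?h ?h ` ?O = Ord"
  proof -
    have "map_prod ?h ?h (map_prod g g x) = x" if "x \<in> Ord" for x
      using that sub(1) inv_into_f_f[OF inj] by (cases x) auto
    then show ?thesis by (simp add: image_image)
  qed
  have M: "(\<lambda>(S, w). (?h ` S, w)) ` ?M = M"
  proof -
    have "(\<lambda>(S, w). (?h ` S, w)) ((\<lambda>(S, w). (g ` S, w)) x) = x" if "x \<in> M" for x
      using that sub(2) hh by (cases x) auto
    then show ?thesis by (simp add: image_image)
  qed
  have 1: "restrict (\<nu> \<circ> g) T \<in> numberings \<gamma> N T Ord M" if "\<nu> \<in> numberings \<gamma> N T' ?O ?M" for \<nu>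
    using numberings_reindex[OF g sub that] .
  have 2: "restrict (\<nu> \<circ> ?h) T' \<in> numberings \<gamma> N T' ?O ?M" if "\<nu> \<in> numberings \<gamma> N T Ord M" for \<nu>
  proof (rule numberings_reindex[OF h])
    show "?O \<subseteq> T' \<times> T'" using sub(1) im by auto
    show "S \<subseteq> T'" if "(S, w) \<in> ?M" for S w using that sub(2) im by auto
    show "\<nu> \<in> numberings \<gamma> N T (map_prod ?h ?h ` ?O) ((\<lambda>(S, w). (?h ` S, w)) ` ?M)"
      unfolding O M using that .
  qed
  have "bij_betw (\<lambda>\<nu>. restrict (\<nu> \<circ> g) T) (numberings \<gamma> N T' ?O ?M) (numberings \<gamma> N T Ord M)"
  proof (rule bij_betw_byWitness[where f' = "\<lambda>\<nu>. restrict (\<nu> \<circ> ?h) T'"])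
    show "\<forall>\<nu>\<in>numberings \<gamma> N T' ?O ?M. restrict (restrict (\<nu> \<circ> g) T \<circ> ?h) T' = \<nu>"
    proof (intro ballI)
      fix \<nu> assume "\<nu> \<in> numberings \<gamma> N T' ?O ?M"
      then have e: "\<nu> \<in> extensional T'" by (auto simp: numberings_def PiE_def)
      show "restrict (restrict (\<nu> \<circ> g) T \<circ> ?h) T' = \<nu>"
        by (rule extensionalityI[OF restrict_extensional e])
           (use bij_betwE[OF h] bij_betw_inv_into_right[OF g] in auto)
    qed
    show "\<forall>\<nu>\<in>numberings \<gamma> N T Ord M. restrict (restrict (\<nu> \<circ> ?h) T' \<circ> g) T = \<nu>"
    proof (intro ballI)
      fix \<nu> assume "\<nu> \<in> numberings \<gamma> N T Ord M"
      then have e: "\<nu> \<in> extensional T" by (auto simp: numberings_def PiE_def)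
      show "restrict (restrict (\<nu> \<circ> ?h) T' \<circ> g) T = \<nu>"
        by (rule extensionalityI[OF restrict_extensional e])
           (use bij_betwE[OF g] bij_betw_inv_into_left[OF g] in auto)
    qed
  qed (use 1 2 in auto)
  then show ?thesis by (rule bij_betw_same_card)
qed

lemma numberings_sum_all:
  assumes "\<nu> \<in> numberings \<gamma> N T Ord M"
  shows "(\<Sum>x\<in>T. \<gamma> (\<nu> x)) = (\<Sum>i = 1..N. \<gamma> i)"
  using assms by (auto simp: numberings_def intro: sum.reindex_bij_betw)

lemma numberings_marking:
  assumes "\<nu> \<in> numberings \<gamma> N T Ord M" "(S, w) \<in> M"
  shows "(\<Sum>x\<in>S. \<gamma> (\<nu> x)) = w"
proof -
  have "\<forall>(S, w)\<in>M. (\<Sum>x\<in>S. \<gamma> (\<nu> x)) = w" using assms(1) unfolding numberings_def by simp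
  from bspec[OF this assms(2)] show ?thesis by simp
qed

lemma numberings_range: "\<nu> \<in> numberings \<gamma> N T Ord M \<Longrightarrow> x \<in> T \<Longrightarrow> \<nu> x \<in> {1..N}"
  unfolding numberings_def PiE_def by auto

lemma numberings_finite: "\<nu> \<in> numberings \<gamma> N T Ord M \<Longrightarrow> finite T"
  unfolding numberings_def using bij_betw_finite by blast

lemma gap_left_Suc: "k \<noteq> t \<Longrightarrow> k \<noteq> h \<Longrightarrow> gap_left t h (Suc k) = gap_left t h k"
  by (auto simp: gap_left_def)

section \<open>Half discs cut off by chords\<close>

text \<open>
  Twice the signed area of the triangle formed by the tail, the head and \<open>z\<close>: positive to the left of the
  line of the arrow.
\<close>

definition line_fun :: "nat \<Rightarrow> nat \<Rightarrow> nat \<Rightarrow> complex \<Rightarrow> real" where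
  "line_fun m t h z = Im ((z - pt m t) * cnj (pt m h - pt m t))"

lemma line_fun_affine:
  "line_fun m t h ((1 - s) *\<^sub>R z + s *\<^sub>R w) = (1 - s) * line_fun m t h z + s * line_fun m t h w"
  by (simp add: line_fun_def algebra_simps)

lemma line_fun_ends [simp]: "line_fun m t h (pt m t) = 0" "line_fun m t h (pt m h) = 0"
  by (simp_all add: line_fun_def algebra_simps)

lemma line_fun_flip: "line_fun m h t z = - line_fun m t h z"
  by (simp add: line_fun_def algebra_simps)

lemma continuous_line_fun: "continuous_on S (line_fun m t h)"
  unfolding line_fun_def by (intro continuous_intros)

text \<open>
  For points of the circle, the area is a product of sines of half the differences of the angles; its sign
  can be read off from the order of the three points.
\<close>

lemma Im_triangle:
  "Im ((cis \<theta> - cis \<alpha>) * cnj (cis \<beta> - cis \<alpha>)) =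
     4 * sin ((\<theta> - \<alpha>) / 2) * sin ((\<beta> - \<alpha>) / 2) * sin ((\<theta> - \<beta>) / 2)"
proof -
  define x y where "x = (\<theta> - \<alpha>) / 2" and "y = (\<beta> - \<alpha>) / 2"
  have xy: "(\<theta> - \<beta>) / 2 = x - y" "\<theta> = \<alpha> + 2 * x" "\<beta> = \<alpha> + 2 * y"
    by (simp_all add: x_def y_def field_simps)
  have "Im ((cis \<theta> - cis \<alpha>) * cnj (cis \<beta> - cis \<alpha>)) = sin (\<theta> - \<beta>) - sin (\<theta> - \<alpha>) - sin (\<alpha> - \<beta>)"
    by (simp add: sin_diff algebra_simps)
  also have "\<dots> = sin (2 * (x - y)) - sin (2 * x) + sin (2 * y)"
    by (simp add: xy algebra_simps)
  also have "\<dots> = 2 * sin (x - y) * (cos (x - y) - cos (x + y))"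
  proof -
    have "sin (2 * x) - sin (2 * y) = 2 * sin (x - y) * cos (x + y)"
      using sin_diff_sin[of "2 * x" "2 * y"] by (simp add: diff_divide_distrib add_divide_distrib)
    then show ?thesis using sin_double[of "x - y"] by (simp add: algebra_simps)
  qed
  also have "cos (x - y) - cos (x + y) = 2 * sin x * sin y"
    by (simp add: cos_diff cos_add)
  finally show ?thesis by (simp add: x_def[symmetric] y_def[symmetric] xy(1) mult_ac)
qed

lemma sgn_sin: "\<bar>x\<bar> < pi \<Longrightarrow> sgn (sin x) = sgn x"
  using sin_gt_zero[of x] sin_gt_zero[of "- x"] by (cases "x = 0"; cases "0 < x") (auto simp: sgn_if)

text \<open>
  Real positions \<open>\<kappa>\<close> cover both the endpoints and the middles of gaps, gap \<open>0\<close> at \<open>\<kappa> = - 1 / 2\<close> included; the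
  range keeps the half angles strictly between \<open>- pi\<close> and \<open>pi\<close>, where the sine has the sign of its argument.
\<close>

lemma sgn_line_fun_cis:
  assumes "t < m" "h < m" "- 1 < \<kappa>" "\<kappa> < m"
  shows "sgn (line_fun m t h (cis (2 * pi * \<kappa> / m))) =
    sgn ((\<kappa> - real t) * (real h - real t) * (\<kappa> - real h))"
proof -
  have m: "0 < real m" using assms(1) by simp
  have *: "sgn (sin ((2 * pi * a / m - 2 * pi * b / m) / 2)) = sgn (a - b)" if "\<bar>a - b\<bar> < m" for a b :: real
  proof -
    have e: "(2 * pi * a / m - 2 * pi * b / m) / 2 = pi * ((a - b) / m)"
      using m by (simp add: field_simps)
    have "\<bar>(a - b) / m\<bar> < 1" using that m by simp
    then have "pi * \<bar>(a - b) / m\<bar> < pi * 1" by (intro mult_strict_left_mono) simp_all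
    then have "\<bar>pi * ((a - b) / m)\<bar> < pi" by (simp add: abs_mult)
    then have "sgn (sin (pi * ((a - b) / m))) = sgn (pi * ((a - b) / m))" by (rule sgn_sin)
    then show ?thesis unfolding e using m by (simp add: sgn_mult sgn_divide)
  qed
  have 0: "t + 1 \<le> m" "h + 1 \<le> m" using assms by auto
  have 1: "\<bar>\<kappa> - real t\<bar> < m" "\<bar>real h - real t\<bar> < m" "\<bar>\<kappa> - real h\<bar> < m"
    using assms 0 by auto
  show ?thesis
    unfolding line_fun_def pt_def Im_triangle by (simp add: sgn_mult *[OF 1(1)] *[OF 1(2)] *[OF 1(3)])
qed

definition gap_pt :: "nat \<Rightarrow> nat \<Rightarrow> complex" where
  "gap_pt m k = cis (2 * pi * (real k - 1 / 2) / m)"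

lemma line_fun_gap_pt:
  assumes "t < m" "h < m" "t \<noteq> h" "k \<le> m"
  shows "0 < line_fun m t h (gap_pt m k) \<longleftrightarrow> gap_left t h k"
    and "line_fun m t h (gap_pt m k) < 0 \<longleftrightarrow> \<not> gap_left t h k"
proof -
  let ?l = "line_fun m t h (gap_pt m k)" let ?x = "real k - 1 / 2"
  have s: "sgn ?l = sgn ((?x - real t) * (real h - real t) * (?x - real h))"
    unfolding gap_pt_def by (rule sgn_line_fun_cis) (use assms in auto)
  have d: "?x - real t > 0 \<longleftrightarrow> t < k" "?x - real t < 0 \<longleftrightarrow> k \<le> t"
    "?x - real h > 0 \<longleftrightarrow> h < k" "?x - real h < 0 \<longleftrightarrow> k \<le> h" by linarith+
  show "0 < ?l \<longleftrightarrow> gap_left t h k"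
    using arg_cong[OF s, of "\<lambda>x. x > 0"] assms(3) d
    by (auto simp: zero_less_mult_iff gap_left_def not_less not_le mult_less_0_iff)
  show "?l < 0 \<longleftrightarrow> \<not> gap_left t h k"
    using arg_cong[OF s, of "\<lambda>x. x < 0"] assms(3) d
    by (auto simp: zero_less_mult_iff gap_left_def not_less not_le mult_less_0_iff)
qed

lemma line_fun_pt:
  assumes "t < m" "h < m" "k < m" "t \<noteq> h" "k \<noteq> t" "k \<noteq> h"
  shows "0 < line_fun m t h (pt m k) \<longleftrightarrow> gap_left t h k"
    and "line_fun m t h (pt m k) < 0 \<longleftrightarrow> \<not> gap_left t h k"
proof -
  let ?l = "line_fun m t h (pt m k)" let ?x = "real k"
  have s: "sgn ?l = sgn ((?x - real t) * (real h - real t) * (?x - real h))"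
    unfolding pt_def using sgn_line_fun_cis[of t m h "real k"] assms by simp
  show "0 < ?l \<longleftrightarrow> gap_left t h k"
    using arg_cong[OF s, of "\<lambda>x. x > 0"] assms(4-6)
    by (auto simp: zero_less_mult_iff gap_left_def not_less not_le mult_less_0_iff)
  show "?l < 0 \<longleftrightarrow> \<not> gap_left t h k"
    using arg_cong[OF s, of "\<lambda>x. x < 0"] assms(4-6)
    by (auto simp: zero_less_mult_iff gap_left_def not_less not_le mult_less_0_iff)
qed

text \<open>
  If two distinct positions had the same point, the area at the middle of gap \<open>0\<close> would vanish, against the sign formula.
\<close>

lemma pt_inj:
  assumes "t < m" "h < m" "pt m t = pt m h" shows "t = h"
proof (rule ccontr)
  assume th: "t \<noteq> h"
  have s: "sgn (line_fun m t h (cis (2 * pi * (- 1 / 2) / m))) =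
    sgn ((- 1 / 2 - real t) * (real h - real t) * (- 1 / 2 - real h))"
    by (rule sgn_line_fun_cis) (use assms in auto)
  have "line_fun m t h z = 0" for z by (simp add: line_fun_def assms(3))
  then show False using s th by (auto simp: sgn_if split: if_splits)
qed

text \<open>
  A point \<open>(1 - r) *\<^sub>R u + r *\<^sub>R v\<close> of the line through two points \<open>u\<close>, \<open>v\<close> of the circle has squared norm
  \<open>1 - 2 * r * (1 - r) * (1 - u \<bullet> v)\<close>, so it lies in the disc only for \<open>0 \<le> r \<le> 1\<close>.
\<close>

lemma chord_iff_line_fun:
  assumes "t < m" "h < m" "t \<noteq> h" "z \<in> cball 0 1"
  shows "z \<in> chord m (t, h, l) \<longleftrightarrow> line_fun m t h z = 0"
proof
  assume "z \<in> chord m (t, h, l)"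
  then show "line_fun m t h z = 0"
    by (auto simp: chord_def in_segment line_fun_affine)
next
  define u v where uv: "u = pt m t" "v = pt m h"
  assume z: "line_fun m t h z = 0"
  have ne: "v - u \<noteq> 0" using pt_inj[OF assms(1,2)] assms(3) uv by auto
  define s where "s = (z - u) / (v - u)"
  have "Im (s * (cmod (v - u))\<^sup>2) = 0"
  proof -
    have "(z - u) * cnj (v - u) = s * ((v - u) * cnj (v - u))" using ne by (simp add: s_def)
    also have "\<dots> = s * (cmod (v - u))\<^sup>2" by (simp only: complex_norm_square)
    finally show ?thesis using z by (simp add: line_fun_def uv)
  qed
  then have "Im s = 0" using ne by simp
  then obtain r where r: "s = of_real r" by (metis complex_is_Real_iff Reals_cases)
  have zr: "z = (1 - r) *\<^sub>R u + r *\<^sub>R v"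
  proof -
    have "z = u + s * (v - u)" using ne by (simp add: s_def)
    then show ?thesis by (simp add: r scaleR_conv_of_real algebra_simps)
  qed
  have nu: "cmod u = 1" "cmod v = 1" by (simp_all add: uv)
  have dot: "u \<bullet> v < 1"
  proof -
    have "0 < (cmod (v - u))\<^sup>2" using ne by simp
    also have "(cmod (v - u))\<^sup>2 = 2 - 2 * (u \<bullet> v)"
      using nu by (simp add: power2_norm_eq_inner inner_diff_left inner_diff_right inner_commute)
         (simp add: power2_norm_eq_inner[symmetric] nu)
    finally show ?thesis by simp
  qed
  have "(cmod z)\<^sup>2 = 1 - 2 * (r * (1 - r)) * (1 - u \<bullet> v)"
  proof -
    have "u \<bullet> u = 1" "v \<bullet> v = 1" using nu by (simp_all add: power2_norm_eq_inner[symmetric])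
    then show ?thesis unfolding zr power2_norm_eq_inner
      by (simp add: inner_add_left inner_add_right inner_commute algebra_simps)
  qed
  moreover have "(cmod z)\<^sup>2 \<le> 1" using assms(4) by (simp add: power_le_one)
  ultimately have "0 \<le> (r * (1 - r)) * (1 - u \<bullet> v)" by simp
  then have "0 \<le> r * (1 - r)" using dot by (simp add: zero_le_mult_iff)
  then have "0 \<le> r" "r \<le> 1" by (auto simp: zero_le_mult_iff)
  then show "z \<in> chord m (t, h, l)" using zr by (auto simp: chord_def in_segment uv)
qed

lemma connected_sign:
  fixes f :: "complex \<Rightarrow> real"
  assumes "connected S" "continuous_on S f" "\<And>z. z \<in> S \<Longrightarrow> f z \<noteq> 0" "z \<in> S" "w \<in> S" "0 < f z"
  shows "0 < f w"
proof (rule ccontr)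
  assume "\<not> 0 < f w"
  then have "f w \<le> 0" by simp
  have "connected (f ` S)" using assms(1,2) by (rule connected_continuous_image[rotated])
  then have "0 \<in> f ` S" using assms(4-6) \<open>f w \<le> 0\<close>
    by (meson connectedD_interval imageI less_imp_le)
  then show False using assms(3) by auto
qed

lemma convex_half: "convex {z \<in> cball 0 1. line_fun m t h z < 0}"
proof -
  have *: "line_fun m t h (u *\<^sub>R x + v *\<^sub>R y) = u * line_fun m t h x + v * line_fun m t h y"
    if "u + v = 1" for u v x y
    using line_fun_affine[of m t h v x y] that by (simp add: eq_diff_eq[symmetric])
  have neg: "convex {z. line_fun m t h z < 0}"
    unfolding convex_def by (auto simp: * intro!: convex_bound_lt)
  have "convex (cball (0::complex) 1 \<inter> {z. line_fun m t h z < 0})"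
    by (intro convex_Int neg) auto
  then show "convex {z \<in> cball 0 1. line_fun m t h z < 0}" by (simp add: Int_def)
qed

text \<open>
  The half disc to the left is convex, hence connected, and the line function has no zero off the chord; so
  the component of any point of the arc from head to tail is this half disc.
\<close>

lemma left_side_half:
  assumes "t < m" "h < m" "t \<noteq> h"
  shows "left_side m (t, h, l) = {z \<in> cball 0 1. 0 < line_fun m t h z}"
proof -
  let ?X = "cball 0 1 - chord m (t, h, l)" let ?H = "{z \<in> cball 0 1. 0 < line_fun m t h z}"
  have m: "0 < real m" using assms by simp
  have X: "?X = {z \<in> cball 0 1. line_fun m t h z \<noteq> 0}"
    using chord_iff_line_fun[OF assms, of _ l] by blast
  have arc: "w \<in> ?H" if w: "w \<in> circle_arc m h t" for w
  proof -
    obtain \<theta> where \<theta>: "w = pt m h * cis \<theta>" "0 < \<theta>" "\<theta> < 2 * pi * real (steps m h t) / m"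
      using w by (auto simp: circle_arc_def)
    have st: "real (steps m h t) = (if h < t then real t - real h else real m + real t - real h)"
      using assms by (auto simp: steps_def mod_if)
    define x where "x = \<theta> * m / (2 * pi)"
    have x: "\<theta> = 2 * pi * x / m" "0 < x" "x < real (steps m h t)"
      using \<theta> m by (auto simp: x_def field_simps)
    (* two names for the same point of the arc, one of which is in the range of the sign formula *)
    have w': "w = cis (2 * pi * (real h + x) / m)" "w = cis (2 * pi * (real h + x - m) / m)"
      unfolding \<theta>(1) pt_def x(1) cis_mult
    proof -
      show "cis (2 * pi * real h / m + 2 * pi * x / m) = cis (2 * pi * (real h + x) / m)"
        by (simp add: add_divide_distrib distrib_left)
      have "2 * pi * (real h + x - m) / m = 2 * pi * real h / m + 2 * pi * x / m - 2 * pi"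
        using m by (simp add: field_simps)
      then show "cis (2 * pi * real h / m + 2 * pi * x / m) = cis (2 * pi * (real h + x - m) / m)"
        using cis_divide[of "2 * pi * real h / m + 2 * pi * x / m" "2 * pi"] by simp
    qed
    have "0 < line_fun m t h w"
    proof (cases "real h + x < m")
      case True
      have "sgn (line_fun m t h w) = sgn ((real h + x - real t) * (real h - real t) * (real h + x - real h))"
        unfolding w'(1) by (rule sgn_line_fun_cis) (use assms True x in auto)
      moreover have "0 < (real h + x - real t) * (real h - real t) * (real h + x - real h)"
        using x st True assms(3) by (cases "h < t") (auto simp: zero_less_mult_iff)
      ultimately show ?thesis by (simp add: sgn_1_pos)
    next
      case False
      have ht: "t < h" using False x(3) st assms by (auto split: if_splits)
      have lt: "real h + x - m < real t" using ht x(3) st by simp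
      have "sgn (line_fun m t h w) =
        sgn ((real h + x - m - real t) * (real h - real t) * (real h + x - m - real h))"
        unfolding w'(2) by (rule sgn_line_fun_cis) (use assms False x lt in auto)
      moreover have "0 < (real h + x - m - real t) * (real h - real t) * (real h + x - m - real h)"
        using lt ht by (auto simp: zero_less_mult_iff mult_less_0_iff)
      ultimately show ?thesis by (simp add: sgn_1_pos)
    qed
    moreover have "norm w = 1" by (simp add: \<theta>(1) norm_mult)
    ultimately show ?thesis by simp
  qed
  have comp: "connected_component_set ?X w = ?H" if w: "w \<in> ?H" for w
  proof
    show "?H \<subseteq> connected_component_set ?X w"
      by (rule connected_component_maximal[OF w])
         (use convex_half[of m h t] in \<open>auto simp: X line_fun_flip[of m h t] convex_connected\<close>)
    show "connected_component_set ?X w \<subseteq> ?H"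
    proof
      fix z assume z: "z \<in> connected_component_set ?X w"
      have "0 < line_fun m t h z"
      proof (rule connected_sign[of "connected_component_set ?X w"])
        show "line_fun m t h y \<noteq> 0" if "y \<in> connected_component_set ?X w" for y
          using that connected_component_subset[of ?X w] by (auto simp: X)
        show "w \<in> connected_component_set ?X w" using w by (auto simp: X)
      qed (use w z continuous_line_fun in auto)
      then show "z \<in> ?H" using z connected_component_subset[of ?X w] by auto
    qed
  qed
  have "circle_arc m h t \<noteq> {}"
  proof -
    have "0 < steps m h t" using assms by (auto simp: steps_def mod_if)
    then have "pt m h * cis (pi * real (steps m h t) / m) \<in> circle_arc m h t"
      unfolding circle_arc_def using m
      by (intro CollectI exI[of _ "pi * real (steps m h t) / m"]) (auto simp: field_simps)
    then show ?thesis by blast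
  qed
  then show ?thesis unfolding left_side_def side_def using comp arc by auto
qed

lemma right_side_half:
  assumes "t < m" "h < m" "t \<noteq> h"
  shows "right_side m (t, h, l) = {z \<in> cball 0 1. line_fun m t h z < 0}"
proof -
  have "right_side m (t, h, l) = left_side m (h, t, l)"
    by (simp add: right_side_def left_side_def side_def chord_def closed_segment_commute)
  then show ?thesis using left_side_half[of h m t l] assms by (simp add: line_fun_flip[of m h t])
qed

section \<open>Regions of a planar drawing\<close>

lemma noncrossingD:
  "noncrossing B \<Longrightarrow> (t, h, l) \<in> B \<Longrightarrow> (t', h', l') \<in> B \<Longrightarrow> (t, h) \<noteq> (t', h') \<Longrightarrow>
    gap_left t h t' = gap_left t h h'"
  unfolding noncrossing_def by blast

lemma noncrossingI:
  assumes "\<And>t h l t' h' l'. (t, h, l) \<in> B \<Longrightarrow> (t', h', l') \<in> B \<Longrightarrow> (t, h) \<noteq> (t', h') \<Longrightarrow>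
    gap_left t h t' = gap_left t h h'"
  shows "noncrossing B"
  unfolding noncrossing_def using assms by blast

text \<open>
  Two arrows that shared an endpoint, or an arrow with equal ends, would leave fewer endpoints than twice
  the number of arrows.
\<close>

lemma wf_diag_distinct:
  assumes "wf_diag D" "(t, h, l) \<in> D" "(t', h', l') \<in> D"
  shows "t \<noteq> h" and "(t, h, l) \<noteq> (t', h', l') \<Longrightarrow> {t, h} \<inter> {t', h'} = {}"
proof -
  have "card (endpoints {(t, h, l)}) = 2 * card {(t, h, l)}"
    by (rule card_endpoints_sub[OF assms(1)]) (use assms in auto)
  then show th: "t \<noteq> h" by (auto simp: endpoints_def card_insert_if split: if_splits)
  assume ne: "(t, h, l) \<noteq> (t', h', l')"
  have "card (endpoints {(t, h, l), (t', h', l')}) = 2 * card {(t, h, l), (t', h', l')}"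
    by (rule card_endpoints_sub[OF assms(1)]) (use assms in auto)
  also have "\<dots> = 4" using ne by simp
  finally have "card {t, h, t', h'} = 4" by (simp add: endpoints_def insert_commute)
  then show "{t, h} \<inter> {t', h'} = {}" by (auto simp: card_insert_if split: if_splits)
qed

lemma wf_diag_tail_unique:
  assumes "wf_diag D" "(t, h, l) \<in> D" "(t, h', l') \<in> D"
  shows "h' = h" "l' = l"
  using wf_diag_distinct(2)[OF assms] by auto

lemma line_fun_between:
  assumes "0 \<le> s" "s \<le> 1"
  shows "0 < line_fun m t h z \<Longrightarrow> 0 < line_fun m t h w \<Longrightarrow> 0 < line_fun m t h ((1 - s) *\<^sub>R z + s *\<^sub>R w)"
    and "line_fun m t h z < 0 \<Longrightarrow> line_fun m t h w < 0 \<Longrightarrow> line_fun m t h ((1 - s) *\<^sub>R z + s *\<^sub>R w) < 0"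
proof -
  have *: "0 < (1 - s) * x + s * y" if "0 < x" "0 < y" for x y :: real
    using that assms by (cases "s = 0") (auto intro!: add_nonneg_pos)
  show "0 < line_fun m t h z \<Longrightarrow> 0 < line_fun m t h w \<Longrightarrow> 0 < line_fun m t h ((1 - s) *\<^sub>R z + s *\<^sub>R w)"
    unfolding line_fun_affine by (rule *)
  show "line_fun m t h z < 0 \<Longrightarrow> line_fun m t h w < 0 \<Longrightarrow> line_fun m t h ((1 - s) *\<^sub>R z + s *\<^sub>R w) < 0"
    unfolding line_fun_affine using *[of "- line_fun m t h z" "- line_fun m t h w"] by simp
qed

lemma cball_between:
  fixes z w :: complex
  assumes "0 \<le> s" "s \<le> 1" "z \<in> cball 0 1" "w \<in> cball 0 1"
  shows "(1 - s) *\<^sub>R z + s *\<^sub>R w \<in> cball 0 1"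
  using convex_cball[of "0 :: complex" 1] assms unfolding convex_alt by blast

definition chord_free :: "'l arrow set \<Rightarrow> complex set" where
  "chord_free D = cball 0 1 - (\<Union>a\<in>D. chord (2 * card D) a)"

text \<open>
  The analogue of \<open>reg\<close> for a point of the disc, and below that for a subset of the disc.
\<close>

definition left_tails :: "'l arrow set \<Rightarrow> complex \<Rightarrow> nat set" where
  "left_tails D z = {t. \<exists>h l. (t, h, l) \<in> D \<and> 0 < line_fun (2 * card D) t h z}"

definition region_tails :: "'l arrow set \<Rightarrow> complex set \<Rightarrow> nat set" where
  "region_tails D P = {t. \<exists>h l. (t, h, l) \<in> D \<and> P \<subseteq> left_side (2 * card D) (t, h, l)}"

text \<open>
  A diagram together with its number of positions, which all the geometric notions depend on.
\<close>

locale drawn_diagram =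
  fixes D :: "'l arrow set" and m :: nat
  assumes wf: "wf_diag D" and m: "m = 2 * card D"
begin

lemma ends: "(t, h, l) \<in> D \<Longrightarrow> t < m" "(t, h, l) \<in> D \<Longrightarrow> h < m" "(t, h, l) \<in> D \<Longrightarrow> t \<noteq> h"
  using wf_diag_less[OF wf] wf_diag_distinct(1)[OF wf] unfolding m by blast+

lemma tail_uniq: "(t, h, l) \<in> D \<Longrightarrow> (t, h', l') \<in> D \<Longrightarrow> h' = h \<and> l' = l"
  using wf_diag_tail_unique[OF wf] by blast

lemma chord_iff:
  "(t, h, l) \<in> D \<Longrightarrow> z \<in> cball 0 1 \<Longrightarrow> z \<in> chord m (t, h, l) \<longleftrightarrow> line_fun m t h z = 0"
  by (rule chord_iff_line_fun[OF ends])

lemma left_half: "(t, h, l) \<in> D \<Longrightarrow> left_side m (t, h, l) = {z \<in> cball 0 1. 0 < line_fun m t h z}"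
  by (rule left_side_half[OF ends])

lemma right_half: "(t, h, l) \<in> D \<Longrightarrow> right_side m (t, h, l) = {z \<in> cball 0 1. line_fun m t h z < 0}"
  by (rule right_side_half[OF ends])

lemma chord_sub: "chord m a \<subseteq> cball 0 1"
  by (cases a) (simp add: chord_def closed_segment_subset)

lemma chord_free_iff:
  "z \<in> chord_free D \<longleftrightarrow> z \<in> cball 0 1 \<and> (\<forall>(t, h, l)\<in>D. line_fun m t h z \<noteq> 0)"
proof -
  show ?thesis using chord_iff[of _ _ _ z] unfolding chord_free_def m[symmetric] by fast
qed

lemma left_tails_iff: "(t, h, l) \<in> D \<Longrightarrow> t \<in> left_tails D z \<longleftrightarrow> 0 < line_fun m t h z"
  unfolding left_tails_def m[symmetric] using tail_uniq by blast

lemma left_tails_sub: "left_tails D z \<subseteq> fst ` D"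
  unfolding left_tails_def by force

lemma reg_iff: "(t, h, l) \<in> D \<Longrightarrow> t \<in> reg D k \<longleftrightarrow> gap_left t h k"
  unfolding reg_def using tail_uniq by blast

lemma reg_sub: "reg D k \<subseteq> fst ` D"
  unfolding reg_def by force

lemma tails_eqI:
  assumes "A \<subseteq> fst ` D" "B \<subseteq> fst ` D" "\<And>t h l. (t, h, l) \<in> D \<Longrightarrow> t \<in> A \<longleftrightarrow> t \<in> B"
  shows "A = B"
proof -
  have "t \<in> A \<longleftrightarrow> t \<in> B" if t: "t \<in> fst ` D" for t
  proof -
    obtain h l where "(t, h, l) \<in> D" using t by (metis imageE prod.collapse)
    then show ?thesis by (rule assms(3))
  qed
  then show ?thesis using assms(1,2) by blast
qed

lemma convex_cell: "convex {w \<in> chord_free D. left_tails D w = T}" (is "convex ?cell")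
  unfolding convex_alt
proof (intro ballI allI impI, elim conjE)
  fix v w and s :: real assume v: "v \<in> ?cell" and w: "w \<in> ?cell" and s: "0 \<le> s" "s \<le> 1"
  let ?y = "(1 - s) *\<^sub>R v + s *\<^sub>R w"
  have *: "line_fun m t h ?y \<noteq> 0 \<and> (0 < line_fun m t h ?y \<longleftrightarrow> 0 < line_fun m t h v)"
    if a: "(t, h, l) \<in> D" for t h l
  proof -
    have "line_fun m t h v \<noteq> 0" "line_fun m t h w \<noteq> 0"
      using v w a by (auto simp: chord_free_iff)
    moreover have "0 < line_fun m t h v \<longleftrightarrow> 0 < line_fun m t h w"
      using v w left_tails_iff[OF a] by auto
    ultimately show ?thesis
      using line_fun_between[OF s, of m t h v w] by (cases "0 < line_fun m t h v") auto
  qed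
  have "?y \<in> chord_free D"
    unfolding chord_free_iff using * v w cball_between[OF s, of v w] by (auto simp: chord_free_iff)
  moreover have "left_tails D ?y = left_tails D v"
    by (rule tails_eqI[OF left_tails_sub left_tails_sub]) (simp add: left_tails_iff *)
  ultimately show "?y \<in> ?cell" using v by simp
qed

text \<open>
  The points with given signs with respect to all the lines form a convex set, and no sign changes along a
  connected set that avoids the chords.
\<close>

lemma component_cell:
  assumes z: "z \<in> chord_free D"
  shows "connected_component_set (chord_free D) z = {w \<in> chord_free D. left_tails D w = left_tails D z}"
    (is "?C = ?cell")
proof
  have "convex ?cell" by (rule convex_cell)
  then show "?cell \<subseteq> ?C"
    by (intro connected_component_maximal) (use z in \<open>auto simp: convex_connected\<close>)
  show "?C \<subseteq> ?cell"
  proof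
    fix w assume w: "w \<in> ?C"
    have wX: "w \<in> chord_free D" using w connected_component_subset[of "chord_free D" z] by auto
    have zC: "z \<in> ?C" using z by simp
    have nz: "line_fun m t h y \<noteq> 0" if "(t, h, l) \<in> D" "y \<in> ?C" for t h l y
      using that connected_component_subset[of "chord_free D" z] chord_free_iff by fastforce
    have "left_tails D w = left_tails D z"
    proof (rule tails_eqI[OF left_tails_sub left_tails_sub])
      fix t h l assume a: "(t, h, l) \<in> D"
      note c = connected_sign[OF connected_connected_component continuous_line_fun nz[OF a]]
      show "t \<in> left_tails D w \<longleftrightarrow> t \<in> left_tails D z"
        unfolding left_tails_iff[OF a] using c[OF _ w zC] c[OF _ zC w] by blast
    qed
    then show "w \<in> ?cell" using wX by simp
  qed
qed

lemma regions_cells: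
  "regions D = (\<lambda>z. {w \<in> chord_free D. left_tails D w = left_tails D z}) ` chord_free D"
  unfolding regions_def components_def chord_free_def[symmetric]
  by (rule image_cong) (simp_all add: component_cell)

lemma region_tails_cell:
  assumes z: "z \<in> chord_free D"
  shows "region_tails D {w \<in> chord_free D. left_tails D w = left_tails D z} = left_tails D z"
proof (rule tails_eqI)
  let ?P = "{w \<in> chord_free D. left_tails D w = left_tails D z}"
  show "region_tails D ?P \<subseteq> fst ` D" unfolding region_tails_def by force
  fix t h l assume a: "(t, h, l) \<in> D"
  have "t \<in> region_tails D ?P \<longleftrightarrow> ?P \<subseteq> left_side m (t, h, l)"
    unfolding region_tails_def m[symmetric] using tail_uniq a by blast
  also have "\<dots> \<longleftrightarrow> 0 < line_fun m t h z"
  proof -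
    have "w \<in> cball 0 1" if "w \<in> ?P" for w using that chord_free_iff by blast
    then show ?thesis
      unfolding left_half[OF a] using z left_tails_iff[OF a] by blast
  qed
  finally show "t \<in> region_tails D ?P \<longleftrightarrow> t \<in> left_tails D z" by (simp add: left_tails_iff[OF a])
qed (rule left_tails_sub)

lemma region_cell:
  assumes "P \<in> regions D"
  shows "P = {w \<in> chord_free D. left_tails D w = region_tails D P}" "P \<noteq> {}"
proof -
  obtain z where z: "z \<in> chord_free D" "P = {w \<in> chord_free D. left_tails D w = left_tails D z}"
    using assms unfolding regions_cells by blast
  then have rt: "region_tails D P = left_tails D z" using region_tails_cell by simp
  show "P = {w \<in> chord_free D. left_tails D w = region_tails D P}" unfolding rt by (rule z(2))
  show "P \<noteq> {}" using z by blast
qed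

lemma planar_line_fun:
  assumes "planar D" "(t, h, l) \<in> D" "(t', h', l') \<in> D" "t \<noteq> t'" "y \<in> chord m (t, h, l)"
  shows "line_fun m t' h' y \<noteq> 0"
proof -
  have "y \<in> cball 0 1"
    using assms(5) chord_sub by blast
  moreover have "y \<notin> chord m (t', h', l')"
    using assms unfolding planar_def m[symmetric] by blast
  ultimately show ?thesis using chord_iff[OF assms(3)] by blast
qed

lemma chord_sign:
  assumes "planar D" "(t, h, l) \<in> D" "(t', h', l') \<in> D" "t \<noteq> t'"
    "y \<in> chord m (t, h, l)" "y' \<in> chord m (t, h, l)"
  shows "0 < line_fun m t' h' y \<longleftrightarrow> 0 < line_fun m t' h' y'"
proof -
  have "connected (chord m (t, h, l))" by (simp add: chord_def)
  note c = connected_sign[OF this continuous_line_fun planar_line_fun[OF assms(1-4)]]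
  show ?thesis using c[OF _ assms(5,6)] c[OF _ assms(6,5)] by blast
qed

text \<open>
  Both conditions say that the line function of one arrow has a constant sign on the chord of the other: it
  is affine on the chord, and its signs at the two ends are given by the sides of the ends.
\<close>

lemma planar_iff_noncrossing: "planar D \<longleftrightarrow> noncrossing D"
proof
  assume pl: "planar D"
  show "noncrossing D"
  proof (rule noncrossingI)
    fix t h l t' h' l'
    assume a: "(t, h, l) \<in> D" and b: "(t', h', l') \<in> D" and ne: "(t, h) \<noteq> (t', h')"
    have d: "{t, h} \<inter> {t', h'} = {}" using wf_diag_distinct(2)[OF wf a b] ne by blast
    have "0 < line_fun m t h (pt m t') \<longleftrightarrow> 0 < line_fun m t h (pt m h')"
      by (rule chord_sign[OF pl b a]) (use d in \<open>auto simp: chord_def\<close>)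
    moreover have "t' \<noteq> t" "t' \<noteq> h" "h' \<noteq> t" "h' \<noteq> h" using d by auto
    ultimately show "gap_left t h t' = gap_left t h h'"
      using line_fun_pt(1)[OF ends(1,2)[OF a] ends(1)[OF b] ends(3)[OF a]]
        line_fun_pt(1)[OF ends(1,2)[OF a] ends(2)[OF b] ends(3)[OF a]] by metis
  qed
next
  assume nc: "noncrossing D"
  show "planar D"
    unfolding planar_def
  proof (intro ballI impI)
    fix a b assume a: "a \<in> D" and b: "b \<in> D" and ne: "a \<noteq> b"
    obtain t h l t' h' l' where eq: "a = (t, h, l)" "b = (t', h', l')" by (cases a, cases b) auto
    note a = a[unfolded eq] and b = b[unfolded eq]
    have d: "{t, h} \<inter> {t', h'} = {}"
      by (rule wf_diag_distinct(2)[OF wf a b]) (use ne eq in simp)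
    have g: "gap_left t h t' = gap_left t h h'"
      by (rule noncrossingD[OF nc a b]) (use d in auto)
    have nz: "line_fun m t h y \<noteq> 0" if "y \<in> chord m b" for y
    proof -
      have "\<exists>s. y = (1 - s) *\<^sub>R pt m t' + s *\<^sub>R pt m h' \<and> 0 \<le> s \<and> s \<le> 1"
        using that by (simp add: eq chord_def closed_segment_def)
      then obtain s where s: "0 \<le> s" "s \<le> 1" "y = (1 - s) *\<^sub>R pt m t' + s *\<^sub>R pt m h'"
        by (elim exE conjE)
      have "t' \<noteq> t" "t' \<noteq> h" "h' \<noteq> t" "h' \<noteq> h" using d by auto
      note e = line_fun_pt[OF ends(1,2)[OF a] ends(1)[OF b] ends(3)[OF a] this(1,2)]
        line_fun_pt[OF ends(1,2)[OF a] ends(2)[OF b] ends(3)[OF a] this(3,4)]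
      show ?thesis
      proof (cases "gap_left t h t'")
        case True
        have "0 < line_fun m t h y"
          unfolding s(3) by (rule line_fun_between(1)[OF s(1,2)]) (use e g True in simp_all)
        then show ?thesis by simp
      next
        case False
        have "line_fun m t h y < 0"
          unfolding s(3) by (rule line_fun_between(2)[OF s(1,2)]) (use e g False in simp_all)
        then show ?thesis by simp
      qed
    qed
    have "False" if y: "y \<in> chord m a" "y \<in> chord m b" for y
    proof -
      have "y \<in> cball 0 1" using y(2) chord_sub by (rule subsetD[rotated])
      then have "line_fun m t h y = 0" using chord_iff[OF a, of y] y(1) unfolding eq by simp
      then show False using nz[OF y(2)] by simp
    qed
    then show "chord (2 * card D) a \<inter> chord (2 * card D) b = {}"
      unfolding m[symmetric] by auto
  qed
qed

lemma gap_pt_free: "k \<le> m \<Longrightarrow> gap_pt m k \<in> chord_free D" (is "_ \<Longrightarrow> ?thesis")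
proof -
  assume k: "k \<le> m"
  have "line_fun m t h (gap_pt m k) \<noteq> 0" if a: "(t, h, l) \<in> D" for t h l
    using line_fun_gap_pt[OF ends[OF a] k] by (cases "gap_left t h k") simp_all
  moreover have "gap_pt m k \<in> cball 0 1" by (simp add: gap_pt_def)
  ultimately show ?thesis unfolding chord_free_iff by blast
qed

lemma left_tails_gap_pt: "k \<le> m \<Longrightarrow> left_tails D (gap_pt m k) = reg D k"
  by (rule tails_eqI[OF left_tails_sub reg_sub])
     (simp add: left_tails_iff reg_iff line_fun_gap_pt(1)[OF ends])

lemma reg_large: "m \<le> k \<Longrightarrow> reg D k = reg D 0"
  by (rule tails_eqI[OF reg_sub reg_sub]) (use ends in \<open>fastforce simp: reg_iff gap_left_def\<close>)

lemma region_tails_iff: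
  "(t, h, l) \<in> D \<Longrightarrow> t \<in> region_tails D P \<longleftrightarrow> P \<subseteq> left_side m (t, h, l)"
  unfolding region_tails_def m[symmetric] using tail_uniq by blast

text \<open>
  Every region reaches the circle.  Walk from \<open>z\<close> straight towards the middle of gap \<open>0\<close>.  If the side with respect to
  some arrow changes, let \<open>a\<close> be the first arrow crossed.  In a planar drawing the other arrows see the crossing
  point as they see \<open>z\<close>, and they see all of the chord of \<open>a\<close> alike; so they see its tail as they see \<open>z\<close>.
  One of the two gaps at this tail lies on the same side of \<open>a\<close> as \<open>z\<close>, and belongs to the region of \<open>z\<close>.
\<close>

lemma left_tails_reg:
  assumes pl: "planar D" and z: "z \<in> chord_free D"
  shows "left_tails D z \<in> regs D"
proof -
  define q where "q = gap_pt m 0"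
  have q: "q \<in> chord_free D" unfolding q_def by (rule gap_pt_free) simp
  define A where "A = {(t, h, l) \<in> D. (0 < line_fun m t h z) \<noteq> (0 < line_fun m t h q)}"
  (* the parameter at which the walk from z to q crosses the line of an arrow in A *)
  define s where "s = (\<lambda>(t, h, l :: 'l). line_fun m t h z / (line_fun m t h z - line_fun m t h q))"
  have nz: "line_fun m t h z \<noteq> 0" "line_fun m t h q \<noteq> 0" if "(t, h, l) \<in> D" for t h l
    using z q that by (auto simp: chord_free_iff)
  have fin: "finite A"
    by (rule finite_subset[of _ D]) (use wf in \<open>auto simp: A_def wf_diag_def\<close>)
  show ?thesis
  proof (cases "A = {}")
    case True
    have "left_tails D z = left_tails D q"
    proof (rule tails_eqI[OF left_tails_sub left_tails_sub])
      fix t h l assume a: "(t, h, l) \<in> D"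
      then have "(0 < line_fun m t h z) = (0 < line_fun m t h q)" using True by (auto simp: A_def)
      then show "t \<in> left_tails D z \<longleftrightarrow> t \<in> left_tails D q" by (simp only: left_tails_iff[OF a])
    qed
    then show ?thesis using left_tails_gap_pt[of 0] by (simp add: q_def regs_def)
  next
    case False
    obtain a where a: "a \<in> A" and least: "\<And>b. b \<in> A \<Longrightarrow> s a \<le> s b"
      using ex_is_arg_min_if_finite[OF fin False, of s] unfolding is_arg_min_linorder by blast
    obtain t h l where at: "a = (t, h, l)" by (cases a) auto
    have aD: "(t, h, l) \<in> D" using a by (simp add: A_def at)
    have s01: "0 \<le> s b \<and> s b \<le> 1" if "b \<in> A" for b
    proof -
      obtain t h l where b: "b = (t, h, l)" by (cases b) auto
      have "(0 < line_fun m t h z) \<noteq> (0 < line_fun m t h q)" using that by (simp add: A_def b)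
      then show ?thesis by (cases "0 < line_fun m t h z") (simp_all add: s_def b divide_simps)
    qed
    define y where "y = (1 - s a) *\<^sub>R z + s a *\<^sub>R q"
    have yc: "y \<in> chord m (t, h, l)"
    proof -
      have "y \<in> cball 0 1" unfolding y_def
        by (rule cball_between) (use s01[OF a] z q in \<open>auto simp: chord_free_iff\<close>)
      moreover have "line_fun m t h y = 0"
      proof -
        have "line_fun m t h z - line_fun m t h q \<noteq> 0" using a by (auto simp: A_def at)
        then show ?thesis unfolding y_def line_fun_affine s_def at
          by (simp add: divide_simps)
      qed
      ultimately show ?thesis using chord_iff[OF aD] by blast
    qed
    have y: "0 < line_fun m t' h' y \<longleftrightarrow> 0 < line_fun m t' h' z"
      if b: "(t', h', l') \<in> D" and ne: "t \<noteq> t'" for t' h' l'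
    proof (cases "(t', h', l') \<in> A")
      case False
      then have "0 < line_fun m t' h' z \<longleftrightarrow> 0 < line_fun m t' h' q" using b by (auto simp: A_def)
      then show ?thesis unfolding y_def
        using line_fun_between[of "s a" m t' h' z q] s01[OF a] nz[OF b]
        by (cases "0 < line_fun m t' h' z") auto
    next
      case True
      let ?f = "line_fun m t' h'" let ?b = "(t', h', l')"
      have df: "(0 < ?f z) \<noteq> (0 < ?f q)" using True by (auto simp: A_def)
      have le: "s a \<le> s ?b" by (rule least[OF True])
      have sb: "s ?b * (?f z - ?f q) = ?f z"
      proof -
        have "?f z - ?f q \<noteq> 0" using df by auto
        then show ?thesis by (simp add: s_def)
      qed
      have fy: "?f y = (s ?b - s a) * (?f z - ?f q)"
        using sb unfolding y_def line_fun_affine by (simp add: algebra_simps)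
      have "?f y \<noteq> 0" by (rule planar_line_fun[OF pl aD b ne yc])
      then have "0 < s ?b - s a" using le fy by (cases "s ?b = s a") auto
      then have "0 < ?f y \<longleftrightarrow> 0 < ?f z - ?f q" unfolding fy by (simp add: zero_less_mult_iff)
      then show ?thesis using df nz[OF b] by auto
    qed
    have pt: "gap_left t' h' t \<longleftrightarrow> 0 < line_fun m t' h' z \<and> t \<noteq> t'" "t \<noteq> t'" "t \<noteq> h'"
      if b: "(t', h', l') \<in> D" and ne: "t \<noteq> t'" for t' h' l'
    proof -
      have d: "{t, h} \<inter> {t', h'} = {}" using wf_diag_distinct(2)[OF wf aD b] ne by blast
      show "t \<noteq> t'" "t \<noteq> h'" using d by auto
      have "0 < line_fun m t' h' (pt m t) \<longleftrightarrow> 0 < line_fun m t' h' y"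
        by (rule chord_sign[OF pl aD b ne _ yc]) (simp add: chord_def)
      then show "gap_left t' h' t \<longleftrightarrow> 0 < line_fun m t' h' z \<and> t \<noteq> t'"
        using line_fun_pt(1)[OF ends(1,2)[OF b] ends(1)[OF aD] ends(3)[OF b] ne \<open>t \<noteq> h'\<close>] y[OF b ne] ne
        by simp
    qed
    have "gap_left t h t \<noteq> gap_left t h (Suc t)"
      using ends[OF aD] by (auto simp: gap_left_def)
    then obtain k where k: "k = t \<or> k = Suc t" "gap_left t h k \<longleftrightarrow> 0 < line_fun m t h z" by metis
    have "left_tails D z = reg D k"
    proof (rule tails_eqI[OF left_tails_sub reg_sub])
      fix t' h' l' assume b: "(t', h', l') \<in> D"
      show "t' \<in> left_tails D z \<longleftrightarrow> t' \<in> reg D k"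
      proof (cases "t' = t")
        case True
        show ?thesis
          using k(2) unfolding True left_tails_iff[OF aD] reg_iff[OF aD] by simp
      next
        case False
        then have ne: "t \<noteq> t'" by simp
        have "gap_left t' h' k = gap_left t' h' t"
          using k(1) gap_left_Suc[OF pt(2,3)[OF b ne]] by blast
        then show ?thesis using pt(1)[OF b ne] ne unfolding left_tails_iff[OF b] reg_iff[OF b] by simp
      qed
    qed
    then show ?thesis by (simp add: regs_def)
  qed
qed

lemma left_tails_image:
  assumes "planar D" shows "left_tails D ` chord_free D = regs D"
proof
  show "left_tails D ` chord_free D \<subseteq> regs D" using left_tails_reg[OF assms] by blast
  have "reg D k \<in> left_tails D ` chord_free D" for k
  proof (cases "k \<le> m")
    case True
    show ?thesis
      unfolding left_tails_gap_pt[OF True, symmetric] by (rule imageI[OF gap_pt_free[OF True]])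
  next
    case False
    then have "reg D k = left_tails D (gap_pt m 0)" using reg_large[of k] left_tails_gap_pt[of 0] by simp
    then show ?thesis using imageI[OF gap_pt_free[of 0], of "left_tails D"] by simp
  qed
  then show "regs D \<subseteq> left_tails D ` chord_free D" by (auto simp: regs_def)
qed

lemma bij_region_tails:
  assumes "planar D" shows "bij_betw (region_tails D) (regions D) (regs D)"
  unfolding bij_betw_def
proof
  show "inj_on (region_tails D) (regions D)"
  proof (rule inj_onI)
    fix P Q assume P: "P \<in> regions D" and Q: "Q \<in> regions D" and eq: "region_tails D P = region_tails D Q"
    show "P = Q" using region_cell(1)[OF P] region_cell(1)[OF Q] unfolding eq by (rule trans[OF _ sym])
  qed
  have "region_tails D ` regions D = left_tails D ` chord_free D"
    unfolding regions_cells image_image by (rule image_cong) (simp_all add: region_tails_cell)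
  then show "region_tails D ` regions D = regs D" using left_tails_image[OF assms] by simp
qed

text \<open>
  If a chord lies in the closure of both regions, any other arrow has both on the side on which it has the
  chord.  Conversely, if the sets differ only in this arrow, a segment between the regions meets the line of
  the arrow in a point of its chord.  Every other arrow has this point, hence the whole chord, on the same
  side as the two regions, and moving from a point of the chord towards a point of either region enters the region.
\<close>

lemma adjacent_iff:
  assumes pl: "planar D" and P: "P \<in> regions D" and Q: "Q \<in> regions D" and a: "(t, h, l) \<in> D"
  shows "P \<subseteq> left_side m (t, h, l) \<and> Q \<subseteq> right_side m (t, h, l) \<and>
      chord m (t, h, l) \<subseteq> closure P \<and> chord m (t, h, l) \<subseteq> closure Q \<longleftrightarrow>
    t \<in> region_tails D P \<and> region_tails D Q = region_tails D P - {t}" (is "?L \<longleftrightarrow> ?R")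
proof -
  have sign: "w \<in> chord_free D \<and> (0 < line_fun m t' h' w \<longleftrightarrow> t' \<in> region_tails D P')"
    if "P' \<in> regions D" "w \<in> P'" "(t', h', l') \<in> D" for P' w t' h' l'
    using region_cell(1)[OF that(1)] that(2) left_tails_iff[OF that(3), of w] by auto
  have nz: "line_fun m t' h' w \<noteq> 0" "w \<in> cball 0 1" if "w \<in> chord_free D" "(t', h', l') \<in> D" for w t' h' l'
    using that by (auto simp: chord_free_iff)
  have sub: "region_tails D P' \<subseteq> fst ` D" for P' unfolding region_tails_def by force
  have ?R if L: ?L
  proof -
    have y: "0 < line_fun m t' h' (pt m t) \<longleftrightarrow> t' \<in> region_tails D P'"
      if P': "P' \<in> regions D" "chord m (t, h, l) \<subseteq> closure P'" and b: "(t', h', l') \<in> D" "t \<noteq> t'"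
      for P' t' h' l'
    proof -
      have yP: "pt m t \<in> closure P'" and yc: "pt m t \<in> chord m (t, h, l)"
        using P'(2) by (auto simp: chord_def)
      have n: "line_fun m t' h' (pt m t) \<noteq> 0" by (rule planar_line_fun[OF pl a b yc])
      show ?thesis
      proof (cases "t' \<in> region_tails D P'")
        case True
        have "P' \<subseteq> {w. 0 \<le> line_fun m t' h' w}" using sign[OF P'(1) _ b(1)] True by fastforce
        moreover have "closed {w. 0 \<le> line_fun m t' h' w}"
          by (intro closed_Collect_le continuous_line_fun continuous_intros)
        ultimately have "closure P' \<subseteq> {w. 0 \<le> line_fun m t' h' w}" by (rule closure_minimal)
        then show ?thesis using yP n True by force
      next
        case False
        have "P' \<subseteq> {w. line_fun m t' h' w \<le> 0}" using sign[OF P'(1) _ b(1)] False by fastforce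
        moreover have "closed {w. line_fun m t' h' w \<le> 0}"
          by (intro closed_Collect_le continuous_line_fun continuous_intros)
        ultimately have "closure P' \<subseteq> {w. line_fun m t' h' w \<le> 0}" by (rule closure_minimal)
        then show ?thesis using yP n False by force
      qed
    qed
    have tP: "t \<in> region_tails D P" using L a unfolding region_tails_def m[symmetric] by blast
    have tQ: "t \<notin> region_tails D Q"
    proof -
      obtain w where w: "w \<in> Q" using region_cell(2)[OF Q] by blast
      then have "line_fun m t h w < 0" using L right_half[OF a] by blast
      then show ?thesis using sign[OF Q w a] by simp
    qed
    have "region_tails D Q = region_tails D P - {t}"
    proof (rule tails_eqI)
      fix t' h' l' assume b: "(t', h', l') \<in> D"
      show "t' \<in> region_tails D Q \<longleftrightarrow> t' \<in> region_tails D P - {t}"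
        using tQ y[OF P _ b] y[OF Q _ b] L by (cases "t' = t") auto
    qed (use sub in auto)
    then show ?thesis using tP by blast
  qed
  moreover have ?L if R: ?R
  proof -
    obtain z w where z: "z \<in> P" and w: "w \<in> Q" using region_cell(2) P Q by blast
    have zf: "z \<in> chord_free D" and wf': "w \<in> chord_free D" using sign[OF P z a] sign[OF Q w a] by auto
    have fz: "0 < line_fun m t h z" and fw: "line_fun m t h w < 0"
      using sign[OF P z a] sign[OF Q w a] R nz(1)[OF wf' a] by auto
    define s where "s = line_fun m t h z / (line_fun m t h z - line_fun m t h w)"
    have s: "0 \<le> s" "s \<le> 1" using fz fw by (auto simp: s_def divide_simps)
    define y where "y = (1 - s) *\<^sub>R z + s *\<^sub>R w"
    have yc: "y \<in> chord m (t, h, l)"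
    proof -
      have "y \<in> cball 0 1" unfolding y_def
        by (rule cball_between[OF s nz(2)[OF zf a] nz(2)[OF wf' a]])
      moreover have "line_fun m t h y = 0"
        using fz fw unfolding y_def line_fun_affine s_def by (simp add: field_simps)
      ultimately show ?thesis using chord_iff[OF a] by blast
    qed
    have same: "0 < line_fun m t' h' z \<longleftrightarrow> 0 < line_fun m t' h' w" if b: "(t', h', l') \<in> D" "t \<noteq> t'" for t' h' l'
      using sign[OF P z b(1)] sign[OF Q w b(1)] R b(2) by auto
    have ysign: "0 < line_fun m t' h' y \<longleftrightarrow> 0 < line_fun m t' h' z" if b: "(t', h', l') \<in> D" "t \<noteq> t'" for t' h' l'
      using line_fun_between[OF s, of m t' h' z w] same[OF b] nz(1)[OF zf b(1)] nz(1)[OF wf' b(1)]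
      unfolding y_def by (cases "0 < line_fun m t' h' z") auto
    have cl: "chord m (t, h, l) \<subseteq> closure P'"
      if P': "P' \<in> regions D" and v: "v \<in> P'"
        and vs: "\<And>t' h' l'. (t', h', l') \<in> D \<Longrightarrow> t \<noteq> t' \<Longrightarrow> 0 < line_fun m t' h' v \<longleftrightarrow> 0 < line_fun m t' h' z" for P' v
    proof
      fix x assume x: "x \<in> chord m (t, h, l)"
      have vf: "v \<in> chord_free D" using sign[OF P' v a] by blast
      have xc: "x \<in> cball 0 1" and x0: "line_fun m t h x = 0"
      proof -
        show "x \<in> cball 0 1" using x chord_sub by blast
        then show "line_fun m t h x = 0" using chord_iff[OF a] x by blast
      qed
      have inP: "(1 - e) *\<^sub>R x + e *\<^sub>R v \<in> P'" if e: "0 < e" "e \<le> 1" for e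
      proof -
        let ?u = "(1 - e) *\<^sub>R x + e *\<^sub>R v"
        have e': "0 \<le> e" using e by simp
        have *: "line_fun m t' h' ?u \<noteq> 0 \<and> (0 < line_fun m t' h' ?u \<longleftrightarrow> 0 < line_fun m t' h' v)"
          if b: "(t', h', l') \<in> D" for t' h' l'
        proof (cases "t' = t")
          case True
          then have "h' = h" using tail_uniq[OF a] b by blast
          then show ?thesis using True x0 e nz(1)[OF vf a]
            by (simp add: line_fun_affine zero_less_mult_iff)
        next
          case False
          then have ne: "t \<noteq> t'" by simp
          have "0 < line_fun m t' h' x \<longleftrightarrow> 0 < line_fun m t' h' v"
            using chord_sign[OF pl a b ne x yc] ysign[OF b ne] vs[OF b ne] by blast
          then show ?thesis
            using line_fun_between[OF e' e(2), of m t' h' x v] nz(1)[OF vf b] planar_line_fun[OF pl a b ne x]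
            by (cases "0 < line_fun m t' h' v") auto
        qed
        have "?u \<in> chord_free D"
          unfolding chord_free_iff using * cball_between[OF e' e(2) xc nz(2)[OF vf a]] by blast
        moreover have "left_tails D ?u = left_tails D v"
          by (rule tails_eqI[OF left_tails_sub left_tails_sub]) (simp add: left_tails_iff *)
        moreover have "left_tails D v = region_tails D P'" using region_cell(1)[OF P'] v by blast
        ultimately show ?thesis using region_cell(1)[OF P'] by blast
      qed
      have "((\<lambda>e. (1 - e) *\<^sub>R x + e *\<^sub>R v) \<longlongrightarrow> (1 - 0) *\<^sub>R x + 0 *\<^sub>R v) (at_right 0)"
        by (intro tendsto_intros)
      moreover have "\<forall>\<^sub>F e in at_right (0::real). (1 - e) *\<^sub>R x + e *\<^sub>R v \<in> closure P'"
        using eventually_at_right_real[OF zero_less_one]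
        by (rule eventually_mono) (use inP closure_subset[of P'] in auto)
      ultimately show "x \<in> closure P'"
        using Lim_in_closed_set[of "closure P'" "\<lambda>e. (1 - e) *\<^sub>R x + e *\<^sub>R v" "at_right 0" x] by simp
    qed
    have "P \<subseteq> left_side m (t, h, l)"
      unfolding left_half[OF a] using sign[OF P _ a] R nz(2)[OF _ a] by blast
    moreover have "Q \<subseteq> right_side m (t, h, l)"
      unfolding right_half[OF a] using sign[OF Q _ a] R nz[OF _ a] by fastforce
    moreover have "chord m (t, h, l) \<subseteq> closure P" by (rule cl[OF P z]) simp
    moreover have "chord m (t, h, l) \<subseteq> closure Q" by (rule cl[OF Q w]) (use same in blast)
    ultimately show ?thesis by blast
  qed
  ultimately show ?thesis by blast
qed

end

section \<open>Chain presentations of a fixed drawing\<close>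

definition naked :: "'l arrow set \<Rightarrow> unit arrow set" where
  "naked D = (\<lambda>(t, h, l). (t, h, ())) ` D"

lemma naked_iff: "(t, h, u) \<in> naked D \<longleftrightarrow> (\<exists>l. (t, h, l) \<in> D)"
  unfolding naked_def by force

lemma endpoints_naked: "endpoints (naked D) = endpoints D"
  unfolding endpoints_def naked_def by force

lemma card_naked:
  assumes "wf_diag D" shows "card (naked D) = card D"
  unfolding naked_def
proof (rule card_image, rule inj_onI)
  fix a b assume ab: "a \<in> D" "b \<in> D" "(case a of (t, h, l) \<Rightarrow> (t, h, ())) = (case b of (t, h, l) \<Rightarrow> (t, h, ()))"
  obtain t h l t' h' l' where eq: "a = (t, h, l)" "b = (t', h', l')" by (cases a, cases b)
  have "t' = t" "h' = h" using ab(3) by (simp_all add: eq)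
  with ab(1,2) show "a = b" using wf_diag_tail_unique(2)[OF assms, of t h l h' l'] by (simp add: eq)
qed

lemma wf_naked: "wf_diag D \<Longrightarrow> wf_diag (naked D)"
  using card_naked[of D] unfolding wf_diag_def endpoints_naked by (simp add: naked_def)

lemma reg_naked: "reg (naked D) = reg D"
  by (rule ext) (simp add: reg_def naked_iff)

lemma regs_naked: "regs (naked D) = regs D"
  by (simp add: regs_def reg_naked)

lemma noncrossing_naked: "noncrossing (naked D) \<longleftrightarrow> noncrossing D"
  by (auto simp: noncrossing_def naked_iff)

lemma naked_rot: "wf_diag D \<Longrightarrow> naked (rot r D) = rot r (naked D)"
  by (simp only: rot_def card_naked) (unfold relabel_def naked_def image_image, rule image_cong, auto)

lemma naked_substitute: "naked (substitute \<gamma> (D, \<nu>)) = D"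
  unfolding naked_def substitute_def prod.case image_image
  by (rule trans[OF _ image_ident]) (rule image_cong, auto)

definition presentations :: "(nat \<Rightarrow> int) \<Rightarrow> int arrow set \<Rightarrow> (complex set \<Rightarrow> nat) set" where
  "presentations \<gamma> D = {\<nu> \<in> regions (naked D) \<rightarrow>\<^sub>E {1..card D + 1}.
     chain_presentation (naked D, \<nu>) \<and> substitute \<gamma> (naked D, \<nu>) = D}"

lemma substitute_eq_iff:
  assumes "wf_diag D"
  shows "substitute \<gamma> (naked D, \<nu>) = D \<longleftrightarrow> (\<forall>(t, h, mk)\<in>D.
    (\<Sum>P | P \<in> regions (naked D) \<and> P \<subseteq> left_side (2 * card D) (t, h, ()). \<gamma> (\<nu> P)) = mk)"
    (is "?S = D \<longleftrightarrow> _")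
proof -
  define F where "F t h = (\<Sum>P | P \<in> regions (naked D) \<and> P \<subseteq> left_side (2 * card D) (t, h, ()). \<gamma> (\<nu> P))" for t h
  have S: "?S = (\<lambda>(t, h, mk). (t, h, F t h)) ` D"
    unfolding substitute_def prod.case card_naked[OF assms] F_def unfolding naked_def image_image
    by (rule image_cong) auto
  have "?S = D \<longleftrightarrow> (\<forall>(t, h, mk)\<in>D. F t h = mk)"
  proof
    assume eq: "?S = D"
    show "\<forall>(t, h, mk)\<in>D. F t h = mk"
    proof clarify
      fix t h mk assume a: "(t, h, mk) \<in> D"
      have "(t, h, F t h) \<in> ?S" unfolding S using a by force
      then have "(t, h, F t h) \<in> D" by (simp only: eq)
      from wf_diag_tail_unique(2)[OF assms a this] show "F t h = mk" .
    qed
  next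
    assume "\<forall>(t, h, mk)\<in>D. F t h = mk"
    then have "(\<lambda>(t, h, mk). (t, h, F t h)) ` D = id ` D" by (intro image_cong) auto
    then show "?S = D" unfolding S by simp
  qed
  then show ?thesis unfolding F_def .
qed

text \<open>
  Sending a piece of the disc to the set of arrows that have it on their left turns geometric presentations
  into numberings of sets of tails.
\<close>

lemma card_presentations:
  assumes wfD: "wf_diag D"
  shows "card (presentations \<gamma> D) = chain_count \<gamma> D"
proof -
  define m where "m = 2 * card D"
  define D0 where "D0 = naked D"
  have m0: "m = 2 * card D0" unfolding m_def D0_def by (simp add: card_naked[OF wfD])
  interpret drawn_diagram D0 m
    by unfold_locales (use wf_naked[OF wfD] m0 in \<open>simp_all add: D0_def\<close>)
  show ?thesis
  proof (cases "planar D0")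
    case False
    then have "\<not> noncrossing D" unfolding planar_iff_noncrossing unfolding D0_def by (simp add: noncrossing_naked)
    moreover have "presentations \<gamma> D = {}"
      using False by (simp add: presentations_def chain_presentation_def D0_def)
    ultimately show ?thesis by (simp add: chain_count_def)
  next
    case True
    then have nc: "noncrossing D" unfolding planar_iff_noncrossing unfolding D0_def by (simp add: noncrossing_naked)
    let ?rt = "region_tails D0"
    define Ord where "Ord = {(P, Q). P \<in> regions D0 \<and> Q \<in> regions D0 \<and> (\<exists>t\<in>?rt P. ?rt Q = ?rt P - {t})}"
    define M where "M = (\<lambda>(t, h, mk). ({P \<in> regions D0. t \<in> ?rt P}, mk)) ` D"
    have bij: "bij_betw ?rt (regions D0) (regs D)"
      using bij_region_tails[OF True] by (simp add: D0_def regs_naked)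
    have mem: "(t, h, ()) \<in> D0" if "(t, h, mk) \<in> D" for t h mk
      using that by (auto simp: D0_def naked_iff)
    have rt: "t \<in> ?rt P \<longleftrightarrow> P \<subseteq> left_side m (t, h, ())" if "(t, h, mk) \<in> D" for P t h mk
      by (rule region_tails_iff[OF mem[OF that]])
    have "presentations \<gamma> D = numberings \<gamma> (card D + 1) (regions D0) Ord M"
    proof -
      have ord: "(\<forall>a\<in>D0. \<forall>P\<in>regions D0. \<forall>Q\<in>regions D0.
        P \<subseteq> left_side m a \<and> Q \<subseteq> right_side m a \<and> chord m a \<subseteq> closure P \<and> chord m a \<subseteq> closure Q
        \<longrightarrow> \<nu> P < \<nu> Q) \<longleftrightarrow> (\<forall>(P, Q)\<in>Ord. \<nu> P < \<nu> Q)" for \<nu> :: "complex set \<Rightarrow> nat"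
      proof
        assume L: "\<forall>a\<in>D0. \<forall>P\<in>regions D0. \<forall>Q\<in>regions D0.
          P \<subseteq> left_side m a \<and> Q \<subseteq> right_side m a \<and> chord m a \<subseteq> closure P \<and> chord m a \<subseteq> closure Q
          \<longrightarrow> \<nu> P < \<nu> Q"
        show "\<forall>(P, Q)\<in>Ord. \<nu> P < \<nu> Q"
        proof clarify
          fix P Q assume "(P, Q) \<in> Ord"
          then obtain t where PQ: "P \<in> regions D0" "Q \<in> regions D0" "t \<in> ?rt P" "?rt Q = ?rt P - {t}"
            by (auto simp: Ord_def)
          then obtain h where a: "(t, h, ()) \<in> D0" unfolding region_tails_def by auto
          from L[rule_format, OF a PQ(1,2)] adjacent_iff[OF True PQ(1,2) a] PQ(3,4)
          show "\<nu> P < \<nu> Q" by blast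
        qed
      next
        assume R: "\<forall>(P, Q)\<in>Ord. \<nu> P < \<nu> Q"
        show "\<forall>a\<in>D0. \<forall>P\<in>regions D0. \<forall>Q\<in>regions D0.
          P \<subseteq> left_side m a \<and> Q \<subseteq> right_side m a \<and> chord m a \<subseteq> closure P \<and> chord m a \<subseteq> closure Q
          \<longrightarrow> \<nu> P < \<nu> Q"
        proof (intro ballI impI)
          fix a P Q assume a: "a \<in> D0" and P: "P \<in> regions D0" and Q: "Q \<in> regions D0"
            and adj: "P \<subseteq> left_side m a \<and> Q \<subseteq> right_side m a \<and> chord m a \<subseteq> closure P \<and> chord m a \<subseteq> closure Q"
          obtain t h where at: "a = (t, h, ())" by (cases a) auto
          have "t \<in> ?rt P \<and> ?rt Q = ?rt P - {t}"
            using adjacent_iff[OF True P Q a[unfolded at]] adj unfolding at by blast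
          then have "(P, Q) \<in> Ord" using P Q unfolding Ord_def by blast
          then show "\<nu> P < \<nu> Q" using R by blast
        qed
      qed
      have sums: "substitute \<gamma> (D0, \<nu>) = D \<longleftrightarrow> (\<forall>(S, w)\<in>M. (\<Sum>x\<in>S. \<gamma> (\<nu> x)) = w)" for \<nu>
      proof -
        have S: "{P. P \<in> regions D0 \<and> P \<subseteq> left_side m (t, h, ())} = {P \<in> regions D0. t \<in> ?rt P}"
          if "(t, h, mk) \<in> D" for t h mk
          by (simp only: rt[OF that])
        have "(\<forall>(S, w)\<in>M. (\<Sum>x\<in>S. \<gamma> (\<nu> x)) = w) \<longleftrightarrow>
            (\<forall>(t, h, mk)\<in>D. (\<Sum>P | P \<in> regions D0 \<and> t \<in> ?rt P. \<gamma> (\<nu> P)) = mk)"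
          by (simp add: M_def case_prod_unfold)
        also have "\<dots> \<longleftrightarrow> (\<forall>(t, h, mk)\<in>D.
            (\<Sum>P | P \<in> regions D0 \<and> P \<subseteq> left_side m (t, h, ()). \<gamma> (\<nu> P)) = mk)"
        proof (rule ball_cong[OF refl])
          fix a assume "a \<in> D"
          then show "(case a of (t, h, mk) \<Rightarrow> (\<Sum>P | P \<in> regions D0 \<and> t \<in> ?rt P. \<gamma> (\<nu> P)) = mk) \<longleftrightarrow>
             (case a of (t, h, mk) \<Rightarrow> (\<Sum>P | P \<in> regions D0 \<and> P \<subseteq> left_side m (t, h, ()). \<gamma> (\<nu> P)) = mk)"
            by (cases a) (simp only: prod.case S)
        qed
        also have "\<dots> \<longleftrightarrow> substitute \<gamma> (D0, \<nu>) = D"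
          unfolding D0_def m_def by (rule substitute_eq_iff[OF wfD, symmetric])
        finally show ?thesis by (rule sym)
      qed
      have "chain_presentation (D0, \<nu>) \<longleftrightarrow> bij_betw \<nu> (regions D0) {1..card D + 1} \<and>
          (\<forall>(P, Q)\<in>Ord. \<nu> P < \<nu> Q)" for \<nu>
        unfolding chain_presentation_def prod.case m0[symmetric] ord
        using True wf_naked[OF wfD] card_naked[OF wfD] by (simp add: D0_def)
      then show ?thesis
        unfolding presentations_def numberings_def D0_def[symmetric] by (simp add: sums conj_assoc)
    qed
    moreover have "map_prod ?rt ?rt ` Ord = neighbours (regs D)"
    proof
      show "map_prod ?rt ?rt ` Ord \<subseteq> neighbours (regs D)"
        using bij_betwE[OF bij] by (auto simp: Ord_def neighbours_def)
      show "neighbours (regs D) \<subseteq> map_prod ?rt ?rt ` Ord"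
      proof clarify
        fix R R' assume RR: "(R, R') \<in> neighbours (regs D)"
        then have "R \<in> ?rt ` regions D0" "R' \<in> ?rt ` regions D0"
          using bij by (auto simp: neighbours_def bij_betw_def)
        then obtain P P' where P: "P \<in> regions D0" "R = ?rt P" "P' \<in> regions D0" "R' = ?rt P'" by blast
        then have "(P, P') \<in> Ord" using RR by (auto simp: Ord_def neighbours_def)
        then show "(R, R') \<in> map_prod ?rt ?rt ` Ord" using P by force
      qed
    qed
    moreover have "(\<lambda>(S, w). (?rt ` S, w)) ` M = marking_conds D"
    proof -
      have "?rt ` {P \<in> regions D0. t \<in> ?rt P} = {R \<in> regs D. t \<in> R}" for t
        using bij by (auto simp: bij_betw_def)
      then show ?thesis
        unfolding M_def marking_conds_def image_image by (intro image_cong) auto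
    qed
    moreover have "card (numberings \<gamma> (card D + 1) (regs D) (map_prod ?rt ?rt ` Ord) ((\<lambda>(S, w). (?rt ` S, w)) ` M))
       = card (numberings \<gamma> (card D + 1) (regions D0) Ord M)"
      by (rule card_numberings_transfer[OF bij]) (auto simp: Ord_def M_def)
    ultimately show ?thesis using nc by (simp add: chain_count_def)
  qed
qed

lemma linear_mult: "linear ((*) (c :: complex))"
  by (intro bounded_linear.linear bounded_linear_mult_right)

lemma inj_mult: "c \<noteq> 0 \<Longrightarrow> inj ((*) (c :: complex))"
  by (auto intro: injI)

lemma
  assumes ch: "chain_presentation (D, \<nu>)"
    and \<nu>': "\<And>P. P \<in> regions D \<Longrightarrow> \<nu>' ((*) (pt (2 * card D) r) ` P) = \<nu> P"
  shows chain_presentation_rot: "chain_presentation (rot r D, \<nu>')"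
    and substitute_rot: "substitute \<gamma> (rot r D, \<nu>') = rot r (substitute \<gamma> (D, \<nu>))"
proof -
  define m c where "m = 2 * card D" and "c = pt m r"
  define f where "f = (\<lambda>(t, h, u :: unit). ((t + r) mod m, (h + r) mod m, u))"
  have wf: "wf_diag D" using ch by (rule chain_wf)
  have c: "c \<noteq> 0" by (simp add: c_def)
  have sub: "(*) c ` P \<subseteq> (*) c ` Q \<longleftrightarrow> P \<subseteq> Q" for P Q
    by (rule inj_image_subset_iff[OF inj_mult[OF c]])
  have m': "2 * card (rot r D) = m" by (simp add: m_def card_rot[OF wf])
  have D': "rot r D = f ` D" by (simp add: rot_def relabel_def f_def m_def)
  have reg: "regions (rot r D) = image ((*) c) ` regions D" unfolding c_def m_def by (rule regions_rot[OF wf])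
  have inj: "inj_on (image ((*) c)) X" for X
    using inj_image_eq_iff[OF inj_mult[OF c]] by (auto intro: inj_onI)
  have \<nu>': "\<nu>' ((*) c ` P) = \<nu> P" if "P \<in> regions D" for P using \<nu>'[OF that] by (simp add: c_def m_def)
  have ch_f: "chord m (f a) = (*) c ` chord m a" for a
    by (cases a) (simp add: f_def c_def chord_rot[where l' = "()"])
  have sides: "left_side m (f a) = (*) c ` left_side m a" "right_side m (f a) = (*) c ` right_side m a"
    if "a \<in> D" for a
    using that wf_diag_less[OF wf] by (cases a; force simp: f_def c_def m_def sides_rot)+
  have cl: "closure ((*) c ` P) = (*) c ` closure P" for P
    by (rule closure_injective_linear_image[OF linear_mult inj_mult[OF c], symmetric])
  have "planar (rot r D)"
    unfolding planar_def m'
  proof (intro ballI impI)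
    fix a b assume ab: "a \<in> rot r D" "b \<in> rot r D" "a \<noteq> b"
    obtain a0 where a0: "a0 \<in> D" "a = f a0" using ab(1) unfolding D' by blast
    obtain b0 where b0: "b0 \<in> D" "b = f b0" using ab(2) unfolding D' by blast
    note 0 = a0(1) b0(1) a0(2) b0(2)
    have "a0 \<noteq> b0" using ab(3) 0(3,4) by blast
    moreover have "planar D" using ch by (simp add: chain_presentation_def)
    ultimately have "chord m a0 \<inter> chord m b0 = {}"
      using 0(1,2) unfolding planar_def m_def by blast
    then show "chord m a \<inter> chord m b = {}"
      unfolding 0(3,4) ch_f image_Int[OF inj_mult[OF c], symmetric] by simp
  qed
  moreover have "bij_betw \<nu>' (regions (rot r D)) {1..card D + 1}"
  proof -
    have "bij_betw (\<nu>' \<circ> image ((*) c)) (regions D) {1..card D + 1}"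
      using ch \<nu>' by (simp add: chain_presentation_def cong: bij_betw_cong)
    moreover have "bij_betw (image ((*) c)) (regions D) (regions (rot r D))"
      unfolding reg by (rule inj_on_imp_bij_betw[OF inj])
    ultimately show ?thesis using bij_betw_comp_iff by blast
  qed
  moreover have "\<nu>' P < \<nu>' Q"
    if "a \<in> rot r D" "P \<in> regions (rot r D)" "Q \<in> regions (rot r D)"
      "P \<subseteq> left_side m a" "Q \<subseteq> right_side m a" "chord m a \<subseteq> closure P" "chord m a \<subseteq> closure Q" for a P Q
  proof -
    have "a \<in> f ` D" using that(1) unfolding D' .
    then obtain a0 where a: "a0 \<in> D" "a = f a0" by blast
    have "P \<in> image ((*) c) ` regions D" "Q \<in> image ((*) c) ` regions D" using that(2,3) unfolding reg .
    then obtain P0 Q0 where PQ: "P0 \<in> regions D" "P = (*) c ` P0" "Q0 \<in> regions D" "Q = (*) c ` Q0"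
      by blast
    have "\<nu> P0 < \<nu> Q0"
      using ch that(4-7) a(1) PQ(1,3)
      unfolding a(2) PQ(2,4) sides[OF a(1)] ch_f cl sub chain_presentation_def prod.case m_def[symmetric] by blast
    then show ?thesis using PQ \<nu>' by simp
  qed
  ultimately show "chain_presentation (rot r D, \<nu>')"
    unfolding chain_presentation_def prod.case m' unfolding card_rot[OF wf]
    using wf_rot[OF wf, of r] by blast
  define F where "F t h = (\<Sum>P | P \<in> regions D \<and> P \<subseteq> left_side m (t, h, ()). \<gamma> (\<nu> P))" for t h
  define F' where "F' t h = (\<Sum>P | P \<in> regions (rot r D) \<and> P \<subseteq> left_side m (t, h, ()). \<gamma> (\<nu>' P))" for t h
  have F: "F' ((t + r) mod m) ((h + r) mod m) = F t h" if a: "(t, h, ()) \<in> D" for t h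
  proof -
    have e: "left_side m ((t + r) mod m, (h + r) mod m, ()) = (*) c ` left_side m (t, h, ())"
      using sides(1)[OF a] by (simp add: f_def)
    have "{P. P \<in> regions (rot r D) \<and> P \<subseteq> left_side m ((t + r) mod m, (h + r) mod m, ())} =
        image ((*) c) ` {P. P \<in> regions D \<and> P \<subseteq> left_side m (t, h, ())}"
      unfolding e reg using sub by auto
    then have "F' ((t + r) mod m) ((h + r) mod m) =
        (\<Sum>P | P \<in> regions D \<and> P \<subseteq> left_side m (t, h, ()). \<gamma> (\<nu>' ((*) c ` P)))"
      unfolding F'_def by (simp only: sum.reindex[OF inj] comp_def)
    also have "\<dots> = F t h" unfolding F_def by (rule sum.cong) (simp_all add: \<nu>')
    finally show ?thesis .
  qed
  have "substitute \<gamma> (rot r D, \<nu>') = (\<lambda>(t, h, u). (t, h, F' t h)) ` f ` D"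
    unfolding substitute_def prod.case m' D'[symmetric] by (rule image_cong) (auto simp: F'_def)
  also have "\<dots> = (\<lambda>(t, h, l). ((t + r) mod m, (h + r) mod m, l)) ` (\<lambda>(t, h, u). (t, h, F t h)) ` D"
    unfolding image_image by (rule image_cong) (auto simp: f_def F)
  also have "(\<lambda>(t, h, u). (t, h, F t h)) ` D = substitute \<gamma> (D, \<nu>)"
    unfolding substitute_def prod.case m_def[symmetric] by (rule image_cong) (auto simp: F_def)
  finally show "substitute \<gamma> (rot r D, \<nu>') = rot r (substitute \<gamma> (D, \<nu>))"
    by (simp only: rot_def relabel_def card_substitute m_def)
qed

lemma regions_disjoint:
  assumes "P \<in> regions D" "Q \<in> regions D" "z \<in> P" "z \<in> Q" shows "P = Q"
  using components_nonoverlap[of P _ Q] assms unfolding regions_def by blast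

text \<open>
  The average of the orbit of a point under a nontrivial rotation is the centre of the disc.  Regions are convex,
  so each region that is mapped to itself contains the centre; but distinct regions are disjoint, and there
  are at least two of them if there is an arrow.
\<close>

lemma rot_free:
  assumes ch: "chain_presentation (D, \<nu>)" and r: "r < max 1 (2 * card D)"
    and fixed: "\<And>P. P \<in> regions D \<Longrightarrow> (*) (pt (2 * card D) r) ` P = P"
  shows "r = 0"
proof (rule ccontr)
  assume r0: "r \<noteq> 0"
  define m c where "m = 2 * card D" and "c = pt m r"
  interpret drawn_diagram D m
    by unfold_locales (use chain_wf[OF ch] m_def in simp_all)
  have rm: "r < m" using r r0 by (simp add: m_def max_def split: if_splits)
  have c1: "c \<noteq> 1" using pt_inj[of r m 0] rm r0 by (auto simp: c_def)
  have cpow: "c ^ j = pt m (r * j)" for j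
    by (induction j) (simp_all add: pt_add c_def)
  have zero: "0 \<in> P" if P: "P \<in> regions D" for P
  proof -
    have conv: "convex P" by (subst region_cell(1)[OF P]) (rule convex_cell)
    obtain z where z: "z \<in> P" using region_cell(2)[OF P] by blast
    have orb: "c ^ j * z \<in> P" for j
    proof (induction j)
      case (Suc j)
      then have "c * (c ^ j * z) \<in> (*) c ` P" by (rule imageI)
      also have "(*) c ` P = P" using fixed[OF P] unfolding c_def m_def .
      finally show ?case by (simp only: power_Suc mult.assoc)
    qed (use z in simp)
    have "(\<Sum>j\<in>{..<m}. (1 / real m) *\<^sub>R (c ^ j * z)) \<in> P"
      by (rule convex_sum[OF _ conv]) (use rm orb in auto)
    also have "(\<Sum>j\<in>{..<m}. (1 / real m) *\<^sub>R (c ^ j * z)) = (1 / real m) *\<^sub>R ((\<Sum>j\<in>{..<m}. c ^ j) * z)"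
      by (simp add: scaleR_sum_right sum_distrib_right)
    also have "(\<Sum>j\<in>{..<m}. c ^ j) = (c ^ m - 1) / (c - 1)" by (rule geometric_sum[OF c1])
    also have "c ^ m = 1" unfolding cpow mult.commute[of r m] by (rule pt_mult)
    finally show ?thesis by simp
  qed
  have "card D \<noteq> 0" using rm by (auto simp: m_def)
  moreover have bij: "bij_betw \<nu> (regions D) {1..card D + 1}"
    using ch by (simp add: chain_presentation_def)
  ultimately have "{1, 2} \<subseteq> \<nu> ` regions D" by (auto simp: bij_betw_def)
  then obtain P Q where PQ: "P \<in> regions D" "Q \<in> regions D" "\<nu> P = 1" "\<nu> Q = 2"
    by (metis imageE insert_subset)
  have "P = Q" by (rule regions_disjoint[OF PQ(1,2) zero[OF PQ(1)] zero[OF PQ(2)]])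
  then show False using PQ by simp
qed

section \<open>Rotations and the pairing with the sum of chains\<close>

lemma abs_diagram_eq_iff:
  assumes "wf_diag D" "wf_diag E"
  shows "abs_diagram D = abs_diagram E \<longleftrightarrow> (\<exists>r. E = rot r D)"
proof -
  have refl: "rot_equiv A A" if "wf_diag A" for A :: "'a arrow set"
    unfolding rot_equiv_def using that rot_0[OF that] by metis
  have "rot_equiv D E \<longleftrightarrow> abs_diagram D = abs_diagram E"
    using Quotient_rel[OF Quotient_diagram, of D E] refl assms by blast
  then show ?thesis unfolding rot_equiv_def using assms by blast
qed

lemma aut_abs:
  assumes "wf_diag D"
  shows "aut (abs_diagram D) = card {r. r < max 1 (2 * card D) \<and> rot r D = D}"
proof (rule aut.abs_eq)
  show "rot_equiv D D" unfolding rot_equiv_def using assms rot_0[OF assms] by metis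
qed

lemma diagram_degree_abs:
  assumes "wf_diag D" shows "diagram_degree (abs_diagram D) = card D"
proof (rule diagram_degree.abs_eq)
  show "rot_equiv D D" unfolding rot_equiv_def using assms rot_0[OF assms] by metis
qed

lemma rot_mod:
  assumes "wf_diag D" "m = 2 * card D"
  shows "rot (r mod m) D = rot r D"
  unfolding rot_def by (rule relabel_cong) (simp add: assms(2) mod_add_right_eq)

text \<open>
  The rotations carrying one drawing to another, if there are any, form a coset of the group of rotations that
  fix the drawing.  This replaces the factor \<open>aut\<close> in pairings by a sum over rotations.
\<close>

lemma card_rot_solutions:
  assumes D: "wf_diag D" and E: "wf_diag E"
  shows "card {r. r < max 1 (2 * card D) \<and> rot r E = D} =
    (if abs_diagram E = abs_diagram D then aut (abs_diagram D) else 0)"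
proof (cases "abs_diagram E = abs_diagram D")
  case False
  then have "{r. r < max 1 (2 * card D) \<and> rot r E = D} = {}"
    using abs_diagram_eq_iff[OF E D] by auto
  then show ?thesis using False by simp
next
  case True
  then obtain s where s: "D = rot s E" using abs_diagram_eq_iff[OF E D] by blast
  define m where "m = 2 * card D"
  let ?A = "{r. r < max 1 m \<and> rot r D = D}" and ?B = "{r. r < max 1 m \<and> rot r E = D}"
  have cE: "card E = card D" unfolding s by (simp add: card_rot[OF E])
  have "card ?A = card ?B"
  proof (cases "m = 0")
    case True
    then have "D = {}" "E = {}" using D E cE by (auto simp: m_def wf_diag_def)
    then show ?thesis by simp
  next
    case False
    then have M: "max 1 m = m" by simp
    (* minus s modulo m *)
    let ?u = "(m - 1) * s"
    have E': "E = rot ?u D" unfolding s using rot_inverse[OF E, of s] by (simp add: m_def cE)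
    have modE: "rot (r mod m) E = rot r E" for r by (rule rot_mod[OF E]) (simp add: m_def cE)
    have modD: "rot (r mod m) D = rot r D" for r by (rule rot_mod[OF D]) (simp add: m_def)
    have le1: "card ?A \<le> card ?B"
    proof (rule card_inj_on_le[where f = "\<lambda>r. (r + s) mod m"])
      show "inj_on (\<lambda>r. (r + s) mod m) ?A"
        by (rule inj_on_subset[OF inj_on_add_mod]) (unfold M, auto)
      show "(\<lambda>r. (r + s) mod m) ` ?A \<subseteq> ?B"
      proof (rule image_subsetI)
        fix r assume "r \<in> ?A"
        then have r: "rot r D = D" by simp
        have "rot (r + s) E = rot r (rot s E)" using rot_rot[OF E, of r s] by (simp add: add.commute)
        also have "\<dots> = D" using r s by simp
        finally show "(r + s) mod m \<in> ?B"
          using False by (simp add: modE)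
      qed
    qed simp
    have le2: "card ?B \<le> card ?A"
    proof (rule card_inj_on_le[where f = "\<lambda>r. (r + ?u) mod m"])
      show "inj_on (\<lambda>r. (r + ?u) mod m) ?B"
        by (rule inj_on_subset[OF inj_on_add_mod]) (unfold M, auto)
      show "(\<lambda>r. (r + ?u) mod m) ` ?B \<subseteq> ?A"
      proof (rule image_subsetI)
        fix r assume "r \<in> ?B"
        then have r: "rot r E = D" by simp
        have "rot (r + ?u) D = rot r (rot ?u D)" using rot_rot[OF D, of r ?u] by (simp add: add.commute)
        also have "\<dots> = D" using r E' by simp
        finally show "(r + ?u) mod m \<in> ?A"
          using False by (simp add: modD)
      qed
    qed simp
    show ?thesis using le1 le2 by simp
  qed
  then show ?thesis using True by (simp add: aut_abs[OF D] m_def)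
qed

lemma lookup_lin_ext:
  "Poly_Mapping.lookup (lin_ext f x) d = (\<Sum>a\<in>Poly_Mapping.keys x. Poly_Mapping.lookup x a * Poly_Mapping.lookup (f a) d)"
  by (simp add: lin_ext_def lookup_sum Poly_Mapping.map.rep_eq when_def) (intro sum.cong, auto)

lemma pairing_altdef: "pairing x y = (\<Sum>d\<in>Poly_Mapping.keys y. Poly_Mapping.lookup x d * (Poly_Mapping.lookup y d * of_nat (aut d)))"
proof -
  have s: "scalar (Poly_Mapping.single d 1) (Poly_Mapping.single d' 1) = (if d = d' then 1 else 0)"
    for d d' :: "'a diagram"
    by (auto simp: scalar_def)
  have "pairing x y = (\<Sum>d'\<in>Poly_Mapping.keys y. \<Sum>d\<in>Poly_Mapping.keys x. if d = d' then Poly_Mapping.lookup x d * Poly_Mapping.lookup y d' * of_nat (aut d) else 0)"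
    unfolding pairing_def s by (subst sum.swap) (intro sum.cong, auto)
  also have "\<dots> = (\<Sum>d\<in>Poly_Mapping.keys y. Poly_Mapping.lookup x d * (Poly_Mapping.lookup y d * of_nat (aut d)))"
    by (intro sum.cong refl) (simp add: sum.delta in_keys_iff)
  finally show ?thesis .
qed

lemma pairing_single: "pairing x (Poly_Mapping.single d c) = Poly_Mapping.lookup x d * c * of_nat (aut d)"
  by (simp add: pairing_altdef)

lemma pairing_sum_right:
  assumes "finite A"
  shows "pairing x (\<Sum>a\<in>A. y a) = (\<Sum>a\<in>A. pairing x (y a))"
proof -
  define K where "K = (\<Union>a\<in>A. Poly_Mapping.keys (y a))"
  have K: "finite K" using assms by (simp add: K_def)
  have ext: "pairing x z = (\<Sum>d\<in>K. Poly_Mapping.lookup x d * (Poly_Mapping.lookup z d * of_nat (aut d)))" if "Poly_Mapping.keys z \<subseteq> K" for z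
    unfolding pairing_altdef by (rule sum.mono_neutral_left[OF K that]) (auto simp: in_keys_iff)
  have "Poly_Mapping.keys (\<Sum>a\<in>A. y a) \<subseteq> K" unfolding K_def by (rule keys_sum)
  then have "pairing x (\<Sum>a\<in>A. y a) = (\<Sum>d\<in>K. \<Sum>a\<in>A. Poly_Mapping.lookup x d * (Poly_Mapping.lookup (y a) d * of_nat (aut d)))"
    by (simp add: ext lookup_sum sum_distrib_left sum_distrib_right)
  also have "\<dots> = (\<Sum>a\<in>A. pairing x (y a))"
    by (subst sum.swap) (intro sum.cong refl ext[symmetric], auto simp: K_def)
  finally show ?thesis .
qed

lemma lookup_U: "Poly_Mapping.lookup (U n) c = (if chain_degree c = n then 1 else 0)"
  by (simp add: U_def lookup_sum lookup_single when_def sum.delta finite_chains)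

lemma keys_U: "Poly_Mapping.keys (U n) = {c. chain_degree c = n}"
  by (auto simp: in_keys_iff lookup_U split: if_splits)

lemma lookup_Phi:
  "Poly_Mapping.lookup (Phi n \<gamma>) A = of_nat (card {c. chain_degree c = n \<and> chain_diagram \<gamma> c = A})"
proof -
  have "Poly_Mapping.lookup (Phi n \<gamma>) A = (\<Sum>c | chain_degree c = n. if chain_diagram \<gamma> c = A then 1 else 0)"
    unfolding Phi_def lookup_lin_ext keys_U
    by (rule sum.cong) (simp_all add: lookup_U lookup_single when_def)
  then show ?thesis by (simp add: sum.If_cases finite_chains Int_def)
qed

lemma chain_rep:
  obtains D \<nu> where "c = abs_chain (D, \<nu>)" "chain_presentation (D, \<nu>)"
    "chain_degree c = card D" "chain_diagram \<gamma> c = abs_diagram (substitute \<gamma> (D, \<nu>))"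
proof -
  obtain D \<nu> where c: "c = abs_chain (D, \<nu>)" "pres_equiv (D, \<nu>) (D, \<nu>)"
    by (metis Quotient_chain Quotient_rep_reflp Quotient_abs_rep surj_pair)
  show ?thesis
    by (rule that[OF c(1)]) (use c(2) chain_degree.abs_eq[OF c(2)] chain_diagram.abs_eq[OF c(2)]
        in \<open>simp_all add: c(1) pres_equiv_iff\<close>)
qed

lemma pres_equiv_imp_abs_eq: "pres_equiv p q \<Longrightarrow> abs_chain p = abs_chain q"
  by (meson Quotient_rel_abs Quotient_chain)

lemma abs_eq_imp_pres_equiv:
  "chain_presentation p \<Longrightarrow> chain_presentation q \<Longrightarrow> abs_chain p = abs_chain q \<Longrightarrow> pres_equiv p q"
proof -
  assume p: "chain_presentation p" and q: "chain_presentation q" and e: "abs_chain p = abs_chain q"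
  have refl: "pres_equiv x x" if "chain_presentation x" for x
  proof (cases x)
    case (Pair D \<nu>)
    have "chain_presentation (D, \<nu>)" using that Pair by simp
    then show ?thesis unfolding Pair pres_equiv_iff
      by (intro conjI exI[of _ 0]) (simp_all add: rot_0 chain_wf)
  qed
  show ?thesis using Quotient_rel[OF Quotient_chain, of p q] refl[OF p] refl[OF q] e by blast
qed

text \<open>
  A rotation that carries the marked diagram of a fixed presentation to \<open>D\<close> carries the presentation to one of
  \<open>D\<close>.  All presentations of \<open>D\<close> in the same class arise in this way, each from a single rotation by
  \<open>rot_free\<close>.
\<close>

lemma card_presentations_orbit:
  fixes Dc :: "unit arrow set" and \<gamma> :: "nat \<Rightarrow> int"
  assumes D: "wf_diag D" and ch: "chain_presentation (Dc, \<nu>c)"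
  defines "E \<equiv> substitute \<gamma> (Dc, \<nu>c)"
  shows "card {r. r < max 1 (2 * card D) \<and> rot r E = D} =
    card {\<nu> \<in> presentations \<gamma> D. abs_chain (naked D, \<nu>) = abs_chain (Dc, \<nu>c)}"
    (is "card ?A = card ?B")
proof (cases "card Dc = card D")
  case False
  have wfc: "wf_diag Dc" using ch by (rule chain_wf)
  have wfE: "wf_diag E" unfolding E_def by (rule wf_substitute[OF wfc])
  have "rot r E \<noteq> D" for r
    using card_rot[OF wfE, of r] False by (auto simp: E_def card_substitute)
  moreover have "?B = {}"
  proof -
    have "card (naked D) = card Dc" if "pres_equiv (Dc, \<nu>c) (naked D, \<nu>)" for \<nu>
      using that card_rot[OF wfc] by (auto simp: pres_equiv_iff)
    then show ?thesis
      using abs_eq_imp_pres_equiv[OF ch] False card_naked[OF D] by (auto simp: presentations_def) metis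
  qed
  ultimately have "?A = {}" "?B = {}" by auto
  then show ?thesis by (simp only: card.empty)
next
  case True
  have wfc: "wf_diag Dc" using ch by (rule chain_wf)
  have wfE: "wf_diag E" unfolding E_def by (rule wf_substitute[OF wfc])
  define m where "m = 2 * card D"
  have mc: "2 * card Dc = m" by (simp add: m_def True)
  (* the piece of the disc that the rotation by r carries to Q *)
  define pb where "pb r Q = (*) (inverse (pt m r)) ` Q" for r Q
  have pb: "pb r ((*) (pt m r) ` P) = P" for r P
    by (simp add: pb_def image_image mult.assoc[symmetric])
  define T where "T r = restrict (\<lambda>Q. \<nu>c (pb r Q)) (regions (naked D))" for r
  have nk: "naked D = rot r Dc" if "rot r E = D" for r
    using naked_rot[OF wfE, of r] that by (simp add: E_def naked_substitute)
  have reg: "regions (naked D) = image ((*) (pt m r)) ` regions Dc" if "rot r E = D" for r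
    unfolding nk[OF that] regions_rot[OF wfc] mc ..
  have T: "T r ((*) (pt m r) ` P) = \<nu>c P" if "rot r E = D" "P \<in> regions Dc" for r P
    unfolding T_def using that(2) by (simp add: reg[OF that(1)] pb)
  have "bij_betw T ?A ?B"
    unfolding bij_betw_def
  proof (intro conjI equalityI)
    show "inj_on T ?A"
    proof -
      have le_eq: "r = r'" if r: "r \<in> ?A" and r': "r' \<in> ?A" and eq: "T r = T r'" and le: "r \<le> r'" for r r'
      proof -
        have rE: "rot r E = D" "rot r' E = D" and lt: "r' < max 1 m" using r r' by (auto simp: m_def)
        have inj: "inj_on \<nu>c (regions Dc)" using ch by (auto simp: chain_presentation_def bij_betw_def)
        have same: "(*) (pt m r) ` P = (*) (pt m r') ` P" if P: "P \<in> regions Dc" for P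
        proof -
          have "(*) (pt m r) ` P \<in> image ((*) (pt m r')) ` regions Dc"
            using reg[OF rE(1)] reg[OF rE(2)] P by blast
          then obtain P' where P': "P' \<in> regions Dc" "(*) (pt m r) ` P = (*) (pt m r') ` P'" by blast
          have "\<nu>c P = \<nu>c P'" using T[OF rE(1) P] T[OF rE(2) P'(1)] eq P'(2) by simp
          then have "P = P'" using inj P P'(1) by (auto dest: inj_onD)
          then show ?thesis using P'(2) by simp
        qed
        have "r' - r = 0"
        proof (rule rot_free)
          show "chain_presentation (rot r Dc, T r)"
            by (rule chain_presentation_rot[OF ch]) (use T[OF rE(1)] mc in simp)
          show "r' - r < max 1 (2 * card (rot r Dc))" using lt by (simp add: card_rot[OF wfc] mc)
          fix Q assume "Q \<in> regions (rot r Dc)"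
          then obtain P where P: "P \<in> regions Dc" "Q = (*) (pt m r) ` P"
            unfolding regions_rot[OF wfc] mc by blast
          have "(*) (pt m (r' - r)) ` Q = (*) (pt m (r' - r + r)) ` P"
            unfolding P(2) image_image pt_add by (simp add: mult.assoc)
          also have "\<dots> = Q" using same[OF P(1)] P(2) le by simp
          finally show "(*) (pt (2 * card (rot r Dc)) (r' - r)) ` Q = Q"
            by (simp add: card_rot[OF wfc] mc)
        qed
        then show ?thesis using le by simp
      qed
      show ?thesis
      proof (rule inj_onI)
        fix r r' assume "r \<in> ?A" "r' \<in> ?A" "T r = T r'"
        then show "r = r'"
          using le_eq[of r r'] le_eq[of r' r] by (cases "r \<le> r'") simp_all
      qed
    qed
    show "T ` ?A \<subseteq> ?B"
    proof (rule image_subsetI)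
      fix r assume "r \<in> ?A"
      then have rE: "rot r E = D" by simp
      have ch': "chain_presentation (naked D, T r)"
        unfolding nk[OF rE] by (rule chain_presentation_rot[OF ch]) (use T[OF rE] mc in simp)
      have "substitute \<gamma> (naked D, T r) = D"
      proof -
        have "substitute \<gamma> (naked D, T r) = rot r E"
          unfolding nk[OF rE] E_def by (rule substitute_rot[OF ch]) (use T[OF rE] mc in simp)
        then show ?thesis using rE by simp
      qed
      moreover have "T r \<in> regions (naked D) \<rightarrow>\<^sub>E {1..card D + 1}"
        using ch' card_naked[OF D] bij_betwE by (force simp: T_def chain_presentation_def)
      moreover have "pres_equiv (Dc, \<nu>c) (naked D, T r)"
        unfolding pres_equiv_iff using ch ch' nk[OF rE] T[OF rE] mc by auto
      then have "abs_chain (naked D, T r) = abs_chain (Dc, \<nu>c)"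
        by (rule pres_equiv_imp_abs_eq[symmetric])
      ultimately show "T r \<in> ?B"
        using ch' by (simp add: presentations_def)
    qed
    show "?B \<subseteq> T ` ?A"
    proof
      fix \<nu> assume "\<nu> \<in> ?B"
      then have \<nu>: "\<nu> \<in> presentations \<gamma> D" and eq: "abs_chain (naked D, \<nu>) = abs_chain (Dc, \<nu>c)" by auto
      have ch': "chain_presentation (naked D, \<nu>)" and sub: "substitute \<gamma> (naked D, \<nu>) = D"
        and ext: "\<nu> \<in> extensional (regions (naked D))"
        using \<nu> by (auto simp: presentations_def PiE_def)
      obtain r0 where r0: "naked D = rot r0 Dc"
          "\<And>P. P \<in> regions Dc \<Longrightarrow> \<nu> ((*) (pt m r0) ` P) = \<nu>c P"
        using abs_eq_imp_pres_equiv[OF ch ch' eq[symmetric]] unfolding pres_equiv_iff mc by blast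
      define r where "r = (if m = 0 then 0 else r0 mod m)"
      have r_lt: "r < max 1 m" by (simp add: r_def)
      have ptr: "pt m r = pt m r0" by (cases "m = 0") (simp add: r_def pt_def, simp add: r_def)
      have "rot r0 E = substitute \<gamma> (naked D, \<nu>)"
        unfolding r0(1) E_def by (rule substitute_rot[OF ch, symmetric]) (use r0(2) mc in simp)
      then have rE0: "rot r0 E = D" using sub by simp
      have rE: "rot r E = D"
      proof (cases "m = 0")
        case True
        then have "card Dc = 0" "card D = 0" using mc by (simp_all add: m_def)
        then have "Dc = {}" "D = {}" using wfc D by (auto simp: wf_diag_def)
        then have "E = {}" "D = {}" by (simp_all add: E_def substitute_def)
        then show ?thesis by (simp add: rot_def relabel_def)
      next
        case False
        then show ?thesis using rE0 rot_mod[OF wfE, of m r0] mc by (simp add: r_def E_def card_substitute)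
      qed
      have "\<nu> = T r"
      proof (rule extensionalityI[OF ext])
        show "T r \<in> extensional (regions (naked D))" by (simp add: T_def)
        fix Q assume "Q \<in> regions (naked D)"
        then obtain P where P: "P \<in> regions Dc" "Q = (*) (pt m r) ` P" unfolding reg[OF rE] by blast
        show "\<nu> Q = T r Q" unfolding P(2) T[OF rE P(1)] unfolding ptr by (rule r0(2)[OF P(1)])
      qed
      then show "\<nu> \<in> T ` ?A" using r_lt rE by (auto simp: m_def)
    qed
  qed
  then show ?thesis by (rule bij_betw_same_card)
qed

text \<open>
  The presentations of \<open>D\<close> are partitioned by their classes, and a class is counted in the coefficient of the
  diagram of \<open>D\<close> exactly if it contains such a presentation.
\<close>

lemma pairing_Phi:
  assumes D: "wf_diag D"
  shows "pairing (Phi n \<gamma>) (Poly_Mapping.single (abs_diagram D) 1) =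
    (if card D = n then of_nat (chain_count \<gamma> D) else 0)"
proof -
  let ?C = "{c. chain_degree c = n}"
  have per: "(if chain_diagram \<gamma> c = abs_diagram D then aut (abs_diagram D) else 0) =
      card {\<nu> \<in> presentations \<gamma> D. abs_chain (naked D, \<nu>) = c}" for c
  proof -
    obtain Dc \<nu>c where c: "c = abs_chain (Dc, \<nu>c)" "chain_presentation (Dc, \<nu>c)"
      "chain_diagram \<gamma> c = abs_diagram (substitute \<gamma> (Dc, \<nu>c))" by (rule chain_rep)
    have wfE: "wf_diag (substitute \<gamma> (Dc, \<nu>c))" by (rule wf_substitute[OF chain_wf[OF c(2)]])
    show ?thesis
      unfolding c(3) using card_rot_solutions[OF D wfE] card_presentations_orbit[OF D c(2), of \<gamma>]
      by (simp only: c(1))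
  qed
  have fin: "finite (presentations \<gamma> D)"
  proof (cases "\<exists>\<nu>. \<nu> \<in> presentations \<gamma> D")
    case True
    then have "finite (regions (naked D))"
      using bij_betw_finite by (fastforce simp: presentations_def chain_presentation_def)
    then have "finite (regions (naked D) \<rightarrow>\<^sub>E {1..card D + 1})" by (simp add: finite_PiE)
    then show ?thesis unfolding presentations_def by (rule rev_finite_subset) auto
  qed auto
  have deg: "chain_degree (abs_chain (naked D, \<nu>)) = card D" if "\<nu> \<in> presentations \<gamma> D" for \<nu>
  proof -
    have ch: "chain_presentation (naked D, \<nu>)" using that by (simp add: presentations_def)
    have "pres_equiv (naked D, \<nu>) (naked D, \<nu>)" by (rule abs_eq_imp_pres_equiv[OF ch ch refl])
    from chain_degree.abs_eq[OF this] show ?thesis by (simp add: card_naked[OF D])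
  qed
  have "pairing (Phi n \<gamma>) (Poly_Mapping.single (abs_diagram D) 1) =
      of_nat (card {c. chain_degree c = n \<and> chain_diagram \<gamma> c = abs_diagram D} * aut (abs_diagram D))"
    by (simp add: pairing_single lookup_Phi)
  also have "card {c. chain_degree c = n \<and> chain_diagram \<gamma> c = abs_diagram D} * aut (abs_diagram D) =
      (\<Sum>c\<in>?C. if chain_diagram \<gamma> c = abs_diagram D then aut (abs_diagram D) else 0)"
    by (simp add: sum.If_cases finite_chains Int_def)
  also have "\<dots> = (\<Sum>c\<in>?C. card {\<nu> \<in> presentations \<gamma> D. abs_chain (naked D, \<nu>) = c})"
    by (simp only: per)
  also have "\<dots> = card (\<Union>c\<in>?C. {\<nu> \<in> presentations \<gamma> D. abs_chain (naked D, \<nu>) = c})"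
    by (rule card_UN_disjoint[symmetric]) (use fin finite_chains in auto)
  also have "(\<Union>c\<in>?C. {\<nu> \<in> presentations \<gamma> D. abs_chain (naked D, \<nu>) = c}) =
      (if card D = n then presentations \<gamma> D else {})"
    using deg by auto
  finally show ?thesis by (simp add: card_presentations[OF D])
qed

lemma Phi_in_arrow_space: "Phi n \<gamma> \<in> arrow_space n"
  unfolding arrow_space_def
proof clarify
  fix A assume "A \<in> Poly_Mapping.keys (Phi n \<gamma>)"
  then have "card {c. chain_degree c = n \<and> chain_diagram \<gamma> c = A} \<noteq> 0"
    by (simp add: in_keys_iff lookup_Phi)
  then obtain c where c: "chain_degree c = n" "chain_diagram \<gamma> c = A" by (metis (mono_tags, lifting) Collect_empty_eq card.empty)
  obtain D \<nu> where D: "chain_presentation (D, \<nu>)" "chain_degree c = card D"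
    "chain_diagram \<gamma> c = abs_diagram (substitute \<gamma> (D, \<nu>))" by (rule chain_rep)
  show "diagram_degree A = n"
    using c D diagram_degree_abs[OF wf_substitute[OF chain_wf[OF D(1)]], of \<gamma> \<nu>]
    by (simp add: card_substitute)
qed

section \<open>The state sum\<close>

text \<open>
  What remains of \<open>wf_diag\<close> after the deletion of arrows: distinct endpoints, at arbitrary positions.
\<close>

definition distinct_ends :: "'l arrow set \<Rightarrow> bool" where
  "distinct_ends B \<longleftrightarrow> finite B \<and> (\<forall>t h l t' h' l'. (t, h, l) \<in> B \<longrightarrow> (t', h', l') \<in> B \<longrightarrow>
     t \<noteq> h \<and> ((t, h, l) = (t', h', l') \<or> {t, h} \<inter> {t', h'} = {}))"

lemma distinct_ends_sub:
  assumes "wf_diag D" "B \<subseteq> D" shows "distinct_ends B"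
  unfolding distinct_ends_def
proof (intro conjI allI impI)
  show "finite B" using assms finite_subset by (auto simp: wf_diag_def)
  fix t h l t' h' l' assume a: "(t, h, l) \<in> B" "(t', h', l') \<in> B"
  then have b: "(t, h, l) \<in> D" "(t', h', l') \<in> D" using assms(2) by auto
  show "t \<noteq> h" by (rule wf_diag_distinct(1)[OF assms(1) b])
  show "(t, h, l) = (t', h', l') \<or> {t, h} \<inter> {t', h'} = {}" using wf_diag_distinct(2)[OF assms(1) b] by blast
qed

lemma
  assumes "distinct_ends B"
  shows distinct_ends_finite: "finite B"
    and distinct_endsD: "(t, h, l) \<in> B \<Longrightarrow> t \<noteq> h"
    and distinct_ends_disjoint: "(t, h, l) \<in> B \<Longrightarrow> (t', h', l') \<in> B \<Longrightarrow> (t, h, l) \<noteq> (t', h', l') \<Longrightarrow> {t, h} \<inter> {t', h'} = {}"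
    and distinct_ends_tail: "(t, h, l) \<in> B \<Longrightarrow> (t, h', l') \<in> B \<Longrightarrow> h' = h \<and> l' = l"
  using assms unfolding distinct_ends_def by blast+

lemma distinct_ends_mono:
  assumes B: "distinct_ends B" and sub: "C \<subseteq> B" shows "distinct_ends C"
  unfolding distinct_ends_def
proof (intro conjI allI impI)
  show "finite C" by (rule finite_subset[OF sub distinct_ends_finite[OF B]])
  fix t h l t' h' l' assume "(t, h, l) \<in> C" "(t', h', l') \<in> C"
  then have a: "(t, h, l) \<in> B" "(t', h', l') \<in> B" using sub by auto
  show "t \<noteq> h" by (rule distinct_endsD[OF B a(1)])
  show "(t, h, l) = (t', h', l') \<or> {t, h} \<inter> {t', h'} = {}" using distinct_ends_disjoint[OF B a] by blast
qed

lemma reg_mem_iff: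
  assumes "distinct_ends B" "(t, h, l) \<in> B"
  shows "t \<in> reg B k \<longleftrightarrow> gap_left t h k"
  unfolding reg_def using distinct_ends_tail[OF assms(1) assms(2)] assms(2) by blast

lemma reg_tails: "reg B k \<subseteq> fst ` B"
  unfolding reg_def by force

lemma tails_sub_endpoints: "fst ` B \<subseteq> endpoints B"
  unfolding endpoints_def by force

lemma gap_left_order:
  assumes "t < k \<longleftrightarrow> t' < k'" "h < k \<longleftrightarrow> h' < k'" "h < t \<longleftrightarrow> h' < t'"
  shows "gap_left t h k \<longleftrightarrow> gap_left t' h' k'"
  using assms unfolding gap_left_def by (metis not_less)

text \<open>
  A monotone renumbering of the endpoints identifies the gaps, up to gaps between which there is no endpoint.
\<close>

lemma monotone_gaps:
  fixes f :: "nat \<Rightarrow> nat"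
  assumes fin: "finite E" and f: "strict_mono_on E f"
  shows "\<exists>k'. \<forall>e\<in>E. e < k \<longleftrightarrow> f e < k'" and "\<exists>k. \<forall>e\<in>E. e < k \<longleftrightarrow> f e < k'"
proof -
  have less: "f e < f e' \<longleftrightarrow> e < e'" if "e \<in> E" "e' \<in> E" for e e'
    using strict_mono_on_less[OF f that] .
  have le: "f e \<le> f e' \<longleftrightarrow> e \<le> e'" if "e \<in> E" "e' \<in> E" for e e'
    using less[OF that(2,1)] by (meson not_less)
  show "\<exists>k'. \<forall>e\<in>E. e < k \<longleftrightarrow> f e < k'"
  proof (cases "{e \<in> E. e < k} = {}")
    case True
    then show ?thesis by (intro exI[of _ 0]) auto
  next
    case False
    define M where "M = Max {e \<in> E. e < k}"
    have fin': "finite {e \<in> E. e < k}" using fin by simp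
    have M: "M \<in> E" "M < k" using Max_in[OF fin' False] unfolding M_def by auto
    have ge: "e \<le> M" if "e \<in> E" "e < k" for e using Max_ge[OF fin'] that unfolding M_def by blast
    have "e < k \<longleftrightarrow> f e < Suc (f M)" if e: "e \<in> E" for e
      using ge[OF e] M(2) le[OF e M(1)] unfolding less_Suc_eq_le by auto
    then show ?thesis by blast
  qed
  show "\<exists>k. \<forall>e\<in>E. e < k \<longleftrightarrow> f e < k'"
  proof (cases "{e \<in> E. f e < k'} = {}")
    case True
    then show ?thesis by (intro exI[of _ 0]) auto
  next
    case False
    define M where "M = Max {e \<in> E. f e < k'}"
    have fin': "finite {e \<in> E. f e < k'}" using fin by simp
    have M: "M \<in> E" "f M < k'" using Max_in[OF fin' False] unfolding M_def by auto
    have ge: "e \<le> M" if "e \<in> E" "f e < k'" for e using Max_ge[OF fin'] that unfolding M_def by blast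
    have "e < Suc M \<longleftrightarrow> f e < k'" if e: "e \<in> E" for e
      using ge[OF e] M(2) le[OF e M(1)] unfolding less_Suc_eq_le by auto
    then show ?thesis by blast
  qed
qed

lemma neighbours_sub: "neighbours T \<subseteq> T \<times> T"
  by (auto simp: neighbours_def)

lemma marking_conds_sub: "(S, w) \<in> marking_conds B \<Longrightarrow> S \<subseteq> regs B"
  by (auto simp: marking_conds_def)

text \<open>
  Regions, crossings and neighbours are defined by comparing positions, so a monotone renumbering of the
  endpoints transports them.
\<close>

lemma chain_count_relabel:
  assumes B: "distinct_ends B" and f: "strict_mono_on (endpoints B) f"
  shows "chain_count \<gamma> (relabel f B) = chain_count \<gamma> B"
proof -
  let ?B = "relabel f B"
  have fin: "finite (endpoints B)" using finite_endpoints distinct_ends_finite[OF B] .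
  have inj: "inj_on f (endpoints B)" using f by (rule strict_mono_on_imp_inj_on)
  have less: "f e < f e' \<longleftrightarrow> e < e'" if "e \<in> endpoints B" "e' \<in> endpoints B" for e e'
    using strict_mono_on_less[OF f that] .
  have card: "card ?B = card B" by (rule card_relabel[OF inj])
  have rel: "x \<in> ?B \<longleftrightarrow> (\<exists>t h l. x = (f t, f h, l) \<and> (t, h, l) \<in> B)" for x
    unfolding relabel_def by force
  have nc: "noncrossing ?B \<longleftrightarrow> noncrossing B"
  proof -
    have g: "gap_left (f t) (f h) (f k) \<longleftrightarrow> gap_left t h k" if "(t, h, l) \<in> B" "k \<in> endpoints B" for t h l k
      using less endpointsI[OF that(1)] that(2) by (intro gap_left_order) auto
    have eq: "(f t, f h) = (f t', f h') \<longleftrightarrow> (t, h) = (t', h')" if "(t, h, l) \<in> B" "(t', h', l') \<in> B" for t h l t' h' l'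
      using inj_on_eq_iff[OF inj] endpointsI[OF that(1)] endpointsI[OF that(2)] by auto
    show ?thesis
    proof
      assume nc: "noncrossing ?B"
      show "noncrossing B"
      proof (rule noncrossingI)
        fix t h l t' h' l' assume a: "(t, h, l) \<in> B" "(t', h', l') \<in> B" "(t, h) \<noteq> (t', h')"
        have "gap_left (f t) (f h) (f t') = gap_left (f t) (f h) (f h')"
          by (rule noncrossingD[OF nc]) (use a rel eq[OF a(1,2)] in auto)
        then show "gap_left t h t' = gap_left t h h'"
          using g[OF a(1)] endpointsI[OF a(2)] by simp
      qed
    next
      assume nc: "noncrossing B"
      show "noncrossing ?B"
      proof (rule noncrossingI)
        fix u v l u' v' l' assume "(u, v, l) \<in> ?B" "(u', v', l') \<in> ?B" and ne: "(u, v) \<noteq> (u', v')"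
        then obtain t h t' h' where a: "(t, h, l) \<in> B" "(t', h', l') \<in> B"
          and e: "u = f t" "v = f h" "u' = f t'" "v' = f h'" unfolding rel by auto
        have "gap_left t h t' = gap_left t h h'"
          by (rule noncrossingD[OF nc a]) (use ne e in auto)
        then show "gap_left u v u' = gap_left u v v'"
          unfolding e using g[OF a(1)] endpointsI[OF a(2)] by simp
      qed
    qed
  qed
  have reg: "reg ?B k' = f ` reg B k" if k: "\<And>e. e \<in> endpoints B \<Longrightarrow> e < k \<longleftrightarrow> f e < k'" for k k'
  proof -
    have g: "gap_left (f t) (f h) k' \<longleftrightarrow> gap_left t h k" if "(t, h, l) \<in> B" for t h l
      using less k endpointsI[OF that] by (intro gap_left_order) auto
    show ?thesis unfolding reg_def rel using g by blast
  qed
  have regs: "regs ?B = image f ` regs B"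
  proof
    show "regs ?B \<subseteq> image f ` regs B"
      unfolding regs_def using monotone_gaps(2)[OF fin f] reg by (metis image_subsetI rangeI image_eqI)
    show "image f ` regs B \<subseteq> regs ?B"
      unfolding regs_def using monotone_gaps(1)[OF fin f] reg by (metis image_subsetI rangeI image_eqI image_image)
  qed
  have sub: "R \<subseteq> endpoints B" if "R \<in> regs B" for R
    using that reg_tails tails_sub_endpoints unfolding regs_def by blast
  have img: "f ` R = f ` R' \<longleftrightarrow> R = R'" if "R \<subseteq> endpoints B" "R' \<subseteq> endpoints B" for R R'
    using inj_on_image_eq_iff[OF inj that] .
  have bij: "bij_betw (image f) (regs B) (regs ?B)"
    unfolding bij_betw_def regs using img sub by (auto intro!: inj_onI)
  have mem: "f t \<in> f ` R \<longleftrightarrow> t \<in> R" if "t \<in> endpoints B" "R \<subseteq> endpoints B" for t R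
    using inj_on_image_mem_iff[OF inj that] .
  have "neighbours (regs ?B) = map_prod (image f) (image f) ` neighbours (regs B)"
  proof
    have diff: "f ` (R - {t}) = f ` R - {f t}" if "R \<in> regs B" "t \<in> R" for R t
      using inj_on_image_set_diff[OF inj, of R "{t}"] sub[OF that(1)] that(2) by auto
    show "map_prod (image f) (image f) ` neighbours (regs B) \<subseteq> neighbours (regs ?B)"
    proof (rule image_subsetI)
      fix x assume "x \<in> neighbours (regs B)"
      then obtain R t where R: "x = (R, R - {t})" "R \<in> regs B" "R - {t} \<in> regs B" "t \<in> R"
        by (auto simp: neighbours_def)
      have "f ` R \<in> regs ?B" "f ` (R - {t}) \<in> regs ?B" "f t \<in> f ` R"
        unfolding regs using R by (auto intro: imageI)
      then show "map_prod (image f) (image f) x \<in> neighbours (regs ?B)"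
        unfolding R(1) neighbours_def using diff[OF R(2,4)] by auto
    qed
    show "neighbours (regs ?B) \<subseteq> map_prod (image f) (image f) ` neighbours (regs B)"
    proof
      fix x assume "x \<in> neighbours (regs ?B)"
      then obtain S u where S: "x = (S, S - {u})" "S \<in> regs ?B" "S - {u} \<in> regs ?B" "u \<in> S"
        by (auto simp: neighbours_def)
      obtain R where R: "R \<in> regs B" "S = f ` R" using S(2) unfolding regs by (rule imageE)
      obtain R' where R': "R' \<in> regs B" "S - {u} = f ` R'" using S(3) unfolding regs by (rule imageE)
      obtain t where t: "t \<in> R" "u = f t" using S(4) unfolding R(2) by (rule imageE)
      have "f ` R' = f ` (R - {t})" using diff[OF R(1) t(1)] R'(2) R(2) t(2) by simp
      then have "R' = R - {t}" using img[of R' "R - {t}"] sub[OF R(1)] sub[OF R'(1)] by blast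
      then have "(R, R') \<in> neighbours (regs B)" using R(1) R'(1) t(1) by (auto simp: neighbours_def)
      moreover have "x = map_prod (image f) (image f) (R, R')" using S(1) R(2) R'(2) by simp
      ultimately show "x \<in> map_prod (image f) (image f) ` neighbours (regs B)" by (rule rev_image_eqI)
    qed
  qed
  moreover have "marking_conds ?B = (\<lambda>(S, w). (image f ` S, w)) ` marking_conds B"
  proof -
    have e: "{R \<in> regs ?B. f t \<in> R} = image f ` {R \<in> regs B. t \<in> R}" if "(t, h, l) \<in> B" for t h l
      unfolding regs using mem[OF endpointsI(1)[OF that] sub] by blast
    have "(\<lambda>(t, h, mk). ({R \<in> regs ?B. t \<in> R}, mk)) ` (\<lambda>(t, h, l). (f t, f h, l)) ` B =
      (\<lambda>(S, w). (image f ` S, w)) ` (\<lambda>(t, h, mk). ({R \<in> regs B. t \<in> R}, mk)) ` B"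
      unfolding image_image
    proof (rule image_cong[OF refl])
      fix a assume a: "a \<in> B"
      obtain t h mk where at: "a = (t, h, mk)" by (cases a)
      show "(case case a of (t, h, l) \<Rightarrow> (f t, f h, l) of (t, h, mk) \<Rightarrow> ({R \<in> regs ?B. t \<in> R}, mk)) =
        (case case a of (t, h, mk) \<Rightarrow> ({R \<in> regs B. t \<in> R}, mk) of (S, w) \<Rightarrow> (image f ` S, w))"
        unfolding at prod.case e[OF a[unfolded at]] ..
    qed
    then show ?thesis unfolding marking_conds_def relabel_def .
  qed
  ultimately have "card (numberings \<gamma> N (regs ?B) (neighbours (regs ?B)) (marking_conds ?B)) =
      card (numberings \<gamma> N (regs B) (neighbours (regs B)) (marking_conds B))" for N
    using card_numberings_transfer[OF bij neighbours_sub marking_conds_sub, where \<gamma> = \<gamma> and N = N]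
    by simp
  then show ?thesis unfolding chain_count_def nc card by simp
qed

definition unsign :: "(asign \<times> int) arrow set \<Rightarrow> int arrow set" where
  "unsign D = (\<lambda>(t, h, s, mk). (t, h, mk)) ` D"

definition sign_prod :: "(asign \<times> int) arrow set \<Rightarrow> rat" where
  "sign_prod D = (\<Prod>(t, h, s, mk)\<in>D. sign_val s)"

lemma endpoints_unsign: "endpoints (unsign D) = endpoints D"
  unfolding endpoints_def unsign_def by force

lemma card_unsign:
  assumes "distinct_ends D" shows "card (unsign D) = card D"
  unfolding unsign_def
proof (rule card_image, rule inj_onI)
  fix a b assume ab: "a \<in> D" "b \<in> D"
    "(case a of (t, h, s, mk) \<Rightarrow> (t, h, mk)) = (case b of (t, h, s, mk) \<Rightarrow> (t, h, mk))"
  obtain t h s mk t' h' s' mk' where eq: "a = (t, h, s, mk)" "b = (t', h', s', mk')" by (cases a, cases b)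
  have "t' = t" "h' = h" using ab(3) by (simp_all add: eq)
  with ab(1,2) show "a = b" using distinct_ends_tail[OF assms, of t h "(s, mk)" h' "(s', mk')"] by (simp add: eq)
qed

lemma wf_unsign: "wf_diag D \<Longrightarrow> wf_diag (unsign D)"
  using card_unsign[OF distinct_ends_sub[of D D]] unfolding wf_diag_def endpoints_unsign by (simp add: unsign_def)

lemma unsign_relabel: "unsign (relabel f D) = relabel f (unsign D)"
  unfolding unsign_def relabel_def image_image by (rule image_cong) auto

lemma unsign_rot: "wf_diag D \<Longrightarrow> unsign (rot r D) = rot r (unsign D)"
  by (simp only: rot_def unsign_relabel card_unsign[OF distinct_ends_sub[of D D]] subset_refl)

lemma sign_prod_relabel: "inj_on f (endpoints D) \<Longrightarrow> sign_prod (relabel f D) = sign_prod D"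
  unfolding sign_prod_def relabel_def
  by (subst prod.reindex[OF inj_on_relabel]) (auto intro!: prod.cong)

lemma sign_prod_rot: "wf_diag D \<Longrightarrow> sign_prod (rot r D) = sign_prod D"
  unfolding rot_def by (rule sign_prod_relabel) (auto simp: wf_diag_def inj_on_add_mod)

lemma unsign_add_signs: "unsign (add_signs \<sigma> A) = A"
  unfolding unsign_def add_signs_def image_image by (rule trans[OF _ image_ident]) (rule image_cong, auto)

lemma sign_prod_add_signs: "sign_prod (add_signs \<sigma> A) = (\<Prod>a\<in>A. sign_val (\<sigma> a))"
  unfolding sign_prod_def add_signs_def
  by (subst prod.reindex) (auto intro!: inj_onI prod.cong)

lemma add_signs_cancel:
  assumes "add_signs \<sigma> A = add_signs \<sigma>' A" "\<sigma> \<in> PiE A (\<lambda>_. UNIV)" "\<sigma>' \<in> PiE A (\<lambda>_. UNIV)" "distinct_ends A"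
  shows "\<sigma> = \<sigma>'"
proof (rule extensionalityI[of _ A])
  fix a assume a: "a \<in> A"
  obtain t h mk where at: "a = (t, h, mk)" by (cases a)
  have "(t, h, \<sigma> a, mk) \<in> add_signs \<sigma> A" unfolding add_signs_def using a at by force
  then have "(t, h, \<sigma> a, mk) \<in> add_signs \<sigma>' A" by (simp only: assms(1))
  then show "\<sigma> a = \<sigma>' a" unfolding add_signs_def at by auto
qed (use assms(2,3) in \<open>auto simp: PiE_def\<close>)

text \<open>
  Distinct arrows of a Gauss diagram have distinct tails, so the signs are a function on the unsigned arrows.
\<close>

lemma signed_lift:
  assumes "distinct_ends G"
  obtains \<sigma> where "\<sigma> \<in> PiE (unsign G) (\<lambda>_. UNIV)" "add_signs \<sigma> (unsign G) = G"
proof -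
  define \<sigma> where "\<sigma> = restrict (\<lambda>(t, h, mk). SOME s. (t, h, s, mk) \<in> G) (unsign G)"
  have \<sigma>: "\<sigma> (t, h, mk) = s" if a: "(t, h, s, mk) \<in> G" for t h s mk
  proof -
    have u: "(t, h, mk) \<in> unsign G" unfolding unsign_def using a by force
    have "(t, h, (SOME s. (t, h, s, mk) \<in> G), mk) \<in> G" using a by (rule someI)
    then have "(SOME s. (t, h, s, mk) \<in> G) = s"
      using distinct_ends_tail[OF assms a] by blast
    then show ?thesis using u by (simp add: \<sigma>_def)
  qed
  have "add_signs \<sigma> (unsign G) = id ` G"
    unfolding add_signs_def unsign_def image_image by (rule image_cong) (auto simp: \<sigma>)
  then show ?thesis by (intro that[of \<sigma>]) (auto simp: \<sigma>_def)
qed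

lemma rot_cancel: "wf_diag D \<Longrightarrow> wf_diag E \<Longrightarrow> rot r D = rot r E \<Longrightarrow> D = E"
proof -
  assume D: "wf_diag D" and E: "wf_diag E" and eq: "rot r D = rot r E"
  have c: "card D = card E" using card_rot[OF D, of r] card_rot[OF E, of r] eq by simp
  have "D = rot ((2 * card D - 1) * r) (rot r D)" by (rule rot_inverse[OF D, symmetric])
  also have "\<dots> = E" unfolding eq c by (rule rot_inverse[OF E])
  finally show ?thesis .
qed

lemma rot_surj:
  assumes "wf_diag D" obtains E where "wf_diag E" "rot r E = D"
proof (rule that)
  let ?E = "rot ((2 * card D - 1) * r) D"
  show "wf_diag ?E" by (rule wf_rot[OF assms])
  have "rot r ?E = rot ((2 * card D - 1) * r) (rot r D)" by (simp add: rot_rot assms add.commute)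
  then show "rot r ?E = D" using rot_inverse[OF assms] by simp
qed

text \<open>
  At most one choice of signs turns \<open>A\<close>, rotated by \<open>r\<close>, into \<open>G\<close>, and it has the sign product of \<open>G\<close>.
\<close>

lemma sum_signs_rot:
  assumes A: "wf_diag A" and G: "wf_diag G"
  shows "(\<Sum>\<sigma>\<in>PiE A (\<lambda>_. UNIV). (\<Prod>a\<in>A. sign_val (\<sigma> a)) * of_bool (rot r (add_signs \<sigma> A) = G)) =
    sign_prod G * of_bool (rot r A = unsign G)"
proof -
  have fin: "finite (PiE A (\<lambda>_. UNIV :: asign set))"
  proof (rule finite_PiE)
    have "UNIV = {Positive, Negative}" using asign.exhaust by auto
    then have "finite (UNIV :: asign set)" by (metis finite.simps)
    then show "finite (UNIV :: asign set)" .
  qed (use A in \<open>simp add: wf_diag_def\<close>)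
  have dA: "distinct_ends A" by (rule distinct_ends_sub[OF A]) simp
  have wfs: "wf_diag (add_signs \<sigma> A)" for \<sigma> by (rule wf_add_signs[OF A])
  show ?thesis
  proof (cases "rot r A = unsign G")
    case False
    have "rot r (add_signs \<sigma> A) \<noteq> G" for \<sigma>
      using False unsign_rot[OF wfs, of r \<sigma>] by (auto simp: unsign_add_signs)
    then show ?thesis using False by simp
  next
    case True
    obtain E where E: "wf_diag E" "rot r E = G" using rot_surj[OF G] .
    have "rot r (unsign E) = rot r A" using unsign_rot[OF E(1), of r] E(2) True by simp
    then have EA: "unsign E = A" by (rule rot_cancel[OF wf_unsign[OF E(1)] A])
    obtain \<tau> where \<tau>: "\<tau> \<in> PiE A (\<lambda>_. UNIV)" "add_signs \<tau> A = E"
      using signed_lift[OF distinct_ends_sub[OF E(1) subset_refl]] unfolding EA by blast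
    have iff: "rot r (add_signs \<sigma> A) = G \<longleftrightarrow> \<sigma> = \<tau>" if "\<sigma> \<in> PiE A (\<lambda>_. UNIV)" for \<sigma>
    proof
      assume "rot r (add_signs \<sigma> A) = G"
      then have "rot r (add_signs \<sigma> A) = rot r (add_signs \<tau> A)" using \<tau>(2) E(2) by simp
      then have "add_signs \<sigma> A = add_signs \<tau> A" by (rule rot_cancel[OF wfs wfs])
      then show "\<sigma> = \<tau>" by (rule add_signs_cancel[OF _ that \<tau>(1) dA])
    qed (use \<tau>(2) E(2) in simp)
    have "(\<Sum>\<sigma>\<in>PiE A (\<lambda>_. UNIV). (\<Prod>a\<in>A. sign_val (\<sigma> a)) * of_bool (rot r (add_signs \<sigma> A) = G)) =
        (\<Sum>\<sigma>\<in>PiE A (\<lambda>_. UNIV). if \<tau> = \<sigma> then \<Prod>a\<in>A. sign_val (\<sigma> a) else 0)"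
      by (rule sum.cong) (auto simp: iff)
    also have "\<dots> = (\<Prod>a\<in>A. sign_val (\<tau> a))" using fin \<tau>(1) by simp
    also have "\<dots> = sign_prod G"
      using sign_prod_add_signs[of \<tau> A] sign_prod_rot[OF E(1), of r] \<tau>(2) E(2) by simp
    finally show ?thesis using True by simp
  qed
qed

lemma diagram_rep:
  obtains D where "wf_diag D" "A = abs_diagram D"
proof -
  obtain D where "A = abs_diagram D" "rot_equiv D D"
    by (metis Quotient_diagram Quotient_rep_reflp Quotient_abs_rep)
  then show ?thesis using that by (auto simp: rot_equiv_def)
qed

text \<open>
  The factor \<open>aut\<close> becomes a sum over rotations, and for each rotation the sum over the signs collapses.
\<close>

lemma lookup_S_diagram:
  assumes A: "wf_diag A" and G: "wf_diag G"
  shows "Poly_Mapping.lookup (S_diagram (abs_diagram A)) (abs_diagram G) * of_nat (aut (abs_diagram G)) =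
    sign_prod G * of_nat (if abs_diagram A = abs_diagram (unsign G) then aut (abs_diagram (unsign G)) else 0)"
proof -
  let ?P = "PiE A (\<lambda>_. UNIV :: asign set)" let ?M = "max 1 (2 * card G)"
  let ?s = "\<lambda>\<sigma>. \<Prod>a\<in>A. sign_val (\<sigma> a)"
  have cG: "card (unsign G) = card G" by (rule card_unsign[OF distinct_ends_sub[OF G subset_refl]])
  have count: "of_nat (card {r. r < M \<and> Q r}) = (\<Sum>r<M. of_bool (Q r) :: rat)" for M and Q :: "nat \<Rightarrow> bool"
    by (simp add: sum.If_cases of_bool_def Int_def)
  have eqA: "rot_equiv A A" unfolding rot_equiv_def using A rot_0[OF A] by metis
  have "Poly_Mapping.lookup (S_diagram (abs_diagram A)) (abs_diagram G) * of_nat (aut (abs_diagram G)) =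
      (\<Sum>\<sigma>\<in>?P. ?s \<sigma> * of_nat (if abs_diagram (add_signs \<sigma> A) = abs_diagram G then aut (abs_diagram G) else 0))"
    unfolding S_diagram.abs_eq[OF eqA] by (simp add: lookup_sum lookup_single when_def sum_distrib_right) (intro sum.cong, auto)
  also have "\<dots> = (\<Sum>\<sigma>\<in>?P. ?s \<sigma> * of_nat (card {r. r < ?M \<and> rot r (add_signs \<sigma> A) = G}))"
    by (simp only: card_rot_solutions[OF G wf_add_signs[OF A]])
  also have "\<dots> = (\<Sum>\<sigma>\<in>?P. \<Sum>r<?M. ?s \<sigma> * of_bool (rot r (add_signs \<sigma> A) = G))"
    unfolding count sum_distrib_left ..
  also have "\<dots> = (\<Sum>r<?M. \<Sum>\<sigma>\<in>?P. ?s \<sigma> * of_bool (rot r (add_signs \<sigma> A) = G))"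
    by (rule sum.swap)
  also have "\<dots> = (\<Sum>r<?M. sign_prod G * of_bool (rot r A = unsign G))"
    by (simp only: sum_signs_rot[OF A G])
  also have "\<dots> = sign_prod G * of_nat (card {r. r < max 1 (2 * card (unsign G)) \<and> rot r A = unsign G})"
    unfolding count cG sum_distrib_left ..
  also have "card {r. r < max 1 (2 * card (unsign G)) \<and> rot r A = unsign G} =
      (if abs_diagram A = abs_diagram (unsign G) then aut (abs_diagram (unsign G)) else 0)"
    by (rule card_rot_solutions[OF wf_unsign[OF G] A])
  finally show ?thesis .
qed

lemma pairing_S_map:
  assumes G: "wf_diag G"
  shows "pairing (S_map x) (Poly_Mapping.single (abs_diagram G) 1) =
    sign_prod G * pairing x (Poly_Mapping.single (abs_diagram (unsign G)) 1)"
proof -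
  let ?u = "abs_diagram (unsign G)"
  have "Poly_Mapping.lookup (S_diagram A) (abs_diagram G) * of_nat (aut (abs_diagram G)) =
      sign_prod G * (if A = ?u then of_nat (aut ?u) else 0)" for A
  proof -
    obtain D where "wf_diag D" "A = abs_diagram D" by (rule diagram_rep)
    then show ?thesis using lookup_S_diagram[OF _ G, of D] by auto
  qed
  then have "pairing (S_map x) (Poly_Mapping.single (abs_diagram G) 1) =
     (\<Sum>A\<in>Poly_Mapping.keys x. Poly_Mapping.lookup x A * (sign_prod G * (if A = ?u then of_nat (aut ?u) else 0)))"
    unfolding pairing_single S_map_def lookup_lin_ext sum_distrib_right mult_1_right
    by (simp only: mult.assoc)
  also have "\<dots> = (\<Sum>A\<in>Poly_Mapping.keys x. if A = ?u then Poly_Mapping.lookup x ?u * (sign_prod G * of_nat (aut ?u)) else 0)"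
    by (rule sum.cong) auto
  also have "\<dots> = Poly_Mapping.lookup x ?u * (sign_prod G * of_nat (aut ?u))"
    by (simp add: sum.delta in_keys_iff)
  finally show ?thesis unfolding pairing_single by simp
qed

text \<open>
  The contribution of one subdiagram, given with the positions that it has in the whole diagram.
\<close>

definition state_value :: "nat \<Rightarrow> (nat \<Rightarrow> int) \<Rightarrow> (asign \<times> int) arrow set \<Rightarrow> rat" where
  "state_value n \<gamma> B = (if card B = n then sign_prod B * of_nat (chain_count \<gamma> (unsign B)) else 0)"

lemma distinct_ends_unsign:
  assumes "distinct_ends B" shows "distinct_ends (unsign B)"
proof -
  have "(t, h, l) \<in> unsign B \<longleftrightarrow> (\<exists>s. (t, h, s, l) \<in> B)" for t h l
    unfolding unsign_def by force
  then show ?thesis using assms unfolding distinct_ends_def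
    by (auto simp: unsign_def[of B]) blast+
qed

lemma state_value_relabel:
  assumes B: "distinct_ends B" and f: "strict_mono_on (endpoints B) f"
  shows "state_value n \<gamma> (relabel f B) = state_value n \<gamma> B"
proof -
  have inj: "inj_on f (endpoints B)" using f by (rule strict_mono_on_imp_inj_on)
  show ?thesis
    unfolding state_value_def card_relabel[OF inj] sign_prod_relabel[OF inj] unsign_relabel
    using chain_count_relabel[OF distinct_ends_unsign[OF B], of f \<gamma>] f by (simp add: endpoints_unsign)
qed

lemma relabel_mono: "C \<subseteq> B \<Longrightarrow> relabel f C \<subseteq> relabel f B"
  unfolding relabel_def by (rule image_mono)

lemma rank_mono_on:
  assumes "finite E" shows "strict_mono_on E (\<lambda>x. card {e \<in> E. e < (x::nat)})"
  by (rule strict_mono_onI) (rule rank_strict_mono[OF assms])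

lemma sum_subsets_relabel:
  assumes "inj_on f (endpoints B)"
  shows "(\<Sum>C\<in>Pow (relabel f B). g C) = (\<Sum>C\<in>Pow B. g (relabel f C))"
proof -
  let ?f = "\<lambda>(t, h, l). (f t, f h, l)"
  have inj: "inj_on ?f B" by (rule inj_on_relabel[OF assms])
  have "Pow (relabel f B) = image ?f ` Pow B" unfolding relabel_def by (rule image_Pow_surj[OF refl, symmetric])
  then show ?thesis
    by (simp add: sum.reindex[OF inj_on_image_Pow[OF inj]] relabel_def)
qed

lemma pairing_I_map:
  assumes D: "wf_diag D"
  shows "pairing x (I_map (Poly_Mapping.single (abs_diagram D) 1)) =
    (\<Sum>B\<in>Pow D. pairing x (Poly_Mapping.single (abs_diagram (std B)) 1))"
proof -
  have eq: "rot_equiv D D" unfolding rot_equiv_def using D rot_0[OF D] by metis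
  have "I_map (Poly_Mapping.single (abs_diagram D) (1::rat)) = I_diagram (abs_diagram D)"
    unfolding I_map_def lin_ext_def by (rule poly_mapping_eqI) (simp add: Poly_Mapping.map.rep_eq when_def)
  also have "\<dots> = (\<Sum>B\<in>Pow D. Poly_Mapping.single (abs_diagram (std B)) 1)"
    by (rule I_diagram.abs_eq[OF eq])
  finally show ?thesis using D by (simp add: pairing_sum_right wf_diag_def)
qed

lemma state_sum_wf:
  assumes D: "wf_diag D"
  shows "pairing (S_map (Phi n \<gamma>)) (I_map (Poly_Mapping.single (abs_diagram D) 1)) =
    (\<Sum>B\<in>Pow D. state_value n \<gamma> B)"
  unfolding pairing_I_map[OF D]
proof (rule sum.cong[OF refl])
  fix B assume "B \<in> Pow D"
  then have B: "B \<subseteq> D" by simp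
  have dB: "distinct_ends B" by (rule distinct_ends_sub[OF D B])
  have fin: "finite (endpoints B)" using finite_endpoints distinct_ends_finite[OF dB] .
  have ws: "wf_diag (std B)" by (rule wf_std[OF D B])
  have "pairing (S_map (Phi n \<gamma>)) (Poly_Mapping.single (abs_diagram (std B)) 1) = state_value n \<gamma> (std B)"
    unfolding pairing_S_map[OF ws] pairing_Phi[OF wf_unsign[OF ws]]
      card_unsign[OF distinct_ends_sub[OF ws subset_refl]] state_value_def by simp
  also have "\<dots> = state_value n \<gamma> B"
    unfolding std_def by (rule state_value_relabel[OF dB rank_mono_on[OF fin]])
  finally show "pairing (S_map (Phi n \<gamma>)) (Poly_Mapping.single (abs_diagram (std B)) 1) = state_value n \<gamma> B" .
qed

text \<open>
  Renumbering the endpoints after the deletion of arrows changes no state value; so both the deletion made by a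
  move and the further deletions made by the map \<open>I\<close> can be described inside one fixed diagram.
\<close>

lemma state_sum:
  assumes D: "wf_diag D" and B: "B \<subseteq> D"
  shows "pairing (S_map (Phi n \<gamma>)) (I_map (Poly_Mapping.single (abs_diagram (std B)) 1)) =
    (\<Sum>C\<in>Pow B. state_value n \<gamma> C)"
proof -
  have dB: "distinct_ends B" by (rule distinct_ends_sub[OF D B])
  have fin: "finite (endpoints B)" using finite_endpoints distinct_ends_finite[OF dB] .
  note mono = rank_mono_on[OF fin]
  show ?thesis
    unfolding state_sum_wf[OF wf_std[OF D B]] unfolding std_def sum_subsets_relabel[OF strict_mono_on_imp_inj_on[OF mono]]
  proof (rule sum.cong[OF refl])
    fix C assume "C \<in> Pow B"
    then have C: "C \<subseteq> B" by simp
    show "state_value n \<gamma> (relabel (\<lambda>x. card {e \<in> endpoints B. e < x}) C) = state_value n \<gamma> C"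
      by (rule state_value_relabel[OF distinct_ends_sub[OF D]])
         (use C B in \<open>auto intro: monotone_on_subset[OF mono] endpoints_mono[THEN subsetD]\<close>)
  qed
qed

section \<open>Three chords around a triangle\<close>

text \<open>
  Three pairwise disjoint chords with ends \<open>1, x\<close> and \<open>x + 1, y\<close> and \<open>0, y + 1\<close>: they bound a triangle whose arcs
  are the gaps \<open>1\<close>, \<open>x + 1\<close> and \<open>y + 1\<close>.  The directions and the markings of the three arrows are arbitrary.
\<close>

locale triangle_config =
  fixes B0 :: "int arrow set" and x y :: nat and t h :: "nat \<Rightarrow> nat" and mk :: "nat \<Rightarrow> int"
  assumes dist: "distinct_ends (B0 \<union> {(t 1, h 1, mk 1), (t 2, h 2, mk 2), (t 3, h 3, mk 3)})"
    and new: "\<And>i. i \<in> {1, 2, 3} \<Longrightarrow> (t i, h i, mk i) \<notin> B0"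
    and xy: "1 < x" "x + 1 < y"
    and ends1: "{t 1, h 1} = {1, x}" and ends2: "{t 2, h 2} = {x + 1, y}" and ends3: "{t 3, h 3} = {0, y + 1}"
begin

definition e :: "nat \<Rightarrow> int arrow" where "e i = (t i, h i, mk i)"

text \<open>
  Where a gap lies: behind the first, the second or the third chord, or (value \<open>0\<close>) at the triangle.
\<close>

definition loc :: "nat \<Rightarrow> nat" where
  "loc k = (if 1 < k \<and> k \<le> x then 1 else if x + 1 < k \<and> k \<le> y then 2 else if 0 < k \<and> k \<le> y + 1 then 0 else 3)"

text \<open>
  Whether the part of the disc behind chord \<open>i\<close> is on the left of the arrow.
\<close>

definition d :: "nat \<Rightarrow> bool" where
  "d i = (if i = 3 then t i < h i else h i < t i)"

definition c0 :: "nat set" where "c0 = reg B0 0"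

text \<open>
  The regions off the triangle: the place of a region and what the arrows of \<open>B0\<close> see of it.  When one of the
  three arrows is missing, the triangle belongs to the region behind it, so that these nodes represent all
  regions, whichever arrow is missing.
\<close>

definition nodes :: "(nat \<times> nat set) set" where
  "nodes = {(loc k, reg B0 k) | k. loc k \<noteq> 0}"

text \<open>
  No arrow of \<open>B0\<close> passes from behind one of the three chords to behind another.
\<close>

definition separated :: bool where
  "separated \<longleftrightarrow> noncrossing B0 \<and> (\<forall>s g l. (s, g, l) \<in> B0 \<longrightarrow> loc s = loc g)"

lemma loc_range: "loc k \<in> {0, 1, 2, 3}"
  by (simp add: loc_def)

lemma loc_iff:
  "loc k = 1 \<longleftrightarrow> 1 < k \<and> k \<le> x" "loc k = 2 \<longleftrightarrow> x + 1 < k \<and> k \<le> y"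
  "loc k = 3 \<longleftrightarrow> k = 0 \<or> y + 1 < k" "loc k = 0 \<longleftrightarrow> k = 1 \<or> k = x + 1 \<or> k = y + 1"
  using xy unfolding loc_def by (simp; linarith)+

lemma gap_e:
  assumes "i \<in> {1, 2, 3}"
  shows "gap_left (t i) (h i) k \<longleftrightarrow> (loc k = i) = d i"
proof -
  consider "i = 1" | "i = 2" | "i = 3" using assms by blast
  then show ?thesis
  proof cases
    case 1
    have "t 1 = 1 \<and> h 1 = x \<or> t 1 = x \<and> h 1 = 1" using ends1 by (auto simp: doubleton_eq_iff)
    then show ?thesis using 1 xy by (auto simp: gap_left_def loc_def d_def)
  next
    case 2
    have "t 2 = x + 1 \<and> h 2 = y \<or> t 2 = y \<and> h 2 = x + 1" using ends2 by (auto simp: doubleton_eq_iff)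
    then show ?thesis using 2 xy by (auto simp: gap_left_def loc_def d_def)
  next
    case 3
    have "t 3 = 0 \<and> h 3 = y + 1 \<or> t 3 = y + 1 \<and> h 3 = 0" using ends3 by (auto simp: doubleton_eq_iff)
    then show ?thesis using 3 xy by (auto simp: gap_left_def loc_def d_def)
  qed
qed

lemma specials:
  assumes "(s, g, l) \<in> B0"
  shows "s \<notin> {0, 1, x, x + 1, y, y + 1}" "g \<notin> {0, 1, x, x + 1, y, y + 1}"
proof -
  have "{s, g} \<inter> {t i, h i} = {}" if i: "i \<in> {1, 2, 3}" for i
  proof (rule distinct_ends_disjoint[OF dist])
    show "(s, g, l) \<noteq> (t i, h i, mk i)" using new[OF i] assms by blast
  qed (use assms i in auto)
  from this[of 1] this[of 2] this[of 3]
  have "{s, g} \<inter> {1, x} = {}" "{s, g} \<inter> {x + 1, y} = {}" "{s, g} \<inter> {0, y + 1} = {}"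
    unfolding ends1 ends2 ends3 by simp_all
  then show "s \<notin> {0, 1, x, x + 1, y, y + 1}" "g \<notin> {0, 1, x, x + 1, y, y + 1}" by auto
qed

lemma loc_end:
  assumes "(s, g, l) \<in> B0" shows "loc s \<in> {1, 2, 3}" "loc g \<in> {1, 2, 3}"
proof -
  have "loc s \<noteq> 0" "loc g \<noteq> 0" using specials[OF assms] unfolding loc_iff(4) by simp_all
  then show "loc s \<in> {1, 2, 3}" "loc g \<in> {1, 2, 3}" using loc_range[of s] loc_range[of g] by simp_all
qed

lemma loc_e_ends:
  assumes "i \<in> {1, 2, 3}" shows "loc (t i) \<in> {0, i}" "loc (h i) \<in> {0, i}"
proof -
  consider "i = 1" | "i = 2" | "i = 3" using assms by blast
  then have "loc (t i) \<in> {0, i} \<and> loc (h i) \<in> {0, i}"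
  proof cases
    case 1
    have "t 1 = 1 \<and> h 1 = x \<or> t 1 = x \<and> h 1 = 1" using ends1 by (auto simp: doubleton_eq_iff)
    then show ?thesis using 1 xy by (auto simp: loc_def)
  next
    case 2
    have "t 2 = x + 1 \<and> h 2 = y \<or> t 2 = y \<and> h 2 = x + 1" using ends2 by (auto simp: doubleton_eq_iff)
    then show ?thesis using 2 xy by (auto simp: loc_def)
  next
    case 3
    have "t 3 = 0 \<and> h 3 = y + 1 \<or> t 3 = y + 1 \<and> h 3 = 0" using ends3 by (auto simp: doubleton_eq_iff)
    then show ?thesis using 3 xy by (auto simp: loc_def)
  qed
  then show "loc (t i) \<in> {0, i}" "loc (h i) \<in> {0, i}" by blast+
qed

lemma e_ends_special:
  "i \<in> {1, 2, 3} \<Longrightarrow> t i \<in> {0, 1, x, x + 1, y, y + 1} \<and> h i \<in> {0, 1, x, x + 1, y, y + 1}"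
  (is "_ \<Longrightarrow> ?thesis")
proof -
  have "t 1 \<in> {1, x}" "h 1 \<in> {1, x}" "t 2 \<in> {x + 1, y}" "h 2 \<in> {x + 1, y}" "t 3 \<in> {0, y + 1}" "h 3 \<in> {0, y + 1}"
    unfolding ends1[symmetric] ends2[symmetric] ends3[symmetric] by simp_all
  then show "i \<in> {1, 2, 3} \<Longrightarrow> ?thesis" by (elim insertE emptyE) simp_all
qed

text \<open>
  An arrow of \<open>B0\<close> with both ends behind one chord has on one side of it everything that is not behind this
  chord, and also the extreme gaps behind it, next to the ends of the chord.
\<close>

lemma gap_outside:
  assumes a: "(s, g, l) \<in> B0" and L: "loc s = loc g"
    and k: "loc k \<noteq> loc s \<or> k \<in> {0, 1, 2, x, x + 1, x + 2, y, y + 1, y + 2}"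
  shows "gap_left s g k = gap_left s g 0"
proof -
  have out: "\<not> (min s g < k \<and> k \<le> max s g)"
  proof -
    have sp: "s \<noteq> 0" "s \<noteq> x" "s \<noteq> y" "g \<noteq> 0" "g \<noteq> x" "g \<noteq> y" using specials[OF a] by auto
    consider "loc s = 1" | "loc s = 2" | "loc s = 3" using loc_end(1)[OF a] by blast
    then show ?thesis
    proof cases
      case 1
      have "1 < s \<and> s < x \<and> 1 < g \<and> g < x"
        using 1 L sp loc_iff(1)[of s] loc_iff(1)[of g] by auto
      moreover have "k \<le> 1 \<or> x < k \<or> k = 2 \<or> k = x"
        using k xy unfolding 1 loc_iff(1) by auto
      ultimately show ?thesis by auto
    next
      case 2
      have "x + 1 < s \<and> s < y \<and> x + 1 < g \<and> g < y"
        using 2 L sp loc_iff(2)[of s] loc_iff(2)[of g] by auto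
      moreover have "k \<le> x + 1 \<or> y < k \<or> k = x + 2 \<or> k = y"
        using k xy unfolding 2 loc_iff(2) by auto
      ultimately show ?thesis by auto
    next
      case 3
      have "y + 1 < s \<and> y + 1 < g"
        using 3 L sp loc_iff(3)[of s] loc_iff(3)[of g] by auto
      moreover have "k \<le> y + 1 \<or> k = y + 2"
        using k xy unfolding 3 loc_iff(3) by auto
      ultimately show ?thesis by auto
    qed
  qed
  show ?thesis
  proof (cases "g < s")
    case True
    then show ?thesis using out unfolding gap_left_def by simp
  next
    case False
    then show ?thesis using out unfolding gap_left_def by simp
  qed
qed

text \<open>
  An arrow that joins the parts behind two different chords crosses both of these, so any two of the three chords
  exclude it.
\<close>

lemma noncrossing_iff_separated:
  assumes I: "I \<subseteq> {1, 2, 3}" and i: "i \<in> I" and j: "j \<in> I" and ij: "i \<noteq> j"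
  shows "noncrossing (B0 \<union> e ` I) \<longleftrightarrow> separated"
proof
  have e_mem: "(t i', h i', mk i') \<in> e ` I" if "i' \<in> I" for i' using that unfolding e_def by blast
  assume nc: "noncrossing (B0 \<union> e ` I)"
  show separated
    unfolding separated_def
  proof (intro conjI allI impI)
    show "noncrossing B0" by (rule noncrossingI, rule noncrossingD[OF nc]) auto
    fix s g l assume a: "(s, g, l) \<in> B0"
    have same: "loc s = i' \<longleftrightarrow> loc g = i'" if i': "i' \<in> I" for i'
    proof -
      have i3: "i' \<in> {1, 2, 3}" using i' I by blast
      have "(t i', h i') \<noteq> (s, g)"
        using e_ends_special[OF i3] specials[OF a] by auto
      then have "gap_left (t i') (h i') s = gap_left (t i') (h i') g"
        by (intro noncrossingD[OF nc, of _ _ "mk i'" _ _ l]) (use a e_mem[OF i'] in auto)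
      then show ?thesis unfolding gap_e[OF i3] by auto
    qed
    show "loc s = loc g"
    proof -
      have "i \<in> {1, 2, 3}" "j \<in> {1, 2, 3}" using i j I by blast+
      then show ?thesis using same[OF i] same[OF j] loc_end[OF a] ij by auto
    qed
  qed
next
  assume sep: separated
  show "noncrossing (B0 \<union> e ` I)"
  proof (rule noncrossingI)
    fix t1 h1 l1 t2 h2 l2
    assume a: "(t1, h1, l1) \<in> B0 \<union> e ` I" and b: "(t2, h2, l2) \<in> B0 \<union> e ` I" and ne: "(t1, h1) \<noteq> (t2, h2)"
    consider "(t1, h1, l1) \<in> B0" "(t2, h2, l2) \<in> B0"
      | j' where "(t1, h1, l1) \<in> B0" "j' \<in> I" "t2 = t j'" "h2 = h j'"
      | i' where "i' \<in> I" "t1 = t i'" "h1 = h i'" "(t2, h2, l2) \<in> B0"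
      | i' j' where "i' \<in> I" "t1 = t i'" "h1 = h i'" "j' \<in> I" "t2 = t j'" "h2 = h j'"
    proof -
      have "(t1, h1, l1) \<in> B0 \<or> (\<exists>i'\<in>I. t1 = t i' \<and> h1 = h i')" using a by (auto simp: e_def)
      moreover have "(t2, h2, l2) \<in> B0 \<or> (\<exists>j'\<in>I. t2 = t j' \<and> h2 = h j')" using b by (auto simp: e_def)
      ultimately show ?thesis using that by metis
    qed
    then show "gap_left t1 h1 t2 = gap_left t1 h1 h2"
    proof cases
      case 1
      have "noncrossing B0" using sep unfolding separated_def by (rule conjunct1)
      from noncrossingD[OF this 1 ne] show ?thesis .
    next
      case 2
      have L: "loc t1 = loc h1" using sep 2(1) unfolding separated_def by blast
      have "j' \<in> {1, 2, 3}" using 2(2) I by blast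
      from e_ends_special[OF this] show ?thesis
        using gap_outside[OF 2(1) L, of t2] gap_outside[OF 2(1) L, of h2] unfolding 2(3,4) by auto
    next
      case 3
      have L: "loc t2 = loc h2" using sep 3(4) unfolding separated_def by blast
      have "i' \<in> {1, 2, 3}" using 3(1) I by blast
      then show ?thesis unfolding 3(2,3) by (simp only: gap_e L)
    next
      case 4
      have i3: "i' \<in> {1, 2, 3}" and j3: "j' \<in> {1, 2, 3}" using 4 I by blast+
      have "i' \<noteq> j'" using ne 4(2,3,5,6) by blast
      then have "loc t2 \<noteq> i'" "loc h2 \<noteq> i'"
        using loc_e_ends[OF j3] i3 unfolding 4(5,6) by auto
      then show ?thesis unfolding 4(2,3) gap_e[OF i3] by simp
    qed
  qed
qed

lemma dist0: "distinct_ends B0"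
  by (rule distinct_ends_mono[OF dist]) blast

lemma reg0_iff: "(s, g, l) \<in> B0 \<Longrightarrow> s \<in> reg B0 k \<longleftrightarrow> gap_left s g k"
  by (rule reg_mem_iff[OF dist0])

lemma t_new: "i \<in> {1, 2, 3} \<Longrightarrow> t i \<notin> fst ` B0"
proof
  assume i: "i \<in> {1, 2, 3}" and "t i \<in> fst ` B0"
  then obtain g l where "(t i, g, l) \<in> B0" by auto
  from specials(1)[OF this] show False using conjunct1[OF e_ends_special[OF i]] by (rule notE)
qed

lemma t_inj: "i \<in> {1, 2, 3} \<Longrightarrow> j \<in> {1, 2, 3} \<Longrightarrow> t i = t j \<Longrightarrow> i = j"
proof -
  have "t 1 \<in> {1, x}" "t 2 \<in> {x + 1, y}" "t 3 \<in> {0, y + 1}"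
    unfolding ends1[symmetric] ends2[symmetric] ends3[symmetric] by simp_all
  then have ne: "t 1 \<noteq> t 2" "t 1 \<noteq> t 3" "t 2 \<noteq> t 3" using xy by (elim insertE emptyE; simp)+
  assume ij: "i \<in> {1, 2, 3}" "j \<in> {1, 2, 3}" "t i = t j"
  consider "i = 1" | "i = 2" | "i = 3" using ij(1) by blast
  then show "i = j"
    by cases (use ij(2,3) ne ne[symmetric] in \<open>elim insertE emptyE; simp\<close>)+
qed

lemma reg0_not_t: "i \<in> {1, 2, 3} \<Longrightarrow> t i \<notin> reg B0 k"
  using t_new reg_tails by blast

lemma reg0_eqI:
  assumes "\<And>s g l. (s, g, l) \<in> B0 \<Longrightarrow> gap_left s g k = gap_left s g k'"
  shows "reg B0 k = reg B0 k'"
  unfolding reg_def using assms by blast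

lemma nodes_loc: "(L, R) \<in> nodes \<Longrightarrow> L \<in> {1, 2, 3} \<and> (\<exists>k. loc k = L \<and> R = reg B0 k)"
  (is "_ \<Longrightarrow> ?thesis")
proof -
  assume "(L, R) \<in> nodes"
  then obtain k where k: "L = loc k" "R = reg B0 k" "loc k \<noteq> 0" unfolding nodes_def by blast
  then show ?thesis using loc_range[of k] by auto
qed

lemma nodesI: "loc k \<noteq> 0 \<Longrightarrow> (loc k, reg B0 k) \<in> nodes"
  unfolding nodes_def by blast

context
  assumes sep: separated
begin

lemma sep_loc: "(s, g, l) \<in> B0 \<Longrightarrow> loc s = loc g"
  using sep unfolding separated_def by blast

lemma reg0_center: "loc k = 0 \<Longrightarrow> reg B0 k = c0"
  unfolding c0_def
proof (rule reg0_eqI)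
  fix s g l assume k: "loc k = 0" and a: "(s, g, l) \<in> B0"
  show "gap_left s g k = gap_left s g 0"
    by (rule gap_outside[OF a sep_loc[OF a]]) (use loc_end(1)[OF a] k in auto)
qed

lemma c0_node:
  assumes "i \<in> {1, 2, 3}" shows "(i, c0) \<in> nodes"
proof -
  (* a gap behind chord i next to one of its ends *)
  define k where "k = (if i = 1 then 2 else if i = 2 then x + 2 else 0)"
  have l: "loc k = i" using assms xy by (auto simp: k_def loc_def)
  have "reg B0 k = c0" unfolding c0_def
  proof (rule reg0_eqI)
    fix s g l assume a: "(s, g, l) \<in> B0"
    show "gap_left s g k = gap_left s g 0"
      by (rule gap_outside[OF a sep_loc[OF a]]) (auto simp: k_def)
  qed
  then show ?thesis using nodesI[of k] l assms by auto
qed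

text \<open>
  An arrow of \<open>B0\<close> lies behind one chord and sees everything elsewhere alike.  A set of tails that occurs at two
  places is therefore the one seen at the triangle.
\<close>

lemma node_unique:
  assumes "(i, R) \<in> nodes" "(j, R) \<in> nodes" "i \<noteq> j" shows "R = c0"
proof -
  obtain k k' where k: "loc k = i" "R = reg B0 k" "loc k' = j" "R = reg B0 k'"
    using nodes_loc[OF assms(1)] nodes_loc[OF assms(2)] by blast
  have "s \<in> R \<longleftrightarrow> s \<in> c0" for s
  proof (cases "s \<in> fst ` B0")
    case False
    then show ?thesis using k(2) reg_tails[of B0] unfolding c0_def by blast
  next
    case True
    then obtain g l where a: "(s, g, l) \<in> B0" by auto
    have "loc k \<noteq> loc s \<or> loc k' \<noteq> loc s" using k(1,3) assms(3) by auto
    then have "gap_left s g k = gap_left s g 0 \<or> gap_left s g k' = gap_left s g 0"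
      using gap_outside[OF a sep_loc[OF a]] by blast
    moreover have "s \<in> R \<longleftrightarrow> gap_left s g k" by (simp only: k(2) reg0_iff[OF a])
    moreover have "s \<in> R \<longleftrightarrow> gap_left s g k'" by (simp only: k(4) reg0_iff[OF a])
    ultimately show ?thesis unfolding c0_def reg0_iff[OF a] by blast
  qed
  then show ?thesis by blast
qed

end

text \<open>
  The pair of regions along arrow \<open>i\<close> when arrow \<open>l\<close> is missing: the region behind chord \<open>i\<close> and the one formed by
  the triangle and the region behind chord \<open>l\<close>.
\<close>

definition order_pair :: "nat \<Rightarrow> nat \<Rightarrow> (nat \<times> nat set) \<times> (nat \<times> nat set)" where
  "order_pair i l = (if d i then ((i, c0), (l, c0)) else ((l, c0), (i, c0)))"

definition inner_order :: "((nat \<times> nat set) \<times> (nat \<times> nat set)) set" where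
  "inner_order = {((L, R), (L, R - {s})) | L R s. (L, R) \<in> nodes \<and> (L, R - {s}) \<in> nodes \<and> s \<in> R}"

definition inner_conds :: "((nat \<times> nat set) set \<times> int) set" where
  "inner_conds = (\<lambda>(s, g, m). ({z \<in> nodes. s \<in> snd z}, m)) ` B0"

definition left_nodes :: "nat \<Rightarrow> (nat \<times> nat set) set" where
  "left_nodes i = {z \<in> nodes. (fst z = i) = d i}"

text \<open>
  Adjoining to a node the tails of those of the two arrows that have it on their left gives the regions of the
  diagram.  Two regions that differ in an arrow of \<open>B0\<close> have the same place; two regions that differ in
  arrow \<open>i\<close> are at the places \<open>i\<close> and \<open>l\<close> and are the ones along that arrow by \<open>node_unique\<close>.
\<close>

lemma pair_count:
  assumes sep: separated and ijl: "i \<in> {1, 2, 3}" "j \<in> {1, 2, 3}" "l \<in> {1, 2, 3}" "i \<noteq> j" "i \<noteq> l" "j \<noteq> l"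
  shows "chain_count \<gamma> (B0 \<union> {e i, e j}) =
    card (numberings \<gamma> (card B0 + 3) nodes (inner_order \<union> {order_pair i l, order_pair j l})
      (inner_conds \<union> {(left_nodes i, mk i), (left_nodes j, mk j)}))"
proof -
  let ?B = "B0 \<union> {e i, e j}"
  have nc: "noncrossing ?B" using noncrossing_iff_separated[of "{i, j}" i j] sep ijl by simp
  have fin: "finite B0" by (rule distinct_ends_finite[OF dist0])
  have ne: "e i \<noteq> e j" using t_inj[OF ijl(1,2)] ijl(4) unfolding e_def by auto
  have card: "card ?B + 1 = card B0 + 3"
    using fin ne new[OF ijl(1)] new[OF ijl(2)] by (simp add: e_def)
  (* the tails of those of the two arrows that have place L on their left *)
  define bits where "bits L = {u. u = t i \<and> (L = i) = d i \<or> u = t j \<and> (L = j) = d j}" for L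
  define g where "g z = snd z \<union> bits (fst z)" for z
  have tij: "t i \<noteq> t j" using t_inj[OF ijl(1,2)] ijl(4) by blast
  have L3: "L = i \<or> L = j \<or> L = l" if "L \<in> {1, 2, 3}" for L using ijl that by auto
  have mem_i: "t i \<in> g (L, R) \<longleftrightarrow> (L = i) = d i" and mem_j: "t j \<in> g (L, R) \<longleftrightarrow> (L = j) = d j"
    if "(L, R) \<in> nodes" for L R
    using nodes_loc[OF that] reg0_not_t ijl tij unfolding g_def bits_def by auto
  have rest: "g (L, R) - {t i, t j} = R" if "(L, R) \<in> nodes" for L R
    using nodes_loc[OF that] reg0_not_t[OF ijl(1)] reg0_not_t[OF ijl(2)] unfolding g_def bits_def by auto
  have loc_det: "L = L'" if "(L, R) \<in> nodes" "(L', R') \<in> nodes" "(L = i) = (L' = i)" "(L = j) = (L' = j)" for L L' R R'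
    using L3 nodes_loc[OF that(1)] nodes_loc[OF that(2)] that(3,4) by metis
  have regB: "reg ?B k = reg B0 k \<union> bits (loc k)" for k
  proof -
    have "reg ?B k = reg B0 k \<union> {u. u = t i \<and> gap_left (t i) (h i) k} \<union> {u. u = t j \<and> gap_left (t j) (h j) k}"
      unfolding reg_def e_def by blast
    then show ?thesis unfolding gap_e[OF ijl(1)] gap_e[OF ijl(2)] bits_def by blast
  qed
  have regs: "regs ?B = g ` nodes"
  proof
    show "regs ?B \<subseteq> g ` nodes"
      unfolding regs_def
    proof (rule image_subsetI)
      fix k
      show "reg ?B k \<in> g ` nodes"
      proof (cases "loc k = 0")
        case False
        have "reg ?B k = g (loc k, reg B0 k)" unfolding regB g_def by simp
        then show ?thesis using nodesI[OF False] by blast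
      next
        case True
        have "bits 0 = bits l" unfolding bits_def using ijl by auto
        then have "reg ?B k = g (l, c0)" unfolding regB True reg0_center[OF sep True] g_def by simp
        then show ?thesis using c0_node[OF sep ijl(3)] by blast
      qed
    qed
    show "g ` nodes \<subseteq> regs ?B"
    proof (rule image_subsetI)
      fix z assume "z \<in> nodes"
      then obtain k where "z = (loc k, reg B0 k)" unfolding nodes_def by blast
      then have "g z = reg ?B k" unfolding regB g_def by simp
      then show "g z \<in> regs ?B" unfolding regs_def by blast
    qed
  qed
  have inj: "inj_on g nodes"
  proof (rule inj_onI)
    fix z z' assume z: "z \<in> nodes" "z' \<in> nodes" "g z = g z'"
    obtain L R L' R' where zz: "z = (L, R)" "z' = (L', R')" by (cases z, cases z')
    note z = z[unfolded zz]
    have "L = L'" by (rule loc_det[OF z(1,2)]) (use mem_i[OF z(1)] mem_i[OF z(2)] mem_j[OF z(1)] mem_j[OF z(2)] z(3) in auto)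
    moreover have "R = R'" using rest[OF z(1)] rest[OF z(2)] z(3) by simp
    ultimately show "z = z'" unfolding zz by simp
  qed
  have bij: "bij_betw g nodes (regs ?B)" unfolding bij_betw_def regs using inj by blast
  let ?O = "inner_order \<union> {order_pair i l, order_pair j l}"
  have step: "order_pair a l \<in> nodes \<times> nodes \<and>
      map_prod g g (order_pair a l) \<in> neighbours (regs ?B)" if a: "a = i \<or> a = j" for a
  proof -
    have nd: "(a, c0) \<in> nodes" "(l, c0) \<in> nodes" using c0_node[OF sep] ijl a by blast+
    have ta: "t a \<notin> c0" using a ijl reg0_not_t unfolding c0_def by blast
    have r: "g (a, c0) \<in> regs ?B" "g (l, c0) \<in> regs ?B" unfolding regs using nd by blast+
    show ?thesis
    proof (cases "d a")
      case True
      have "t a \<in> g (a, c0)" using a True unfolding g_def bits_def by auto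
      moreover have "g (l, c0) = g (a, c0) - {t a}"
        using a True ta tij ijl unfolding g_def bits_def by auto
      ultimately show ?thesis using r nd True unfolding order_pair_def neighbours_def by auto
    next
      case False
      have "t a \<in> g (l, c0)" using a False ijl unfolding g_def bits_def by auto
      moreover have "g (a, c0) = g (l, c0) - {t a}"
        using a False ta tij ijl unfolding g_def bits_def by auto
      ultimately show ?thesis using r nd False unfolding order_pair_def neighbours_def by auto
    qed
  qed
  have sub: "?O \<subseteq> nodes \<times> nodes"
    using step unfolding inner_order_def by blast
  have "map_prod g g ` ?O = neighbours (regs ?B)"
  proof
    have "map_prod g g z \<in> neighbours (regs ?B)" if inner: "z \<in> inner_order" for z
    proof -
      obtain L R s where z: "z = ((L, R), (L, R - {s}))" "(L, R) \<in> nodes" "(L, R - {s}) \<in> nodes" "s \<in> R"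
        using inner unfolding inner_order_def by blast
      have "s \<noteq> t i" "s \<noteq> t j" using z(4) nodes_loc[OF z(2)] reg0_not_t ijl by blast+
      then have "g (L, R - {s}) = g (L, R) - {s}" unfolding g_def bits_def by auto
      moreover have "s \<in> g (L, R)" using z(4) unfolding g_def by simp
      moreover have "g (L, R) \<in> regs ?B" "g (L, R - {s}) \<in> regs ?B" unfolding regs using z by blast+
      ultimately show ?thesis unfolding z(1) neighbours_def by auto
    qed
    moreover have "map_prod g g (order_pair i l) \<in> neighbours (regs ?B)"
        "map_prod g g (order_pair j l) \<in> neighbours (regs ?B)" using step by simp_all
    ultimately show "map_prod g g ` ?O \<subseteq> neighbours (regs ?B)"
      by (intro image_subsetI) (elim UnE insertE emptyE; simp only:)
    show "neighbours (regs ?B) \<subseteq> map_prod g g ` ?O"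
    proof
      fix p assume "p \<in> neighbours (regs ?B)"
      then obtain S u where S: "p = (S, S - {u})" "S \<in> regs ?B" "S - {u} \<in> regs ?B" "u \<in> S"
        unfolding neighbours_def by blast
      obtain L R where z: "(L, R) \<in> nodes" "S = g (L, R)" using S(2) unfolding regs by auto
      obtain L' R' where z': "(L', R') \<in> nodes" "S - {u} = g (L', R')" using S(3) unfolding regs by auto
      have p: "p = map_prod g g ((L, R), (L', R'))" using S(1) z(2) z'(2) by simp
      (* the case of two regions that differ in arrow a, where b is the other arrow present *)
      have crossing: "((L, R), (L', R')) = order_pair a l"
        if a: "a = i \<or> a = j" and u: "u = t a"
          and b: "b = i \<or> b = j" "a \<noteq> b" and Lb: "(L = b) = (L' = b)" and La: "(L = a) = d a" "(L' = a) \<noteq> d a" for a b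
      proof -
        have "R = R'" using rest[OF z(1)] rest[OF z'(1)] z(2) z'(2) a u by blast
        have neq: "L \<noteq> L'" using La by auto
        have R: "R = c0" by (rule node_unique[OF sep z(1) _ neq]) (use z'(1) \<open>R = R'\<close> in simp)
        have Ls: "L = a \<or> L = b \<or> L = l" "L' = a \<or> L' = b \<or> L' = l"
          using L3 nodes_loc[OF z(1)] nodes_loc[OF z'(1)] a b by blast+
        have "if d a then L = a \<and> L' = l else L = l \<and> L' = a"
          using Ls La Lb b(2) neq by (auto split: if_splits)
        then show ?thesis using R \<open>R = R'\<close> unfolding order_pair_def by (auto split: if_splits)
      qed
      have i_mem: "t i \<in> S \<longleftrightarrow> (L = i) = d i" "t i \<in> S - {u} \<longleftrightarrow> (L' = i) = d i"
        by (rule mem_i[OF z(1), folded z(2)], rule mem_i[OF z'(1), folded z'(2)])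
      have j_mem: "t j \<in> S \<longleftrightarrow> (L = j) = d j" "t j \<in> S - {u} \<longleftrightarrow> (L' = j) = d j"
        by (rule mem_j[OF z(1), folded z(2)], rule mem_j[OF z'(1), folded z'(2)])
      have "((L, R), (L', R')) \<in> ?O"
      proof (cases "u = t i")
        case True
        have "(L = j) = (L' = j)" using j_mem True tij by auto
        moreover have "(L = i) = d i" "(L' = i) \<noteq> d i" using i_mem True S(4) by auto
        ultimately show ?thesis using crossing[of i j] True ijl by blast
      next
        case ui: False
        show ?thesis
        proof (cases "u = t j")
          case True
          have "(L = i) = (L' = i)" using i_mem True tij by auto
          moreover have "(L = j) = d j" "(L' = j) \<noteq> d j" using j_mem True S(4) by auto
          ultimately show ?thesis using crossing[of j i] True ijl by blast
        next
          case False
          have "L = L'" by (rule loc_det[OF z(1) z'(1)]) (use i_mem j_mem ui False in auto)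
          moreover have "u \<in> R" using rest[OF z(1)] z(2) S(4) ui False by blast
          moreover have "R' = R - {u}" using rest[OF z(1)] rest[OF z'(1)] z(2) z'(2) by blast
          ultimately show ?thesis using z(1) z'(1) unfolding inner_order_def by blast
        qed
      qed
      then show "p \<in> map_prod g g ` ?O" using p by (rule rev_image_eqI)
    qed
  qed
  moreover have "(\<lambda>(S, w). (g ` S, w)) ` (inner_conds \<union> {(left_nodes i, mk i), (left_nodes j, mk j)}) = marking_conds ?B"
  proof -
    have inner: "g ` {z \<in> nodes. s \<in> snd z} = {R \<in> regs ?B. s \<in> R}" if a: "(s, g', m) \<in> B0" for s g' m
    proof -
      have "s \<noteq> t i" "s \<noteq> t j" using t_new[OF ijl(1)] t_new[OF ijl(2)] a by force+
      then have "s \<in> g z \<longleftrightarrow> s \<in> snd z" for z unfolding g_def bits_def by blast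
      then show ?thesis unfolding regs by blast
    qed
    have outer: "g ` left_nodes a = {R \<in> regs ?B. t a \<in> R}" if "a = i \<or> a = j" for a
      unfolding regs left_nodes_def using that mem_i mem_j by force
    have "(\<lambda>(S, w). (g ` S, w)) ` inner_conds = (\<lambda>(s, g', m). ({R \<in> regs ?B. s \<in> R}, m)) ` B0"
      unfolding inner_conds_def image_image
    proof (rule image_cong[OF refl])
      fix a assume a: "a \<in> B0"
      obtain s g' m where at: "a = (s, g', m)" by (cases a)
      show "(case case a of (s, g', m) \<Rightarrow> ({z \<in> nodes. s \<in> snd z}, m) of (S, w) \<Rightarrow> (g ` S, w)) =
        (case a of (s, g', m) \<Rightarrow> ({R \<in> regs ?B. s \<in> R}, m))"
        unfolding at prod.case inner[OF a[unfolded at]] ..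
    qed
    then show ?thesis
      unfolding marking_conds_def image_Un using outer[of i] outer[of j] by (simp add: e_def)
  qed
  moreover have "card (numberings \<gamma> N (regs ?B) (map_prod g g ` ?O)
      ((\<lambda>(S, w). (g ` S, w)) ` (inner_conds \<union> {(left_nodes i, mk i), (left_nodes j, mk j)}))) =
    card (numberings \<gamma> N nodes ?O (inner_conds \<union> {(left_nodes i, mk i), (left_nodes j, mk j)}))" for N
    by (rule card_numberings_transfer[OF bij sub]) (auto simp: inner_conds_def left_nodes_def)
  ultimately show ?thesis unfolding chain_count_def card using nc by (simp only: if_True)
qed

text \<open>
  The weight that the marking of arrow \<open>i\<close> prescribes for the regions behind chord \<open>i\<close>.  In these terms the
  triangle condition reads \<open>u K 1 + u K 2 + u K 3 = K\<close>, for both cyclic orders of the three arrows.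
\<close>

definition u :: "int \<Rightarrow> nat \<Rightarrow> int" where
  "u K i = (if d i then mk i else K - mk i)"

text \<open>
  The conditions that do not depend on which of the three arrows is missing.
\<close>

definition base_numberings :: "(nat \<Rightarrow> int) \<Rightarrow> int \<Rightarrow> (nat \<times> nat set \<Rightarrow> nat) set" where
  "base_numberings \<gamma> K = {\<nu> \<in> numberings \<gamma> (card B0 + 3) nodes inner_order inner_conds.
     \<forall>i\<in>{1, 2, 3}. (\<Sum>z | z \<in> nodes \<and> fst z = i. \<gamma> (\<nu> z)) = u K i}"

text \<open>
  The weights behind the three chords add up to \<open>K\<close>, as do the prescribed ones; so the conditions for two of the
  arrows imply the condition for the third.
\<close>

lemma pair_count_base:
  assumes sep: separated and ijl: "i \<in> {1, 2, 3}" "j \<in> {1, 2, 3}" "l \<in> {1, 2, 3}" "i \<noteq> j" "i \<noteq> l" "j \<noteq> l"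
    and K: "K = (\<Sum>i = 1..card B0 + 3. \<gamma> i)" and tri: "u K 1 + u K 2 + u K 3 = K"
  shows "chain_count \<gamma> (B0 \<union> {e i, e j}) = card {\<nu> \<in> base_numberings \<gamma> K.
    (\<lambda>(p, q). \<nu> p < \<nu> q) (order_pair i l) \<and> (\<lambda>(p, q). \<nu> p < \<nu> q) (order_pair j l)}"
proof -
  let ?N = "numberings \<gamma> (card B0 + 3) nodes inner_order inner_conds"
  have "(\<Sum>z\<in>left_nodes i. \<gamma> (\<nu> z)) = mk i \<and> (\<Sum>z\<in>left_nodes j. \<gamma> (\<nu> z)) = mk j \<longleftrightarrow>
      (\<forall>i\<in>{1, 2, 3}. (\<Sum>z | z \<in> nodes \<and> fst z = i. \<gamma> (\<nu> z)) = u K i)"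
    if \<nu>: "\<nu> \<in> ?N" for \<nu>
  proof -
    define w where "w a = (\<Sum>z | z \<in> nodes \<and> fst z = a. \<gamma> (\<nu> z))" for a :: nat
    have fin: "finite nodes" by (rule numberings_finite[OF \<nu>])
    have total: "(\<Sum>z\<in>nodes. \<gamma> (\<nu> z)) = K" using numberings_sum_all[OF \<nu>] K by simp
    have split: "nodes = {z. z \<in> nodes \<and> fst z = 1} \<union> ({z. z \<in> nodes \<and> fst z = 2} \<union> {z. z \<in> nodes \<and> fst z = 3})"
      using nodes_loc by fastforce
    have sum3: "w 1 + (w 2 + w 3) = K"
    proof -
      have "(\<Sum>z\<in>{z. z \<in> nodes \<and> fst z = 1} \<union> ({z. z \<in> nodes \<and> fst z = 2} \<union> {z. z \<in> nodes \<and> fst z = 3}). \<gamma> (\<nu> z)) =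
        w 1 + (w 2 + w 3)"
        unfolding w_def using fin by (subst sum.union_disjoint, simp, simp, force, subst sum.union_disjoint) auto
      then show ?thesis using total split by simp
    qed
    have left: "(\<Sum>z\<in>left_nodes a. \<gamma> (\<nu> z)) = mk a \<longleftrightarrow> w a = u K a" for a
    proof (cases "d a")
      case True
      then have "left_nodes a = {z. z \<in> nodes \<and> fst z = a}" unfolding left_nodes_def by auto
      then show ?thesis using True unfolding w_def u_def by simp
    next
      case False
      then have "left_nodes a = nodes - {z. z \<in> nodes \<and> fst z = a}" unfolding left_nodes_def by auto
      then have "(\<Sum>z\<in>left_nodes a. \<gamma> (\<nu> z)) = K - w a"
        unfolding w_def total[symmetric] using fin by (simp add: sum_diff)
      then show ?thesis using False unfolding u_def by auto
    qed
    have "(w i = u K i \<and> w j = u K j) \<longleftrightarrow> (\<forall>a\<in>{1, 2, 3}. w a = u K a)"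
    proof -
      have "w i + (w j + w l) = K \<and> u K i + (u K j + u K l) = K"
        using sum3 tri ijl by auto
      moreover have "{1, 2, 3} = {i, j, l}" using ijl by auto
      ultimately show ?thesis by auto
    qed
    then show ?thesis unfolding left w_def .
  qed
  then have "numberings \<gamma> (card B0 + 3) nodes (inner_order \<union> {order_pair i l, order_pair j l})
      (inner_conds \<union> {(left_nodes i, mk i), (left_nodes j, mk j)}) =
    {\<nu> \<in> base_numberings \<gamma> K.
    (\<lambda>(p, q). \<nu> p < \<nu> q) (order_pair i l) \<and> (\<lambda>(p, q). \<nu> p < \<nu> q) (order_pair j l)}"
    (is "?L = ?R")
  proof -
    assume *: "\<And>\<nu>. \<nu> \<in> ?N \<Longrightarrow> (\<Sum>z\<in>left_nodes i. \<gamma> (\<nu> z)) = mk i \<and> (\<Sum>z\<in>left_nodes j. \<gamma> (\<nu> z)) = mk j \<longleftrightarrow>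
      (\<forall>i\<in>{1, 2, 3}. (\<Sum>z | z \<in> nodes \<and> fst z = i. \<gamma> (\<nu> z)) = u K i)"
    have L: "\<nu> \<in> ?L \<longleftrightarrow> \<nu> \<in> ?N \<and> ((\<Sum>z\<in>left_nodes i. \<gamma> (\<nu> z)) = mk i \<and> (\<Sum>z\<in>left_nodes j. \<gamma> (\<nu> z)) = mk j)
      \<and> (\<lambda>(p, q). \<nu> p < \<nu> q) (order_pair i l) \<and> (\<lambda>(p, q). \<nu> p < \<nu> q) (order_pair j l)" for \<nu>
      unfolding numberings_def mem_Collect_eq ball_Un by auto
    show ?thesis
    proof (rule set_eqI)
      fix \<nu>
      show "\<nu> \<in> ?L \<longleftrightarrow> \<nu> \<in> ?R"
        unfolding L base_numberings_def mem_Collect_eq using *[of \<nu>]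
        by (cases "\<nu> \<in> ?N") (simp_all only: simp_thms)
    qed
  qed
  then show ?thesis using pair_count[OF sep ijl] by simp
qed

text \<open>
  With all three arrows present the triangle is a region of its own, and the prescribed weights of the other
  regions already add up to \<open>K\<close>; nothing is left for the triangle, whose weight is not \<open>0\<close>.
\<close>

lemma triple_zero:
  assumes nz: "\<forall>i\<in>{1..card B0 + 4}. \<gamma> i \<noteq> 0"
    and K: "K = (\<Sum>i = 1..card B0 + 4. \<gamma> i)" and tri: "u K 1 + u K 2 + u K 3 = K"
  shows "chain_count \<gamma> (B0 \<union> {e 1, e 2, e 3}) = 0"
proof (cases "noncrossing (B0 \<union> {e 1, e 2, e 3})")
  case False
  then show ?thesis by (simp add: chain_count_def)
next
  case True
  let ?B = "B0 \<union> {e 1, e 2, e 3}"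
  have sep: separated
    using noncrossing_iff_separated[of "{1, 2, 3}" 1 2] True by simp
  have fin: "finite B0" by (rule distinct_ends_finite[OF dist0])
  have ne: "e 1 \<noteq> e 2" "e 1 \<noteq> e 3" "e 2 \<noteq> e 3"
    using t_inj[of 1 2] t_inj[of 1 3] t_inj[of 2 3] unfolding e_def by auto
  have card: "card ?B + 1 = card B0 + 4"
    using fin ne new[of 1] new[of 2] new[of 3] by (simp add: e_def)
  have mem: "t i \<in> reg ?B k \<longleftrightarrow> (loc k = i) = d i" if i: "i \<in> {1, 2, 3}" for i k
  proof -
    have "t i \<in> reg ?B k \<longleftrightarrow> gap_left (t i) (h i) k"
      by (rule reg_mem_iff[of _ _ _ "mk i"]) (use dist i in \<open>auto simp: e_def\<close>)
    then show ?thesis unfolding gap_e[OF i] .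
  qed
  have regB: "reg ?B k = reg B0 k \<union> {t i | i. i \<in> {1, 2, 3} \<and> (loc k = i) = d i}" for k
  proof -
    have "reg ?B k = reg B0 k \<union> {t i | i. i \<in> {1, 2, 3} \<and> gap_left (t i) (h i) k}"
      unfolding reg_def e_def by blast
    then show ?thesis using gap_e by blast
  qed
  have l1: "loc 1 = 0" using xy by (simp add: loc_def)
  define C where "C = reg ?B 1"
  have center: "reg ?B k = C" if "loc k = 0" for k
    unfolding C_def regB reg0_center[OF sep that] reg0_center[OF sep l1] that l1 ..
  have False if \<nu>: "\<nu> \<in> numberings \<gamma> (card B0 + 4) (regs ?B) Ord (marking_conds ?B)" for \<nu> Ord
  proof -
    define P where "P i = {R \<in> regs ?B. (t i \<in> R) = d i}" for i
    define w where "w i = (\<Sum>R\<in>P i. \<gamma> (\<nu> R))" for i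
    have finr: "finite (regs ?B)" by (rule numberings_finite[OF \<nu>])
    have total: "(\<Sum>R\<in>regs ?B. \<gamma> (\<nu> R)) = K" using numberings_sum_all[OF \<nu>] K by simp
    have P_iff: "reg ?B k \<in> P i \<longleftrightarrow> loc k = i" if "i \<in> {1, 2, 3}" for i k
      unfolding P_def using mem[OF that] by (auto simp: regs_def)
    have Preg: "R \<in> P i \<Longrightarrow> \<exists>k. R = reg ?B k" for R i unfolding P_def regs_def by blast
    have w: "w i = u K i" if i: "i \<in> {1, 2, 3}" for i
    proof -
      have "({R \<in> regs ?B. t i \<in> R}, mk i) \<in> marking_conds ?B"
        unfolding marking_conds_def using i by (auto simp: e_def)
      then have sum: "(\<Sum>R | R \<in> regs ?B \<and> t i \<in> R. \<gamma> (\<nu> R)) = mk i"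
        by (rule numberings_marking[OF \<nu>])
      show ?thesis
      proof (cases "d i")
        case True
        then have "P i = {R. R \<in> regs ?B \<and> t i \<in> R}" unfolding P_def by auto
        then show ?thesis using sum True unfolding w_def u_def by simp
      next
        case False
        then have "P i = regs ?B - {R. R \<in> regs ?B \<and> t i \<in> R}" unfolding P_def by auto
        then have "w i = K - mk i" unfolding w_def total[symmetric] sum[symmetric] using finr by (simp add: sum_diff)
        then show ?thesis using False unfolding u_def by simp
      qed
    qed
    have "regs ?B = {C} \<union> (P 1 \<union> (P 2 \<union> P 3))"
    proof
      show "{C} \<union> (P 1 \<union> (P 2 \<union> P 3)) \<subseteq> regs ?B" unfolding C_def P_def regs_def by blast
      show "regs ?B \<subseteq> {C} \<union> (P 1 \<union> (P 2 \<union> P 3))"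
      proof
        fix R assume "R \<in> regs ?B"
        then obtain k where k: "R = reg ?B k" unfolding regs_def by blast
        show "R \<in> {C} \<union> (P 1 \<union> (P 2 \<union> P 3))"
          using loc_range[of k] center[of k] P_iff[of 1 k] P_iff[of 2 k] P_iff[of 3 k] unfolding k by auto
      qed
    qed
    moreover have disj: "P i \<inter> P j = {}" if "i \<in> {1, 2, 3}" "j \<in> {1, 2, 3}" "i \<noteq> j" for i j
      using P_iff[OF that(1)] P_iff[OF that(2)] that(3) Preg[of _ i] by fast
    moreover have notC: "C \<notin> P i" if "i \<in> {1, 2, 3}" for i
      unfolding C_def P_iff[OF that] l1 using that by auto
    moreover have "finite (P i)" for i using finr unfolding P_def by simp
    ultimately have "(\<Sum>R\<in>regs ?B. \<gamma> (\<nu> R)) = \<gamma> (\<nu> C) + (w 1 + (w 2 + w 3))"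
      unfolding w_def by (simp add: sum.union_disjoint Int_Un_distrib)
    then have "\<gamma> (\<nu> C) = 0" using total w tri by simp
    moreover have "\<nu> C \<in> {1..card B0 + 4}"
      by (rule numberings_range[OF \<nu>]) (simp add: C_def regs_def)
    ultimately show False using nz by blast
  qed
  then have "numberings \<gamma> (card ?B + 1) (regs ?B) (neighbours (regs ?B)) (marking_conds ?B) = {}"
    unfolding card by blast
  then show ?thesis by (simp add: chain_count_def)
qed

lemma finite_base: "finite (base_numberings \<gamma> K)"
proof (cases "base_numberings \<gamma> K = {}")
  case False
  then obtain \<nu> where "\<nu> \<in> numberings \<gamma> (card B0 + 3) nodes inner_order inner_conds"
    unfolding base_numberings_def by blast
  from numberings_finite[OF this] have "finite (nodes \<rightarrow>\<^sub>E {1..card B0 + 3})" by (simp add: finite_PiE)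
  then show ?thesis unfolding base_numberings_def numberings_def by (rule rev_finite_subset) auto
qed simp

text \<open>
  When arrow \<open>l\<close> is missing, the numbers at the other two places are compared with the number at place \<open>l\<close>.  In each
  case one pair of arrows asks that one number lie on the same side of the other two, and the two remaining
  pairs ask in addition for one or the other order of these two.
\<close>

lemma three_pairs:
  assumes K: "K = (\<Sum>i = 1..card B0 + 3. \<gamma> i)" and tri: "u K 1 + u K 2 + u K 3 = K"
  shows "\<not> d 1 \<Longrightarrow> \<not> d 2 \<Longrightarrow> d 3 \<Longrightarrow> chain_count \<gamma> (B0 \<union> {e 1, e 2}) =
      chain_count \<gamma> (B0 \<union> {e 2, e 3}) + chain_count \<gamma> (B0 \<union> {e 1, e 3})"
    and "\<not> d 1 \<Longrightarrow> d 2 \<Longrightarrow> d 3 \<Longrightarrow> chain_count \<gamma> (B0 \<union> {e 2, e 3}) =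
      chain_count \<gamma> (B0 \<union> {e 1, e 3}) + chain_count \<gamma> (B0 \<union> {e 1, e 2})"
proof -
  have zero: "chain_count \<gamma> (B0 \<union> {e i, e j}) = 0"
    if "\<not> separated" "i \<in> {1, 2, 3}" "j \<in> {1, 2, 3}" "i \<noteq> j" for i j
    using noncrossing_iff_separated[of "{i, j}" i j] that by (simp add: chain_count_def)
  let ?lt = "\<lambda>\<nu> i j. \<nu> (i, c0) < (\<nu> (j, c0) :: nat)"
  have inj: "\<nu> (i, c0) \<noteq> \<nu> (j, c0)" if "separated" "\<nu> \<in> base_numberings \<gamma> K" "i \<in> {1, 2, 3}" "j \<in> {1, 2, 3}" "i \<noteq> j" for \<nu> i j
  proof -
    have "inj_on \<nu> nodes" using that(2) unfolding base_numberings_def numberings_def bij_betw_def by blast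
    then show ?thesis using c0_node[OF that(1)] that(3-5) by (metis inj_onD prod.inject)
  qed
  show "chain_count \<gamma> (B0 \<union> {e 1, e 2}) =
      chain_count \<gamma> (B0 \<union> {e 2, e 3}) + chain_count \<gamma> (B0 \<union> {e 1, e 3})" if "\<not> d 1" "\<not> d 2" "d 3"
  proof (cases separated)
    case True
    note pc = pair_count_base[OF True _ _ _ _ _ _ K tri]
    let ?Q = "base_numberings \<gamma> K"
    have 1: "chain_count \<gamma> (B0 \<union> {e 1, e 2}) = card {\<nu> \<in> ?Q. ?lt \<nu> 3 1 \<and> ?lt \<nu> 3 2}"
      using pc[of 1 2 3] that by (simp add: order_pair_def)
    have 2: "chain_count \<gamma> (B0 \<union> {e 2, e 3}) = card {\<nu> \<in> ?Q. ?lt \<nu> 1 2 \<and> ?lt \<nu> 3 1}"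
      using pc[of 2 3 1] that by (simp add: order_pair_def)
    have 3: "chain_count \<gamma> (B0 \<union> {e 1, e 3}) = card {\<nu> \<in> ?Q. ?lt \<nu> 2 1 \<and> ?lt \<nu> 3 2}"
      using pc[of 1 3 2] that by (simp add: order_pair_def)
    have "{\<nu> \<in> ?Q. ?lt \<nu> 3 1 \<and> ?lt \<nu> 3 2} =
        {\<nu> \<in> ?Q. ?lt \<nu> 1 2 \<and> ?lt \<nu> 3 1} \<union> {\<nu> \<in> ?Q. ?lt \<nu> 2 1 \<and> ?lt \<nu> 3 2}"
      using inj[OF True, of _ 1 2] by (auto simp: less_trans nat_neq_iff)
    then show ?thesis unfolding 1 2 3 using finite_base
      by (simp add: card_Un_disjoint[symmetric] disjoint_iff)
  next
    case False
    then show ?thesis using zero[OF False, of 1 2] zero[OF False, of 2 3] zero[OF False, of 1 3] by simp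
  qed
  show "chain_count \<gamma> (B0 \<union> {e 2, e 3}) =
      chain_count \<gamma> (B0 \<union> {e 1, e 3}) + chain_count \<gamma> (B0 \<union> {e 1, e 2})" if "\<not> d 1" "d 2" "d 3"
  proof (cases separated)
    case True
    note pc = pair_count_base[OF True _ _ _ _ _ _ K tri]
    let ?Q = "base_numberings \<gamma> K"
    have 1: "chain_count \<gamma> (B0 \<union> {e 2, e 3}) = card {\<nu> \<in> ?Q. ?lt \<nu> 2 1 \<and> ?lt \<nu> 3 1}"
      using pc[of 2 3 1] that by (simp add: order_pair_def)
    have 2: "chain_count \<gamma> (B0 \<union> {e 1, e 3}) = card {\<nu> \<in> ?Q. ?lt \<nu> 2 1 \<and> ?lt \<nu> 3 2}"
      using pc[of 1 3 2] that by (simp add: order_pair_def)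
    have 3: "chain_count \<gamma> (B0 \<union> {e 1, e 2}) = card {\<nu> \<in> ?Q. ?lt \<nu> 3 1 \<and> ?lt \<nu> 2 3}"
      using pc[of 1 2 3] that by (simp add: order_pair_def)
    have "{\<nu> \<in> ?Q. ?lt \<nu> 2 1 \<and> ?lt \<nu> 3 1} =
        {\<nu> \<in> ?Q. ?lt \<nu> 2 1 \<and> ?lt \<nu> 3 2} \<union> {\<nu> \<in> ?Q. ?lt \<nu> 3 1 \<and> ?lt \<nu> 2 3}"
      using inj[OF True, of _ 2 3] by (auto simp: less_trans nat_neq_iff)
    then show ?thesis unfolding 1 2 3 using finite_base
      by (simp add: card_Un_disjoint[symmetric] disjoint_iff)
  next
    case False
    then show ?thesis using zero[OF False, of 1 2] zero[OF False, of 2 3] zero[OF False, of 1 3] by simp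
  qed
qed

end

section \<open>Diagrams that carry no chain presentation\<close>

lemma distinct_ends_insert:
  assumes "distinct_ends B" "t \<noteq> h" "t \<notin> endpoints B" "h \<notin> endpoints B"
  shows "distinct_ends (insert (t, h, l) B)"
  unfolding distinct_ends_def
proof (intro conjI allI impI)
  show "finite (insert (t, h, l) B)" using distinct_ends_finite[OF assms(1)] by simp
  fix t1 h1 l1 t2 h2 l2
  assume a: "(t1, h1, l1) \<in> insert (t, h, l) B" and b: "(t2, h2, l2) \<in> insert (t, h, l) B"
  show "t1 \<noteq> h1" using a assms(2) distinct_endsD[OF assms(1)] by blast
  have out: "{s, g} \<inter> {t, h} = {}" if "(s, g, l') \<in> B" for s g l'
    using endpointsI[OF that] assms(3,4) by auto
  show "(t1, h1, l1) = (t2, h2, l2) \<or> {t1, h1} \<inter> {t2, h2} = {}"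
  proof (cases "(t1, h1, l1) \<in> B")
    case True
    show ?thesis
    proof (cases "(t2, h2, l2) \<in> B")
      case True
      show ?thesis using distinct_ends_disjoint[OF assms(1) \<open>(t1, h1, l1) \<in> B\<close> True] by blast
    next
      case False
      then have "t2 = t" "h2 = h" using b by simp_all
      then show ?thesis using out[OF True] by simp
    qed
  next
    case False
    then have 1: "t1 = t" "h1 = h" "l1 = l" using a by simp_all
    show ?thesis
    proof (cases "(t2, h2, l2) \<in> B")
      case True
      show ?thesis using out[OF True] 1 by (simp add: Int_commute)
    next
      case False
      then show ?thesis using b 1 by simp
    qed
  qed
qed

lemma endpoints_insert: "endpoints (insert (t, h, l) B) = {t, h} \<union> endpoints B"
  by (simp add: endpoints_def)

text \<open>
  The arrow cuts off the single region at gap \<open>1\<close>, which would have weight \<open>0\<close>.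
\<close>

lemma chain_count_isolated:
  assumes B: "distinct_ends B" and a: "(t, h, mk) \<in> B"
    and iso: "t = 1 \<and> h = 0 \<and> mk = 0 \<or> t = 0 \<and> h = 1 \<and> mk = K"
    and nz: "\<forall>i\<in>{1..card B + 1}. \<gamma> i \<noteq> 0" and K: "K = (\<Sum>i = 1..card B + 1. \<gamma> i)"
  shows "chain_count \<gamma> B = 0"
proof -
  have False if \<nu>: "\<nu> \<in> numberings \<gamma> (card B + 1) (regs B) Ord (marking_conds B)" for \<nu> Ord
  proof -
    let ?R = "reg B 1"
    have R: "?R \<in> regs B" by (simp add: regs_def)
    have g: "\<gamma> (\<nu> ?R) \<noteq> 0" using nz numberings_range[OF \<nu> R] by blast
    have "({R \<in> regs B. t \<in> R}, mk) \<in> marking_conds B"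
      unfolding marking_conds_def by (rule rev_image_eqI[OF a]) simp
    from numberings_marking[OF \<nu> this]
    have sum: "(\<Sum>R | R \<in> regs B \<and> t \<in> R. \<gamma> (\<nu> R)) = mk" .
    have mem: "t \<in> reg B k \<longleftrightarrow> gap_left t h k" for k by (rule reg_mem_iff[OF B a])
    from iso show False
    proof
      assume i: "t = 1 \<and> h = 0 \<and> mk = 0"
      then have 1: "t \<in> reg B k \<longleftrightarrow> k = 1" for k unfolding mem by (auto simp: gap_left_def)
      have "{R. R \<in> regs B \<and> t \<in> R} = {?R}"
      proof (intro equalityI subsetI)
        fix Q assume Q: "Q \<in> {R. R \<in> regs B \<and> t \<in> R}"
        then obtain k where k: "Q = reg B k" unfolding regs_def by blast
        then have "t \<in> reg B k" using Q by simp
        then show "Q \<in> {?R}" unfolding 1 k by simp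
      next
        fix Q assume "Q \<in> {?R}"
        then have "Q = ?R" by (rule singletonD)
        moreover have "t \<in> ?R" by (simp only: 1)
        ultimately show "Q \<in> {R. R \<in> regs B \<and> t \<in> R}" using R by (simp only: mem_Collect_eq)
      qed
      then show False using sum g i by simp
    next
      assume i: "t = 0 \<and> h = 1 \<and> mk = K"
      then have 1: "t \<in> reg B k \<longleftrightarrow> k \<noteq> 1" for k unfolding mem by (auto simp: gap_left_def)
      have "{R. R \<in> regs B \<and> t \<in> R} = regs B - {?R}"
      proof (intro equalityI subsetI)
        fix Q assume Q: "Q \<in> {R. R \<in> regs B \<and> t \<in> R}"
        moreover have "t \<notin> ?R" by (simp add: 1)
        ultimately show "Q \<in> regs B - {?R}" by blast
      next
        fix Q assume Q: "Q \<in> regs B - {?R}"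
        then obtain k where k: "Q = reg B k" unfolding regs_def by blast
        have "k \<noteq> 1" using Q k by blast
        then have "t \<in> Q" unfolding k 1 .
        then show "Q \<in> {R. R \<in> regs B \<and> t \<in> R}" using Q by blast
      qed
      then have "K = (\<Sum>R\<in>regs B. \<gamma> (\<nu> R)) - \<gamma> (\<nu> ?R)"
        using sum i R numberings_finite[OF \<nu>] by (simp add: sum_diff1)
      then show False using numberings_sum_all[OF \<nu>] K g by simp
    qed
  qed
  then have "numberings \<gamma> (card B + 1) (regs B) (neighbours (regs B)) (marking_conds B) = {}" by blast
  then show ?thesis by (simp add: chain_count_def)
qed

text \<open>
  Noncrossing parallel arrows bound a strip, with arcs at gap \<open>1\<close> and just before the larger of the heads.  No other arrow
  separates these arcs, so the strip is one region; equal markings would give it weight \<open>0\<close>.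
\<close>

lemma chain_count_parallel:
  assumes B: "distinct_ends B" and a: "(0, h, mk) \<in> B" and a': "(1, h', mk) \<in> B"
    and hh: "h' = h + 1 \<or> h = h' + 1"
    and nz: "\<forall>i\<in>{1..card B + 1}. \<gamma> i \<noteq> 0"
  shows "chain_count \<gamma> B = 0"
proof (cases "noncrossing B")
  case False
  then show ?thesis by (simp add: chain_count_def)
next
  case nc: True
  have dis: "{0, h} \<inter> {1, h'} = {}" by (rule distinct_ends_disjoint[OF B a a']) simp
  have h0: "h \<noteq> 0" "h' \<noteq> 1" using distinct_endsD[OF B a] distinct_endsD[OF B a'] by auto
  have h: "2 \<le> h" "2 \<le> h'" using dis h0 by auto
  have "gap_left 0 h 1 = gap_left 0 h h'" by (rule noncrossingD[OF nc a a']) simp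
  then have h'h: "h = h' + 1" using hh h by (auto simp: gap_left_def)
  have False if \<nu>: "\<nu> \<in> numberings \<gamma> (card B + 1) (regs B) Ord (marking_conds B)" for \<nu> Ord
  proof -
    let ?R = "reg B 1"
    have R: "?R \<in> regs B" by (simp add: regs_def)
    have g: "\<gamma> (\<nu> ?R) \<noteq> 0" using nz numberings_range[OF \<nu> R] by blast
    have sum: "(\<Sum>R | R \<in> regs B \<and> s \<in> R. \<gamma> (\<nu> R)) = mk" if s: "(s, g', mk) \<in> B" for s g'
    proof -
      have "({R \<in> regs B. s \<in> R}, mk) \<in> marking_conds B"
        unfolding marking_conds_def by (rule rev_image_eqI[OF s]) simp
      from numberings_marking[OF \<nu> this] show ?thesis .
    qed
    have same: "reg B h = ?R"
    proof -
      have "gap_left s g' h = gap_left s g' 1" if s: "(s, g', l) \<in> B" for s g' l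
      proof (cases "s = 0 \<or> s = 1")
        case True
        then have "g' = (if s = 0 then h else h')"
          using distinct_ends_tail[OF B a] distinct_ends_tail[OF B a'] s by auto
        then show ?thesis using True h h'h by (auto simp: gap_left_def)
      next
        case False
        then have "{s, g'} \<inter> {0, h} = {}" using distinct_ends_disjoint[OF B s a] by auto
        then have "gap_left s g' 1 = gap_left s g' 0" using gap_left_Suc[of 0 s g'] by auto
        moreover have "gap_left s g' 0 = gap_left s g' h" by (rule noncrossingD[OF nc s a]) (use False in simp)
        ultimately show ?thesis by simp
      qed
      then show ?thesis unfolding reg_def by blast
    qed
    have mem0: "0 \<in> reg B k \<longleftrightarrow> gap_left 0 h k" and mem1: "1 \<in> reg B k \<longleftrightarrow> gap_left 1 h' k" for k
      by (rule reg_mem_iff[OF B a], rule reg_mem_iff[OF B a'])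
    have "{R. R \<in> regs B \<and> 1 \<in> R} = insert ?R {R. R \<in> regs B \<and> 0 \<in> R}" (is "?L = ?M")
    proof
      show "?L \<subseteq> ?M"
      proof
        fix R assume R1: "R \<in> ?L"
        then obtain k where k: "R = reg B k" unfolding regs_def by blast
        show "R \<in> ?M"
        proof (cases "gap_left 0 h k")
          case True
          then show ?thesis using R1 mem0 unfolding k by blast
        next
          case False
          moreover have "gap_left 1 h' k" using R1 mem1 unfolding k by blast
          ultimately have "k = 1 \<or> k = h" using h h'h by (auto simp: gap_left_def split: if_splits)
          then show ?thesis using same unfolding k by blast
        qed
      qed
      show "?M \<subseteq> ?L"
      proof -
        have "gap_left 1 h' k" if "gap_left 0 h k \<or> k = 1" for k
          using that h h'h by (auto simp: gap_left_def)
        then have "1 \<in> reg B k" if "0 \<in> reg B k \<or> k = 1" for k using that unfolding mem0 mem1 by blast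
        then show ?thesis using R unfolding regs_def by blast
      qed
    qed
    moreover have "\<not> 0 \<in> ?R" unfolding mem0 using h by (simp add: gap_left_def)
    ultimately have "mk = \<gamma> (\<nu> ?R) + mk"
      using sum[OF a] sum[OF a'] numberings_finite[OF \<nu>] by simp
    then show False using g by simp
  qed
  then have "numberings \<gamma> (card B + 1) (regs B) (neighbours (regs B)) (marking_conds B) = {}" by blast
  then show ?thesis by (simp add: chain_count_def)
qed

lemma chain_count_crossing:
  assumes "(t, h, l) \<in> B" "(t', h', l') \<in> B" "(t, h) \<noteq> (t', h')" "gap_left t h t' \<noteq> gap_left t h h'"
  shows "chain_count \<gamma> B = 0"
  using noncrossingD[OF _ assms(1-3)] assms(4) by (auto simp: chain_count_def)

text \<open>
  The configuration of three arrows around a triangle, with the direction of the second one left open: the two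
  directions belong to the two cyclic orders of the intervals in a third move.
\<close>

lemma triangle_counts:
  assumes X: "distinct_ends X" and out: "endpoints X \<inter> {0, 1, x, x + 1, y, y + 1} = {}"
    and xy: "1 < x" "x + 1 < y" and e2: "t2 = x + 1 \<and> h2 = y \<or> t2 = y \<and> h2 = x + 1"
    and weights: "(K - m1) + (if h2 < t2 then m2 else K - m2) + m3 = K"
  shows "\<forall>i\<in>{1..card X + 4}. \<gamma> i \<noteq> 0 \<Longrightarrow> K = (\<Sum>i = 1..card X + 4. \<gamma> i) \<Longrightarrow>
      chain_count \<gamma> (insert (1, x, m1) (insert (t2, h2, m2) (insert (0, y + 1, m3) X))) = 0"
    and "t2 < h2 \<Longrightarrow> K = (\<Sum>i = 1..card X + 3. \<gamma> i) \<Longrightarrow>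
      chain_count \<gamma> (insert (1, x, m1) (insert (t2, h2, m2) X)) =
      chain_count \<gamma> (insert (t2, h2, m2) (insert (0, y + 1, m3) X)) +
      chain_count \<gamma> (insert (1, x, m1) (insert (0, y + 1, m3) X))"
    and "h2 < t2 \<Longrightarrow> K = (\<Sum>i = 1..card X + 3. \<gamma> i) \<Longrightarrow>
      chain_count \<gamma> (insert (t2, h2, m2) (insert (0, y + 1, m3) X)) =
      chain_count \<gamma> (insert (1, x, m1) (insert (0, y + 1, m3) X)) +
      chain_count \<gamma> (insert (1, x, m1) (insert (t2, h2, m2) X))"
proof -
  define t h :: "nat \<Rightarrow> nat" and mk where
    "t = (\<lambda>i. if i = 1 then 1 else if i = 2 then t2 else 0)" and
    "h = (\<lambda>i. if i = 1 then x else if i = 2 then h2 else y + 1)" and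
    "mk = (\<lambda>i::nat. if i = 1 then m1 else if i = 2 then m2 else m3)"
  have th: "t 1 = 1" "t 2 = t2" "t 3 = 0" "h 1 = x" "h 2 = h2" "h 3 = y + 1"
    "mk 1 = m1" "mk 2 = m2" "mk 3 = m3" by (simp_all add: t_def h_def mk_def)
  interpret triangle_config X x y t h mk
  proof
    have "distinct_ends (insert (1, x, m1) (insert (t2, h2, m2) (insert (0, y + 1, m3) X)))"
      by (intro distinct_ends_insert X) (use out xy e2 in \<open>auto simp: endpoints_insert\<close>)
    then show "distinct_ends (X \<union> {(t 1, h 1, mk 1), (t 2, h 2, mk 2), (t 3, h 3, mk 3)})"
      unfolding th by (simp add: insert_commute)
    show "(t i, h i, mk i) \<notin> X" if "i \<in> {1, 2, 3}" for i
    proof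
      assume "(t i, h i, mk i) \<in> X"
      from endpointsI(1)[OF this] have "t i \<in> endpoints X" .
      then show False using out that th e2 by (elim insertE emptyE) auto
    qed
  qed (use xy th e2 in auto)
  have d: "\<not> d 1" "d 2 \<longleftrightarrow> h2 < t2" "d 3" unfolding d_def th using xy by simp_all
  have e: "e 1 = (1, x, m1)" "e 2 = (t2, h2, m2)" "e 3 = (0, y + 1, m3)" unfolding e_def th by simp_all
  have tri: "u K 1 + u K 2 + u K 3 = K" unfolding u_def th using d weights by simp
  show "\<forall>i\<in>{1..card X + 4}. \<gamma> i \<noteq> 0 \<Longrightarrow> K = (\<Sum>i = 1..card X + 4. \<gamma> i) \<Longrightarrow>
      chain_count \<gamma> (insert (1, x, m1) (insert (t2, h2, m2) (insert (0, y + 1, m3) X))) = 0"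
    using triple_zero[OF _ _ tri] unfolding e by (simp add: insert_commute)
  show "t2 < h2 \<Longrightarrow> K = (\<Sum>i = 1..card X + 3. \<gamma> i) \<Longrightarrow>
      chain_count \<gamma> (insert (1, x, m1) (insert (t2, h2, m2) X)) =
      chain_count \<gamma> (insert (t2, h2, m2) (insert (0, y + 1, m3) X)) +
      chain_count \<gamma> (insert (1, x, m1) (insert (0, y + 1, m3) X))"
    using three_pairs(1)[OF _ tri d(1) _ d(3)] d(2) unfolding e by (simp add: insert_commute)
  show "h2 < t2 \<Longrightarrow> K = (\<Sum>i = 1..card X + 3. \<gamma> i) \<Longrightarrow>
      chain_count \<gamma> (insert (t2, h2, m2) (insert (0, y + 1, m3) X)) =
      chain_count \<gamma> (insert (1, x, m1) (insert (0, y + 1, m3) X)) +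
      chain_count \<gamma> (insert (1, x, m1) (insert (t2, h2, m2) X))"
    using three_pairs(2)[OF _ tri d(1) _ d(3)] d(2) unfolding e by (simp add: insert_commute)
qed

section \<open>Local effect of the third move\<close>

lemma unsign_insert: "unsign (insert (t, h, s, mk) C) = insert (t, h, mk) (unsign C)"
  by (simp add: unsign_def)

lemma sign_prod_insert:
  "finite C \<Longrightarrow> (t, h, s, mk) \<notin> C \<Longrightarrow> sign_prod (insert (t, h, s, mk) C) = sign_val s * sign_prod C"
  by (simp add: sign_prod_def)

lemma sign_val_opposite: "sign_val (opposite s) = - sign_val s"
  by (cases s) simp_all

lemma sign_val_square: "sign_val s * sign_val s = 1"
  by (cases s) simp_all

lemma sum_Pow_insert:
  assumes "finite A" "a \<notin> A"
  shows "(\<Sum>B\<in>Pow (insert a A). g B) = (\<Sum>B\<in>Pow A. g B + g (insert a B))"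
proof -
  have inj: "inj_on (insert a) (Pow A)"
  proof (rule inj_onI)
    fix B C assume "B \<in> Pow A" "C \<in> Pow A" and eq: "insert a B = insert a C"
    then have "a \<notin> B" "a \<notin> C" using assms(2) by auto
    then show "B = C" using eq by (rule insert_ident[THEN iffD1])
  qed
  have "(\<Sum>B\<in>Pow (insert a A). g B) = (\<Sum>B\<in>Pow A. g B) + (\<Sum>B\<in>insert a ` Pow A. g B)"
    unfolding Pow_insert by (rule sum.union_disjoint) (use assms in auto)
  then show ?thesis by (simp add: sum.reindex[OF inj] sum.distrib)
qed

text \<open>
  Moving an end to an adjacent position that is free changes no comparison with the other ends.
\<close>

lemma strict_mono_on_shift:
  fixes t h t' h' :: nat
  assumes t': "t' = t + 1 \<or> t = t' + 1" and h': "h' = h + 1 \<or> h = h' + 1"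
    and E: "t \<notin> E" "h \<notin> E" "t' \<notin> E" "h' \<notin> E" and dist: "t \<noteq> h" "t' \<noteq> h" "h' \<noteq> t" "t' \<noteq> h'"
  shows "strict_mono_on (insert t (insert h E)) (id(t := t', h := h'))"
proof (rule strict_mono_onI)
  let ?S = "insert t (insert h E)"
  define F where "F = id(t := t', h := h')"
  have F: "F t = t'" "F h = h'" using dist(1) by (simp_all add: F_def)
  have FE: "F z = z" if "z \<in> E" for z using that E by (auto simp: F_def)
  have t't: "t' \<noteq> t" and h'h: "h' \<noteq> h" using t' h' by auto
  have "t' \<notin> ?S" "h' \<notin> ?S" using E dist t't h'h by simp_all
  note new = this
  have near: "F z = z \<or> F z \<notin> ?S \<and> (F z = z + 1 \<or> z = F z + 1)" if z: "z \<in> ?S" for z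
  proof -
    from z consider "z = t" | "z = h" | "z \<in> E" by blast
    then show ?thesis by cases (simp_all only: F FE new t' h' simp_thms)
  qed
  have inj: "F z \<noteq> F w" if z: "z \<in> ?S" and w: "w \<in> ?S" and zw: "z \<noteq> w" for z w
  proof
    assume eq: "F z = F w"
    have "F z \<notin> ?S \<and> F w \<notin> ?S" using near[OF z] near[OF w] eq z w zw by metis
    then have "z \<notin> E" "w \<notin> E" using FE by (metis insertCI)+
    then have "z = t \<and> w = h \<or> z = h \<and> w = t" using z w zw by blast
    then show False using eq F dist(4) by auto
  qed
  fix x y assume x: "x \<in> ?S" and y: "y \<in> ?S" and xy: "x < y"
  have "F x < y"
  proof -
    have "F x \<noteq> y" if "F x \<noteq> x" using near[OF x] that y by blast
    then show ?thesis using near[OF x] xy by linarith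
  qed
  moreover have "F x \<noteq> F y" by (rule inj[OF x y]) (use xy in simp)
  ultimately have "F x < F y" using near[OF y] by linarith
  then show "(id(t := t', h := h')) x < (id(t := t', h := h')) y" unfolding F_def .
qed

lemma state_value_shift:
  assumes C: "distinct_ends C" and E: "t \<notin> endpoints C" "h \<notin> endpoints C" "t' \<notin> endpoints C" "h' \<notin> endpoints C"
    and t': "t' = t + 1 \<or> t = t' + 1" and h': "h' = h + 1 \<or> h = h' + 1"
    and dist: "t \<noteq> h" "t' \<noteq> h" "h' \<noteq> t" "t' \<noteq> h'"
  shows "state_value n \<gamma> (insert (t, h, l) C) = state_value n \<gamma> (insert (t', h', l) C)"
proof -
  let ?f = "id(t := t', h := h')" let ?B = "insert (t, h, l) C"
  have e: "endpoints ?B = insert t (insert h (endpoints C))" by (simp add: endpoints_insert)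
  have "relabel ?f C = C" by (rule relabel_id) (use E in auto)
  then have "relabel ?f ?B = insert (t', h', l) C" using dist unfolding relabel_def by simp
  moreover have "state_value n \<gamma> (relabel ?f ?B) = state_value n \<gamma> ?B"
    by (rule state_value_relabel[OF distinct_ends_insert[OF C dist(1) E(1,2)]])
       (unfold e, rule strict_mono_on_shift[OF t' h' E dist])
  ultimately show ?thesis by simp
qed

lemma state_value_zero: "chain_count \<gamma> (unsign B) = 0 \<Longrightarrow> state_value n \<gamma> B = 0"
  by (simp add: state_value_def)

lemma pair_value:
  assumes C: "finite C" and a: "(t, h, s, m) \<notin> insert (t', h', s', m') C" and b: "(t', h', s', m') \<notin> C"
  shows "state_value n \<gamma> (insert (t, h, s, m) (insert (t', h', s', m') C)) =
    (if card C + 2 = n then sign_val s * sign_val s' * sign_prod C *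
      of_nat (chain_count \<gamma> (insert (t, h, m) (insert (t', h', m') (unsign C)))) else 0)"
proof -
  have "card (insert (t, h, s, m) (insert (t', h', s', m') C)) = card C + 2"
    using card_insert_disjoint[OF _ a] card_insert_disjoint[OF C b] C by simp
  moreover have "sign_prod (insert (t, h, s, m) (insert (t', h', s', m') C)) =
      sign_val s * sign_val s' * sign_prod C"
    using sign_prod_insert[OF _ a] sign_prod_insert[OF C b] C by (simp only: finite_insert mult.assoc)
  ultimately show ?thesis unfolding state_value_def unsign_insert by (simp only:)
qed

lemma not_in_ends: "t \<notin> endpoints C \<Longrightarrow> (t, h, l) \<notin> C"
  by (auto dest: endpointsI(1))

text \<open>
  The contributions of the states that contain a fixed set \<open>C\<close> of further arrows, the first interval being at positions
  \<open>0\<close> and \<open>1\<close>.  With one arrow of the three, the two sides of the move differ by a shift of ends.  With two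
  arrows, the states vanish on the side where the arrows cross, and cancel on the other side: the two
  signs agree for the arrows of sign \<open>\<epsilon>\<close> and disagree for the two other pairs.
\<close>

lemma R3_local:
  fixes C :: "(asign \<times> int) arrow set" and \<epsilon> :: asign and n q r :: nat and m12 m13 m23 K :: int and \<gamma> :: "nat \<Rightarrow> int"
  assumes C: "distinct_ends C" and out: "endpoints C \<inter> {0, 1, q, q + 1, r, r + 1} = {}"
    and qr: "distinct [0, 1, q, q + 1, r, r + 1]"
    and tri: "m13 = (if q < r then m12 + m23 - K else m12 + m23)"
    and nz: "\<forall>i\<in>{1..n + 1}. \<gamma> i \<noteq> 0" and K: "K = (\<Sum>i = 1..n + 1. \<gamma> i)"
  defines "a \<equiv> (0, q + 1, \<epsilon>, m12)" and "b \<equiv> (1, r, opposite \<epsilon>, m13)" and "c \<equiv> (q, r + 1, \<epsilon>, m23)"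
    and "a' \<equiv> (1, q, \<epsilon>, m12)" and "b' \<equiv> (0, r + 1, opposite \<epsilon>, m13)" and "c' \<equiv> (q + 1, r, \<epsilon>, m23)"
    and "V \<equiv> state_value n \<gamma>"
  shows "V (insert a C) = V (insert a' C)" "V (insert b C) = V (insert b' C)" "V (insert c C) = V (insert c' C)"
    and "V (insert a (insert b C)) + V (insert a (insert c C)) + V (insert b (insert c C)) = 0"
    and "V (insert a' (insert b' C)) + V (insert a' (insert c' C)) + V (insert b' (insert c' C)) = 0"
    and "V (insert a (insert b (insert c C))) = 0" "V (insert a' (insert b' (insert c' C))) = 0"
proof -
  note defs = a_def b_def c_def a'_def b'_def c'_def
  have ends: "0 \<notin> endpoints C" "1 \<notin> endpoints C" "q \<notin> endpoints C" "q + 1 \<notin> endpoints C"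
    "r \<notin> endpoints C" "r + 1 \<notin> endpoints C" using out by auto
  have ne: "q \<noteq> 0" "q \<noteq> 1" "r \<noteq> 0" "r \<noteq> 1" "q \<noteq> r" "q + 1 \<noteq> r" "r + 1 \<noteq> q" using qr by auto
  show "V (insert a C) = V (insert a' C)" unfolding V_def defs
    by (rule state_value_shift[OF C]) (use ends ne in auto)
  show "V (insert b C) = V (insert b' C)" unfolding V_def defs
    by (rule state_value_shift[OF C]) (use ends ne in auto)
  show "V (insert c C) = V (insert c' C)" unfolding V_def defs
    by (rule state_value_shift[OF C]) (use ends ne in auto)
  let ?X = "unsign C"
  have finC: "finite C" by (rule distinct_ends_finite[OF C])
  have X: "distinct_ends ?X" by (rule distinct_ends_unsign[OF C])
  have cX: "card ?X = card C" by (rule card_unsign[OF C])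
  have outX: "endpoints ?X \<inter> {0, 1, q, q + 1, r, r + 1} = {}" unfolding endpoints_unsign by (rule out)
  note new = not_in_ends[OF ends(1)] not_in_ends[OF ends(2)] not_in_ends[OF ends(3)] not_in_ends[OF ends(4)]
    not_in_ends[OF ends(5)] not_in_ends[OF ends(6)]
  let ?s = "sign_val \<epsilon>"
  have sq: "?s * - ?s = -1" "- ?s * ?s = -1" "?s * ?s = 1" using sign_val_square[of \<epsilon>] by simp_all
  have V2: "V (insert a (insert b C)) = (if card C + 2 = n then - sign_prod C *
        of_nat (chain_count \<gamma> (insert (0, q + 1, m12) (insert (1, r, m13) ?X))) else 0)"
    "V (insert a (insert c C)) = (if card C + 2 = n then sign_prod C *
        of_nat (chain_count \<gamma> (insert (0, q + 1, m12) (insert (q, r + 1, m23) ?X))) else 0)"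
    "V (insert b (insert c C)) = (if card C + 2 = n then - sign_prod C *
        of_nat (chain_count \<gamma> (insert (1, r, m13) (insert (q, r + 1, m23) ?X))) else 0)"
    "V (insert a' (insert b' C)) = (if card C + 2 = n then - sign_prod C *
        of_nat (chain_count \<gamma> (insert (1, q, m12) (insert (0, r + 1, m13) ?X))) else 0)"
    "V (insert a' (insert c' C)) = (if card C + 2 = n then sign_prod C *
        of_nat (chain_count \<gamma> (insert (1, q, m12) (insert (q + 1, r, m23) ?X))) else 0)"
    "V (insert b' (insert c' C)) = (if card C + 2 = n then - sign_prod C *
        of_nat (chain_count \<gamma> (insert (0, r + 1, m13) (insert (q + 1, r, m23) ?X))) else 0)"
    unfolding V_def defs using ne new
    by (simp_all add: pair_value[OF finC] sign_val_opposite sq del: mult_minus_left mult_minus_right)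
  have V3: "V (insert a (insert b (insert c C))) = 0"
    if "card C + 3 = n \<Longrightarrow> chain_count \<gamma> (insert (0, q + 1, m12) (insert (1, r, m13) (insert (q, r + 1, m23) ?X))) = 0"
    unfolding V_def state_value_def defs using that finC ne new by (simp add: unsign_insert)
  have V3': "V (insert a' (insert b' (insert c' C))) = 0"
    if "card C + 3 = n \<Longrightarrow> chain_count \<gamma> (insert (1, q, m12) (insert (0, r + 1, m13) (insert (q + 1, r, m23) ?X))) = 0"
    unfolding V_def state_value_def defs using that finC ne new by (simp add: unsign_insert)
  let ?sum = "V (insert a (insert b C)) + V (insert a (insert c C)) + V (insert b (insert c C)) = 0"
  let ?sum' = "V (insert a' (insert b' C)) + V (insert a' (insert c' C)) + V (insert b' (insert c' C)) = 0"
  let ?triple = "V (insert a (insert b (insert c C))) = 0"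
  let ?triple' = "V (insert a' (insert b' (insert c' C))) = 0"
  have all: "?sum \<and> ?sum' \<and> ?triple \<and> ?triple'"
  proof (cases "q < r")
    case True
    have q: "1 < q" "q + 1 < r" using True ne by auto
    (* before the move any two of the three arrows cross *)
    have x1: "gap_left 0 (q + 1) 1 \<noteq> gap_left 0 (q + 1) r"
      and x2: "gap_left 0 (q + 1) q \<noteq> gap_left 0 (q + 1) (r + 1)"
      and x3: "gap_left 1 r q \<noteq> gap_left 1 r (r + 1)"
      using q by (auto simp: gap_left_def)
    have zero: "chain_count \<gamma> (insert (0, q + 1, m12) (insert (1, r, m13) ?X)) = 0"
      "chain_count \<gamma> (insert (0, q + 1, m12) (insert (q, r + 1, m23) ?X)) = 0"
      "chain_count \<gamma> (insert (1, r, m13) (insert (q, r + 1, m23) ?X)) = 0"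
      "chain_count \<gamma> (insert (0, q + 1, m12) (insert (1, r, m13) (insert (q, r + 1, m23) ?X))) = 0"
      by (rule chain_count_crossing[OF insertI1 insertI2[OF insertI1] _ x1]
          chain_count_crossing[OF insertI1 insertI2[OF insertI1] _ x2]
          chain_count_crossing[OF insertI1 insertI2[OF insertI1] _ x3], use ne in simp)+
    have e2: "q + 1 = q + 1 \<and> r = r \<or> q + 1 = r \<and> r = q + 1" by simp
    have m: "(K - m12) + (if r < q + 1 then m23 else K - m23) + m13 = K" using tri True by simp
    note tf = triangle_counts[OF X outX q e2 m, where \<gamma> = \<gamma>, unfolded cX]
    have pairs: "chain_count \<gamma> (insert (1, q, m12) (insert (q + 1, r, m23) ?X)) =
        chain_count \<gamma> (insert (0, r + 1, m13) (insert (q + 1, r, m23) ?X)) +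
        chain_count \<gamma> (insert (1, q, m12) (insert (0, r + 1, m13) ?X))" if "card C + 2 = n"
    proof -
      have "K = (\<Sum>i = 1..card C + 3. \<gamma> i)" unfolding K using that by (intro sum.cong) auto
      from tf(2)[OF q(2) this] show ?thesis by (simp only: insert_commute[of "(q + 1, r, m23)" "(0, r + 1, m13)"])
    qed
    have triple: "chain_count \<gamma> (insert (1, q, m12) (insert (0, r + 1, m13) (insert (q + 1, r, m23) ?X))) = 0"
      if "card C + 3 = n"
    proof -
      have n4: "n + 1 = card C + 4" using that by simp
      from tf(1)[OF nz[unfolded n4] K[unfolded n4]] show ?thesis by (simp only: insert_commute[of "(q + 1, r, m23)" "(0, r + 1, m13)"])
    qed
    have "?sum \<and> ?sum'"
    proof (cases "card C + 2 = n")
      case True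
      show ?thesis unfolding V2 zero pairs[OF True] by (simp add: True distrib_left)
    next
      case False
      show ?thesis unfolding V2 by (simp only: False if_False) simp
    qed
    then show ?thesis using V3[OF zero(4)] V3'[OF triple] by blast
  next
    case False
    then have q: "1 < r" "r + 1 < q" using ne by auto
    (* after the move any two of the three arrows cross *)
    have x1: "gap_left 1 q 0 \<noteq> gap_left 1 q (r + 1)"
      and x2: "gap_left 1 q (q + 1) \<noteq> gap_left 1 q r"
      and x3: "gap_left 0 (r + 1) (q + 1) \<noteq> gap_left 0 (r + 1) r"
      using q by (auto simp: gap_left_def)
    have zero: "chain_count \<gamma> (insert (1, q, m12) (insert (0, r + 1, m13) ?X)) = 0"
      "chain_count \<gamma> (insert (1, q, m12) (insert (q + 1, r, m23) ?X)) = 0"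
      "chain_count \<gamma> (insert (0, r + 1, m13) (insert (q + 1, r, m23) ?X)) = 0"
      "chain_count \<gamma> (insert (1, q, m12) (insert (0, r + 1, m13) (insert (q + 1, r, m23) ?X))) = 0"
      by (rule chain_count_crossing[OF insertI1 insertI2[OF insertI1] _ x1]
          chain_count_crossing[OF insertI1 insertI2[OF insertI1] _ x2]
          chain_count_crossing[OF insertI1 insertI2[OF insertI1] _ x3], use ne in simp)+
    have e2: "q = r + 1 \<and> r + 1 = q \<or> q = q \<and> r + 1 = r + 1" by simp
    have m: "(K - m13) + (if r + 1 < q then m23 else K - m23) + m12 = K" using tri False q by simp
    have outX': "endpoints ?X \<inter> {0, 1, r, r + 1, q, q + 1} = {}" using outX by auto
    note ts = triangle_counts[OF X outX' q e2 m, where \<gamma> = \<gamma>, unfolded cX]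
    have pairs: "chain_count \<gamma> (insert (0, q + 1, m12) (insert (q, r + 1, m23) ?X)) =
        chain_count \<gamma> (insert (1, r, m13) (insert (q, r + 1, m23) ?X)) +
        chain_count \<gamma> (insert (0, q + 1, m12) (insert (1, r, m13) ?X))" if "card C + 2 = n"
    proof -
      have "K = (\<Sum>i = 1..card C + 3. \<gamma> i)" unfolding K using that by (intro sum.cong) auto
      from ts(3)[OF q(2) this] show ?thesis
        by (simp only: insert_commute[of "(q, r + 1, m23)" "(0, q + 1, m12)"] insert_commute[of "(1, r, m13)" "(0, q + 1, m12)"])
    qed
    have triple: "chain_count \<gamma> (insert (0, q + 1, m12) (insert (1, r, m13) (insert (q, r + 1, m23) ?X))) = 0"
      if "card C + 3 = n"
    proof -
      have n4: "n + 1 = card C + 4" using that by simp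
      from ts(1)[OF nz[unfolded n4] K[unfolded n4]] show ?thesis
        by (simp only: insert_commute[of "(q, r + 1, m23)" "(0, q + 1, m12)"] insert_commute[of "(1, r, m13)" "(0, q + 1, m12)"])
    qed
    have "?sum \<and> ?sum'"
    proof (cases "card C + 2 = n")
      case True
      show ?thesis unfolding V2 zero pairs[OF True] by (simp add: True distrib_left)
    next
      case False
      show ?thesis unfolding V2 by (simp only: False if_False) simp
    qed
    then show ?thesis using V3[OF triple] V3'[OF zero(4)] by blast
  qed
  show ?sum ?sum' ?triple ?triple' using all by blast+
qed

section \<open>Invariance\<close>

lemma rot_origin:
  assumes "p < m" "q = next_pos m p" "1 < m"
  shows "(p + (m - p)) mod m = 0" "(q + (m - p)) mod m = 1"
proof -
  show "(p + (m - p)) mod m = 0" using assms(1) by simp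
  have "(q + (m - p)) mod m = (p + 1 + (m - p)) mod m"
    unfolding assms(2) next_pos_def by (rule mod_add_left_eq)
  also have "p + 1 + (m - p) = 1 + m" using assms(1) by simp
  also have "(1 + m) mod m = 1" using assms(3) by (simp only: mod_add_self2 mod_less)
  finally show "(q + (m - p)) mod m = 1" .
qed

lemma next_pos_rot: "next_pos m ((x + r) mod m) = (next_pos m x + r) mod m"
  unfolding next_pos_def by (simp add: mod_add_left_eq mod_Suc_eq add.assoc)

lemma consecutive_rot: "consecutive m x y \<Longrightarrow> consecutive m ((x + r) mod m) ((y + r) mod m)"
  unfolding consecutive_def next_pos_rot by metis

lemma rot_mem: "(t, h, l) \<in> D \<Longrightarrow> ((t + r) mod (2 * card D), (h + r) mod (2 * card D), l) \<in> rot r D"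
  unfolding rot_def relabel_def by (rule rev_image_eqI, assumption, simp)

lemma abs_diagram_rot: "wf_diag D \<Longrightarrow> abs_diagram (rot r D) = abs_diagram D"
  using abs_diagram_eq_iff[of D "rot r D"] wf_rot by metis

text \<open>
  Renumbering the remaining endpoints commutes with rotations up to a rotation.  This allows every move to be
  rotated to where one of its endpoints is at position \<open>0\<close>, after which none of its pairs of consecutive
  positions is separated by the origin.
\<close>

lemma abs_std_relabel_rot:
  assumes D: "wf_diag D" and B: "B \<subseteq> D"
  shows "abs_diagram (std (relabel (\<lambda>x. (x + r) mod (2 * card D)) B)) = abs_diagram (std B)"
proof (induction r)
  case 0
  have "relabel (\<lambda>x. (x + 0) mod (2 * card D)) B = B"
    by (rule relabel_id) (use endpoints_mono[OF B] D in \<open>auto simp: wf_diag_def\<close>)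
  then show ?case by simp
next
  case (Suc r)
  let ?f = "\<lambda>r x. (x + r) mod (2 * card D)"
  have D': "wf_diag (rot r D)" and c: "card (rot r D) = card D" using wf_rot[OF D] card_rot[OF D] by auto
  have B': "relabel (?f r) B \<subseteq> rot r D" unfolding rot_def by (rule relabel_mono[OF B])
  have "relabel (?f 1) (relabel (?f r) B) = relabel (?f (Suc r)) B"
    unfolding relabel_relabel by (rule relabel_cong) (simp add: mod_Suc_eq)
  moreover have "rot_equiv (std (relabel (?f r) B)) (std (relabel (?f 1) (relabel (?f r) B)))"
    using rot_equiv_std_rot1[OF D' B'] unfolding c .
  ultimately have "abs_diagram (std (relabel (?f r) B)) = abs_diagram (std (relabel (?f (Suc r)) B))"
    using Quotient_rel_abs[OF Quotient_diagram] by metis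
  then show ?case using Suc by simp
qed

lemma relabel_Diff:
  assumes "inj_on f (endpoints D)" "X \<subseteq> D"
  shows "relabel f (D - X) = relabel f D - relabel f X"
  unfolding relabel_def using inj_on_image_set_diff[OF inj_on_relabel[OF assms(1)], of D X] assms(2) by auto

lemma abs_std_rot:
  assumes D: "wf_diag D" and X: "X \<subseteq> D"
  shows "abs_diagram (std (rot r D - relabel (\<lambda>x. (x + r) mod (2 * card D)) X)) = abs_diagram (std (D - X))"
proof -
  have "inj_on (\<lambda>x. (x + r) mod (2 * card D)) (endpoints D)"
    using D by (simp add: wf_diag_def inj_on_add_mod)
  from relabel_Diff[OF this X] abs_std_relabel_rot[OF D, of "D - X" r] show ?thesis
    by (simp add: rot_def)
qed

lemma wf_diag_ends_ge:
  assumes "wf_diag D" "(t, h, l) \<in> D" shows "1 < 2 * card D"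
  using wf_diag_less[OF assms] wf_diag_distinct(1)[OF assms assms(2)] by auto

lemma isolated_at_origin:
  assumes D: "wf_diag D" and a: "(t, h, l) \<in> D" and iso: "isolated K (2 * card D) t h mk"
  obtains r t' h' where "t' = (t + r) mod (2 * card D)" "h' = (h + r) mod (2 * card D)"
    "t' = 1 \<and> h' = 0 \<and> mk = 0 \<or> t' = 0 \<and> h' = 1 \<and> mk = K"
proof -
  let ?m = "2 * card D"
  have l: "t < ?m" "h < ?m" using wf_diag_less[OF D a] by auto
  note m = wf_diag_ends_ge[OF D a]
  from iso consider "t = next_pos ?m h" "mk = 0" | "h = next_pos ?m t" "mk = K"
    unfolding isolated_def by blast
  then show ?thesis
  proof cases
    case 1
    show ?thesis using that[OF refl refl, of "?m - h"] rot_origin[OF l(2) 1(1) m] 1(2) by simp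
  next
    case 2
    show ?thesis using that[OF refl refl, of "?m - t"] rot_origin[OF l(1) 2(1) m] 2(2) by simp
  qed
qed

lemma parallel_at_origin:
  assumes D: "wf_diag D" and a: "(t, h, l) \<in> D" and a': "(t', h', l') \<in> D" and ne: "(t, h, l) \<noteq> (t', h', l')"
    and c: "t' = next_pos (2 * card D) t" "consecutive (2 * card D) h h'"
  defines "f \<equiv> \<lambda>r x. (x + r) mod (2 * card D)"
  obtains r where "f r t = 0" "f r t' = 1" "f r h' = f r h + 1 \<or> f r h = f r h' + 1"
proof -
  let ?m = "2 * card D"
  have l: "t < ?m" "h < ?m" "t' < ?m" "h' < ?m" using wf_diag_less[OF D a] wf_diag_less[OF D a'] by auto
  note m = wf_diag_ends_ge[OF D a]
  let ?r = "?m - t"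
  have 0: "f ?r t = 0" "f ?r t' = 1" using rot_origin[OF l(1) c(1) m] by (simp_all add: f_def)
  have inj: "f ?r x = f ?r y \<Longrightarrow> x < ?m \<Longrightarrow> y < ?m \<Longrightarrow> x = y" for x y
    using inj_on_add_mod[of ?r ?m] unfolding inj_on_def f_def by blast
  have "t \<noteq> h" by (rule wf_diag_distinct(1)[OF D a a])
  moreover have "t \<noteq> h'" using wf_diag_distinct(2)[OF D a a' ne] by auto
  ultimately have nz: "f ?r h \<noteq> 0" "f ?r h' \<noteq> 0" using inj[of t h] inj[of t h'] l 0 by auto
  have "consecutive ?m (f ?r h) (f ?r h')" unfolding f_def by (rule consecutive_rot[OF c(2)])
  then have "f ?r h' = f ?r h + 1 \<or> f ?r h = f ?r h' + 1"
    using nz by (auto simp: consecutive_def next_pos_def mod_Suc f_def split: if_splits)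
  then show ?thesis using that 0 by blast
qed

lemma consecutive_sym: "consecutive m x y \<longleftrightarrow> consecutive m y x"
  unfolding consecutive_def by blast

lemma AP1_vanishes:
  assumes nz: "\<forall>i\<in>{1..n + 1}. \<gamma> i \<noteq> 0" and K: "K = (\<Sum>i = 1..n + 1. \<gamma> i)" and A: "AP1 K A"
  shows "pairing (Phi n \<gamma>) (Poly_Mapping.single A 1) = 0"
proof -
  obtain D t h mk where D: "wf_diag D" "(t, h, mk) \<in> D" "isolated K (2 * card D) t h mk" "A = abs_diagram D"
    using A unfolding AP1_def by blast
  obtain r t' h' where r: "t' = (t + r) mod (2 * card D)" "h' = (h + r) mod (2 * card D)"
    "t' = 1 \<and> h' = 0 \<and> mk = 0 \<or> t' = 0 \<and> h' = 1 \<and> mk = K"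
    by (rule isolated_at_origin[OF D(1-3)])
  let ?D = "rot r D"
  have wf: "wf_diag ?D" by (rule wf_rot[OF D(1)])
  have a: "(t', h', mk) \<in> ?D" unfolding r(1,2) by (rule rot_mem[OF D(2)])
  have "chain_count \<gamma> ?D = 0" if "card ?D = n"
    by (rule chain_count_isolated[OF distinct_ends_sub[OF wf subset_refl] a r(3)]) (use nz K that in simp_all)
  then show ?thesis
    using pairing_Phi[OF wf, of n \<gamma>] unfolding D(4) abs_diagram_rot[OF D(1)] by simp
qed

lemma AP2_vanishes:
  assumes nz: "\<forall>i\<in>{1..n + 1}. \<gamma> i \<noteq> 0" and A: "AP2 n A"
  shows "pairing (Phi n \<gamma>) (Poly_Mapping.single A 1) = 0"
proof -
  obtain D t h t' h' mk where D: "wf_diag D" and a: "(t, h, mk) \<in> D" and a': "(t', h', mk) \<in> D"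
    and ne: "(t, h) \<noteq> (t', h')" and c: "t' = next_pos (2 * card D) t" "consecutive (2 * card D) h h'"
    and AD: "A = abs_diagram D"
  proof -
    obtain D t h t' h' mk where D: "wf_diag D" "(t, h, mk) \<in> D" "(t', h', mk) \<in> D" "(t, h) \<noteq> (t', h')"
      "consecutive (2 * card D) t t'" "consecutive (2 * card D) h h'" "A = abs_diagram D"
      using A unfolding AP2_def by blast
    from D(5) have "t' = next_pos (2 * card D) t \<or> t = next_pos (2 * card D) t'" unfolding consecutive_def .
    then show ?thesis
    proof
      assume "t' = next_pos (2 * card D) t"
      then show ?thesis using that D by blast
    next
      assume "t = next_pos (2 * card D) t'"
      then show ?thesis using that[OF D(1,3,2)] D(4,6,7) consecutive_sym by metis
    qed
  qed
  have ne': "(t, h, mk) \<noteq> (t', h', mk)" using ne by simp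
  obtain r where r: "(t + r) mod (2 * card D) = 0" "(t' + r) mod (2 * card D) = 1"
    "(h' + r) mod (2 * card D) = (h + r) mod (2 * card D) + 1 \<or> (h + r) mod (2 * card D) = (h' + r) mod (2 * card D) + 1"
    by (rule parallel_at_origin[OF D a a' ne' c])
  let ?D = "rot r D"
  have wf: "wf_diag ?D" by (rule wf_rot[OF D])
  have "chain_count \<gamma> ?D = 0" if "card ?D = n"
    by (rule chain_count_parallel[OF distinct_ends_sub[OF wf subset_refl]
          rot_mem[OF a, of r, unfolded r(1)] rot_mem[OF a', of r, unfolded r(2)] r(3)]) (use nz that in simp)
  then show ?thesis
    using pairing_Phi[OF wf, of n \<gamma>] unfolding AD abs_diagram_rot[OF D] by simp
qed

definition invariant :: "nat \<Rightarrow> (nat \<Rightarrow> int) \<Rightarrow> gauss_diagram \<Rightarrow> rat" where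
  "invariant n \<gamma> G = pairing (S_map (Phi n \<gamma>)) (I_map (Poly_Mapping.single G 1))"

lemma invariant_abs: "wf_diag D \<Longrightarrow> invariant n \<gamma> (abs_diagram D) = (\<Sum>B\<in>Pow D. state_value n \<gamma> B)"
  unfolding invariant_def by (rule state_sum_wf)

lemma invariant_std:
  "wf_diag D \<Longrightarrow> B \<subseteq> D \<Longrightarrow> invariant n \<gamma> (abs_diagram (std B)) = (\<Sum>C\<in>Pow B. state_value n \<gamma> C)"
  unfolding invariant_def by (rule state_sum)

lemma unsign_mem: "(t, h, s, mk) \<in> B \<Longrightarrow> (t, h, mk) \<in> unsign B"
  unfolding unsign_def by (rule rev_image_eqI, assumption, simp)

text \<open>
  States containing the isolated arrow vanish; the others are the states of the smaller diagram.
\<close>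

lemma R1_invariant:
  assumes nz: "\<forall>i\<in>{1..n + 1}. \<gamma> i \<noteq> 0" and K: "K = (\<Sum>i = 1..n + 1. \<gamma> i)" and R: "R1 K G G'"
  shows "invariant n \<gamma> G = invariant n \<gamma> G'"
proof -
  obtain D t h \<epsilon> mk where D: "wf_diag D" "(t, h, \<epsilon>, mk) \<in> D" "isolated K (2 * card D) t h mk"
    and G: "G = abs_diagram D" "G' = abs_diagram (std (D - {(t, h, \<epsilon>, mk)}))"
    using R unfolding R1_def by blast
  obtain r t' h' where r: "t' = (t + r) mod (2 * card D)" "h' = (h + r) mod (2 * card D)"
    "t' = 1 \<and> h' = 0 \<and> mk = 0 \<or> t' = 0 \<and> h' = 1 \<and> mk = K"
    by (rule isolated_at_origin[OF D(1-3)])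
  let ?D = "rot r D" let ?a = "(t', h', \<epsilon>, mk)"
  have wf: "wf_diag ?D" by (rule wf_rot[OF D(1)])
  have fin: "finite ?D" using wf by (simp add: wf_diag_def)
  have G': "G' = abs_diagram (std (?D - {?a}))"
    using abs_std_rot[OF D(1), of "{(t, h, \<epsilon>, mk)}" r] D(2) unfolding G(2) r(1,2) by (simp add: relabel_def)
  have zero: "state_value n \<gamma> B = 0" if B: "B \<in> Pow ?D - Pow (?D - {?a})" for B
  proof (cases "card B = n")
    case True
    have BD: "B \<subseteq> ?D" and a: "?a \<in> B" using B by auto
    have dB: "distinct_ends B" by (rule distinct_ends_sub[OF wf BD])
    have "card (unsign B) = n" using card_unsign[OF dB] True by simp
    then have "chain_count \<gamma> (unsign B) = 0"
      by (intro chain_count_isolated[OF distinct_ends_unsign[OF dB] unsign_mem[OF a] r(3)]) (use nz K in simp_all)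
    then show ?thesis by (rule state_value_zero)
  qed (simp add: state_value_def)
  have "invariant n \<gamma> G = (\<Sum>B\<in>Pow ?D. state_value n \<gamma> B)"
    unfolding G(1) abs_diagram_rot[OF D(1), of r, symmetric] by (rule invariant_abs[OF wf])
  also have "\<dots> = (\<Sum>B\<in>Pow (?D - {?a}). state_value n \<gamma> B)"
    by (rule sum.mono_neutral_right) (use fin zero in auto)
  also have "\<dots> = invariant n \<gamma> G'" unfolding G' by (rule invariant_std[OF wf, symmetric]) blast
  finally show ?thesis .
qed

lemma state_value_opposite:
  assumes "finite C" "\<And>s. (t, h, s, mk) \<notin> C"
  shows "state_value n \<gamma> (insert (t, h, opposite \<epsilon>, mk) C) = - state_value n \<gamma> (insert (t, h, \<epsilon>, mk) C)"
  using assms by (simp add: state_value_def sign_prod_insert unsign_insert sign_val_opposite)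

text \<open>
  The two arrows are exchanged by a shift of ends, and their signs are opposite.  So the states with exactly one of
  them cancel, and those with both vanish.
\<close>

lemma R2_at_origin:
  assumes nz: "\<forall>i\<in>{1..n + 1}. \<gamma> i \<noteq> 0" and D: "wf_diag D"
    and a: "(0, h, \<epsilon>, mk) \<in> D" and a': "(1, h', opposite \<epsilon>, mk) \<in> D" and hh: "h' = h + 1 \<or> h = h' + 1"
  shows "(\<Sum>B\<in>Pow D. state_value n \<gamma> B) =
    (\<Sum>B\<in>Pow (D - {(0, h, \<epsilon>, mk), (1, h', opposite \<epsilon>, mk)}). state_value n \<gamma> B)"
proof -
  let ?a = "(0, h, \<epsilon>, mk)" let ?a' = "(1, h', opposite \<epsilon>, mk)" let ?E = "D - {?a, ?a'}"
  let ?V = "state_value n \<gamma>"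
  have fin: "finite ?E" using D by (simp add: wf_diag_def)
  have dis: "{0, h} \<inter> {1, h'} = {}" by (rule wf_diag_distinct(2)[OF D a a']) simp
  have ends: "0 \<notin> endpoints C \<and> h \<notin> endpoints C \<and> 1 \<notin> endpoints C \<and> h' \<notin> endpoints C" if C: "C \<subseteq> ?E" for C
  proof -
    have "{0, h} \<inter> {s, g} = {} \<and> {1, h'} \<inter> {s, g} = {}" if "(s, g, l) \<in> C" for s g l
    proof -
      have z: "(s, g, l) \<in> D" "?a \<noteq> (s, g, l)" "?a' \<noteq> (s, g, l)" using that C by auto
      show ?thesis using wf_diag_distinct(2)[OF D a z(1,2)] wf_diag_distinct(2)[OF D a' z(1,3)] by blast
    qed
    then show ?thesis unfolding endpoints_def by fastforce
  qed
  have D': "D = insert ?a (insert ?a' ?E)" using a a' by blast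
  have fresh: "?a' \<notin> ?E" "?a \<notin> insert ?a' ?E" by simp_all
  have fin': "finite (insert ?a' ?E)" using fin by simp
  have "(\<Sum>B\<in>Pow D. ?V B) = (\<Sum>B\<in>Pow (insert ?a (insert ?a' ?E)). ?V B)"
    by (rule arg_cong[OF D', of "\<lambda>X. \<Sum>B\<in>Pow X. ?V B"])
  also have "\<dots> = (\<Sum>C\<in>Pow ?E. (?V C + ?V (insert ?a C)) + (?V (insert ?a' C) + ?V (insert ?a (insert ?a' C))))"
    unfolding sum_Pow_insert[OF fin' fresh(2)] sum_Pow_insert[OF fin fresh(1)] ..
  also have "\<dots> = (\<Sum>C\<in>Pow ?E. ?V C)"
  proof (rule sum.cong[OF refl])
    fix C assume "C \<in> Pow ?E"
    then have C: "C \<subseteq> ?E" by simp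
    note e = ends[OF C]
    have dC: "distinct_ends C" by (rule distinct_ends_sub[OF D]) (use C in blast)
    have "?V (insert ?a C) = ?V (insert (1, h', \<epsilon>, mk) C)"
      by (rule state_value_shift[OF dC]) (use e hh dis wf_diag_distinct(1)[OF D a a] wf_diag_distinct(1)[OF D a' a'] in auto)
    also have "\<dots> = - ?V (insert ?a' C)"
      using state_value_opposite[OF distinct_ends_finite[OF dC], of 1 h' mk n \<gamma> \<epsilon>] not_in_ends[of 1 C] e by simp
    finally have single: "?V (insert ?a C) + ?V (insert ?a' C) = 0" by simp
    let ?B = "insert ?a (insert ?a' C)"
    have "?V ?B = 0"
    proof (cases "card ?B = n")
      case True
      have dB: "distinct_ends ?B" by (rule distinct_ends_sub[OF D]) (use C a a' in blast)
      have cu: "card (unsign ?B) = n" using card_unsign[OF dB] True by simp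
      have m1: "(0, h, mk) \<in> unsign ?B" by (rule unsign_mem[OF insertI1])
      have m2: "(1, h', mk) \<in> unsign ?B" by (rule unsign_mem[OF insertI2[OF insertI1]])
      have "chain_count \<gamma> (unsign ?B) = 0"
        by (rule chain_count_parallel[OF distinct_ends_unsign[OF dB] m1 m2 hh]) (use nz cu in simp)
      then show ?thesis by (rule state_value_zero)
    qed (simp add: state_value_def)
    then show "(?V C + ?V (insert ?a C)) + (?V (insert ?a' C) + ?V (insert ?a (insert ?a' C))) = ?V C"
      using single by simp
  qed
  finally show ?thesis .
qed

lemma opposite_opposite: "opposite (opposite s) = s"
  by (cases s) simp_all

lemma R2_invariant:
  assumes nz: "\<forall>i\<in>{1..n + 1}. \<gamma> i \<noteq> 0" and R: "R2 G G'"
  shows "invariant n \<gamma> G = invariant n \<gamma> G'"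
proof -
  obtain D t h t' h' \<epsilon> mk where D: "wf_diag D" and a: "(t, h, \<epsilon>, mk) \<in> D" and a': "(t', h', opposite \<epsilon>, mk) \<in> D"
    and c: "t' = next_pos (2 * card D) t" "consecutive (2 * card D) h h'"
    and G: "G = abs_diagram D" "G' = abs_diagram (std (D - {(t, h, \<epsilon>, mk), (t', h', opposite \<epsilon>, mk)}))"
  proof -
    obtain D t h t' h' \<epsilon> mk where D: "wf_diag D" "(t, h, \<epsilon>, mk) \<in> D" "(t', h', opposite \<epsilon>, mk) \<in> D"
      "consecutive (2 * card D) t t'" "consecutive (2 * card D) h h'" "G = abs_diagram D"
      "G' = abs_diagram (std (D - {(t, h, \<epsilon>, mk), (t', h', opposite \<epsilon>, mk)}))"
      using R unfolding R2_def by blast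
    from D(4) have "t' = next_pos (2 * card D) t \<or> t = next_pos (2 * card D) t'" unfolding consecutive_def .
    then show ?thesis
    proof
      assume "t' = next_pos (2 * card D) t"
      then show ?thesis using that D by blast
    next
      assume s: "t = next_pos (2 * card D) t'"
      show ?thesis
        by (rule that[of D t' h' "opposite \<epsilon>" mk t h])
           (use D s consecutive_sym in \<open>simp_all add: opposite_opposite insert_commute\<close>)
    qed
  qed
  have ne: "(t, h, \<epsilon>, mk) \<noteq> (t', h', opposite \<epsilon>, mk)" by (cases \<epsilon>) simp_all
  obtain r where r: "(t + r) mod (2 * card D) = 0" "(t' + r) mod (2 * card D) = 1"
    "(h' + r) mod (2 * card D) = (h + r) mod (2 * card D) + 1 \<or> (h + r) mod (2 * card D) = (h' + r) mod (2 * card D) + 1"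
    by (rule parallel_at_origin[OF D a a' ne c])
  define k k' where "k = (h + r) mod (2 * card D)" and "k' = (h' + r) mod (2 * card D)"
  let ?D = "rot r D" let ?X = "{(0, k, \<epsilon>, mk), (1, k', opposite \<epsilon>, mk)}"
  have wf: "wf_diag ?D" by (rule wf_rot[OF D])
  have X: "relabel (\<lambda>x. (x + r) mod (2 * card D)) {(t, h, \<epsilon>, mk), (t', h', opposite \<epsilon>, mk)} = ?X"
    by (simp add: relabel_def r(1,2) k_def k'_def)
  have G': "G' = abs_diagram (std (?D - ?X))"
    using abs_std_rot[OF D, of "{(t, h, \<epsilon>, mk), (t', h', opposite \<epsilon>, mk)}" r] a a' unfolding G(2) X by simp
  have "invariant n \<gamma> G = (\<Sum>B\<in>Pow ?D. state_value n \<gamma> B)"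
    unfolding G(1) abs_diagram_rot[OF D, of r, symmetric] by (rule invariant_abs[OF wf])
  also have "\<dots> = (\<Sum>B\<in>Pow (?D - ?X). state_value n \<gamma> B)"
    by (rule R2_at_origin[OF nz wf rot_mem[OF a, of r, unfolded r(1), folded k_def]
          rot_mem[OF a', of r, unfolded r(2), folded k'_def] r(3)[folded k_def k'_def]])
  also have "\<dots> = invariant n \<gamma> G'" unfolding G' by (rule invariant_std[OF wf, symmetric]) blast
  finally show ?thesis .
qed

lemma sum_Pow_insert3:
  assumes "finite B" "c \<notin> B" "b \<notin> insert c B" "a \<notin> insert b (insert c B)"
  shows "(\<Sum>S\<in>Pow (insert a (insert b (insert c B))). g S) =
    (\<Sum>C\<in>Pow B. g C + g (insert a C) + g (insert b C) + g (insert c C) +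
      (g (insert a (insert b C)) + g (insert a (insert c C)) + g (insert b (insert c C))) +
      g (insert a (insert b (insert c C))) :: 'a :: comm_monoid_add)"
proof -
  have fin: "finite (insert c B)" "finite (insert b (insert c B))" using assms(1) by simp_all
  show ?thesis
    unfolding sum_Pow_insert[OF fin(2) assms(4)] sum_Pow_insert[OF fin(1) assms(3)] sum_Pow_insert[OF assms(1,2)]
    by (rule sum.cong[OF refl]) (simp add: add_ac)
qed

text \<open>
  An arrow outside the move that met one of the six positions would be one of the three arrows both before and
  after the move, but the move changes all three.  So the states can be grouped by their arrows outside the move.
\<close>

lemma R3_at_origin:
  assumes nz: "\<forall>i\<in>{1..n + 1}. \<gamma> i \<noteq> 0" and K: "K = (\<Sum>i = 1..n + 1. \<gamma> i)"
    and qr: "distinct [0, 1, q, q + 1, r, r + 1]"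
    and tri: "m13 = (if q < r then m12 + m23 - K else m12 + m23)"
    and D: "wf_diag D" "D = B \<union> {(0, q + 1, \<epsilon>, m12), (1, r, opposite \<epsilon>, m13), (q, r + 1, \<epsilon>, m23)}"
    and D': "wf_diag D'" "D' = B \<union> {(1, q, \<epsilon>, m12), (0, r + 1, opposite \<epsilon>, m13), (q + 1, r, \<epsilon>, m23)}"
  shows "(\<Sum>S\<in>Pow D. state_value n \<gamma> S) = (\<Sum>S\<in>Pow D'. state_value n \<gamma> S)"
proof -
  let ?V = "state_value n \<gamma>"
  let ?a = "(0, q + 1, \<epsilon>, m12)" and ?b = "(1, r, opposite \<epsilon>, m13)" and ?c = "(q, r + 1, \<epsilon>, m23)"
  let ?a' = "(1, q, \<epsilon>, m12)" and ?b' = "(0, r + 1, opposite \<epsilon>, m13)" and ?c' = "(q + 1, r, \<epsilon>, m23)"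
  let ?P = "{0, 1, q, q + 1, r, r + 1}"
  have ne: "q \<noteq> 0" "q \<noteq> 1" "r \<noteq> 0" "r \<noteq> 1" "q \<noteq> r" "q + 1 \<noteq> r" "r + 1 \<noteq> q" using qr by auto
  have ends: "{s, g} \<inter> ?P = {}" if z: "(s, g, l) \<in> B" for s g l
  proof -
    have zD: "(s, g, l) \<in> D" "(s, g, l) \<in> D'" unfolding D(2) D'(2) using z by simp_all
    have t: "?a \<in> D" "?b \<in> D" "?c \<in> D" "?a' \<in> D'" "?b' \<in> D'" "?c' \<in> D'"
      unfolding D(2) D'(2) by simp_all
    have "(s, g, l) \<notin> {?a, ?b, ?c} \<or> (s, g, l) \<notin> {?a', ?b', ?c'}" using ne by auto
    then show ?thesis
    proof
      assume "(s, g, l) \<notin> {?a, ?b, ?c}"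
      then have n: "(s, g, l) \<noteq> ?a" "(s, g, l) \<noteq> ?b" "(s, g, l) \<noteq> ?c" by simp_all
      show ?thesis
        using wf_diag_distinct(2)[OF D(1) zD(1) t(1) n(1)] wf_diag_distinct(2)[OF D(1) zD(1) t(2) n(2)]
          wf_diag_distinct(2)[OF D(1) zD(1) t(3) n(3)] by auto
    next
      assume "(s, g, l) \<notin> {?a', ?b', ?c'}"
      then have n: "(s, g, l) \<noteq> ?a'" "(s, g, l) \<noteq> ?b'" "(s, g, l) \<noteq> ?c'" by simp_all
      show ?thesis
        using wf_diag_distinct(2)[OF D'(1) zD(2) t(4) n(1)] wf_diag_distinct(2)[OF D'(1) zD(2) t(5) n(2)]
          wf_diag_distinct(2)[OF D'(1) zD(2) t(6) n(3)] by auto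
    qed
  qed
  have out: "endpoints C \<inter> ?P = {}" if "C \<subseteq> B" for C
  proof -
    have "e \<notin> ?P" if e: "e \<in> endpoints C" for e
    proof -
      obtain s g l where z: "(s, g, l) \<in> C" "e \<in> {s, g}" using e unfolding endpoints_def by auto
      have "(s, g, l) \<in> B" using z(1) \<open>C \<subseteq> B\<close> by (rule subsetD[rotated])
      from ends[OF this] show ?thesis using z(2) by (rule disjoint_iff[THEN iffD1, rule_format])
    qed
    then show ?thesis by blast
  qed
  have fin: "finite B" using D(1) unfolding wf_diag_def D(2) by simp
  have newB: "(e, g, l) \<notin> B" if "e \<in> ?P" for e g l
    using not_in_ends[of e B] out[OF subset_refl] that by blast
  have D3: "D = insert ?a (insert ?b (insert ?c B))" "D' = insert ?a' (insert ?b' (insert ?c' B))"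
    unfolding D(2) D'(2) by simp_all
  have fresh: "?c \<notin> B" "?b \<notin> insert ?c B" "?a \<notin> insert ?b (insert ?c B)"
    "?c' \<notin> B" "?b' \<notin> insert ?c' B" "?a' \<notin> insert ?b' (insert ?c' B)"
    using newB ne by simp_all
  show ?thesis
    unfolding D3 sum_Pow_insert3[OF fin fresh(1-3)] sum_Pow_insert3[OF fin fresh(4-6)]
  proof (rule sum.cong[OF refl])
    fix C assume "C \<in> Pow B"
    then have C: "C \<subseteq> B" by simp
    have dC: "distinct_ends C" by (rule distinct_ends_sub[OF D(1)]) (use C D(2) in blast)
    note loc = R3_local[OF dC out[OF C] qr tri nz K, of \<epsilon>]
    show "?V C + ?V (insert ?a C) + ?V (insert ?b C) + ?V (insert ?c C) +
        (?V (insert ?a (insert ?b C)) + ?V (insert ?a (insert ?c C)) + ?V (insert ?b (insert ?c C))) +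
        ?V (insert ?a (insert ?b (insert ?c C))) =
      ?V C + ?V (insert ?a' C) + ?V (insert ?b' C) + ?V (insert ?c' C) +
        (?V (insert ?a' (insert ?b' C)) + ?V (insert ?a' (insert ?c' C)) + ?V (insert ?b' (insert ?c' C))) +
        ?V (insert ?a' (insert ?b' (insert ?c' C)))"
      by (simp only: loc)
  qed
qed

lemma R3_invariant:
  assumes nz: "\<forall>i\<in>{1..n + 1}. \<gamma> i \<noteq> 0" and K: "K = (\<Sum>i = 1..n + 1. \<gamma> i)" and R: "R3 K G G'"
  shows "invariant n \<gamma> G = invariant n \<gamma> G'"
proof -
  obtain D D' B m p p' q q' r r' \<epsilon> m12 m13 m23 where
    D: "wf_diag D" and D': "wf_diag D'" and m: "m = 2 * card D"
    and nx: "p' = next_pos m p" "q' = next_pos m q" "r' = next_pos m r"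
    and dist: "distinct [p, p', q, q', r, r']" and tri: "triangle K m p q r m12 m13 m23"
    and DB: "D = B \<union> {(p, q', \<epsilon>, m12), (p', r, opposite \<epsilon>, m13), (q, r', \<epsilon>, m23)}"
    and DB': "D' = B \<union> {(p', q, \<epsilon>, m12), (p, r', opposite \<epsilon>, m13), (q', r, \<epsilon>, m23)}"
    and G: "G = abs_diagram D" "G' = abs_diagram D'"
    using R unfolding R3_def by blast
  have l: "p < m" "q' < m" "p' < m" "r < m" "q < m" "r' < m"
  proof -
    have "(p, q', \<epsilon>, m12) \<in> D" "(p', r, opposite \<epsilon>, m13) \<in> D" "(q, r', \<epsilon>, m23) \<in> D"
      unfolding DB by simp_all
    then show "p < m" "q' < m" "p' < m" "r < m" "q < m" "r' < m"
      unfolding m using wf_diag_less[OF D] by blast+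
  qed
  have "p \<noteq> p'" using dist by simp
  then have m1: "1 < m" using l(1,3) by linarith
  (* both diagrams have the same endpoints, so one rotation serves for both *)
  have cD': "2 * card D' = m"
  proof -
    have "endpoints D = endpoints D'" unfolding DB DB' endpoints_Un by (auto simp: endpoints_def)
    then have "{..<2 * card D} = {..<2 * card D'}" using D D' by (simp add: wf_diag_def)
    then show ?thesis unfolding m by (metis card_lessThan)
  qed
  define f where "f x = (x + (m - p)) mod m" for x
  have inj: "f x = f y \<Longrightarrow> x < m \<Longrightarrow> y < m \<Longrightarrow> x = y" for x y
    using inj_on_add_mod[of "m - p" m] unfolding inj_on_def f_def by blast
  have f0: "f p = 0" "f p' = 1" unfolding f_def by (rule rot_origin[OF l(1) nx(1) m1])+
  have fm: "f x < m" for x unfolding f_def using m1 by simp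
  have fnext: "f (next_pos m x) = f x + 1" if "x < m" "next_pos m x < m" "next_pos m x \<noteq> p" for x
  proof -
    have "f (next_pos m x) \<noteq> 0" using inj[of "next_pos m x" p] that(2,3) l(1) f0(1) by metis
    moreover have "f (next_pos m x) = next_pos m (f x)" unfolding f_def by (rule next_pos_rot[symmetric])
    ultimately show ?thesis using fm[of x] by (auto simp: next_pos_def mod_Suc split: if_splits)
  qed
  have pq: "q' \<noteq> p" "r' \<noteq> p" using dist by auto
  have fq: "f q' = f q + 1" using fnext[of q, folded nx(2)] l pq by simp
  have fr: "f r' = f r + 1" using fnext[of r, folded nx(3)] l pq by simp
  have fdist: "distinct [0, 1, f q, f q + 1, f r, f r + 1]"
  proof -
    have "inj_on f {..<m}" using inj_on_add_mod[of "m - p" m] by (simp add: f_def[abs_def])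
    then have "inj_on f (set [p, p', q, q', r, r'])" by (rule inj_on_subset) (use l in simp)
    then have "distinct (map f [p, p', q, q', r, r'])" using dist unfolding distinct_map by simp
    then show ?thesis by (simp only: list.map f0 fq fr)
  qed
  have st: "steps m p x = f x" if "x < m" for x
  proof -
    have "steps m p x = steps m (f p) (f x)" unfolding f_def by (rule steps_mod[OF l(1), symmetric])
    then show ?thesis unfolding f0 using fm[of x] by (simp add: steps_def)
  qed
  have tri': "m13 = (if f q < f r then m12 + m23 - K else m12 + m23)"
    using tri unfolding triangle_def st[OF l(5)] st[OF l(4)] by (simp split: if_splits)
  have rD: "rot (m - p) D = relabel f B \<union> {(0, f q + 1, \<epsilon>, m12), (1, f r, opposite \<epsilon>, m13), (f q, f r + 1, \<epsilon>, m23)}"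
  proof -
    have "rot (m - p) D = relabel f D" unfolding rot_def m[symmetric] f_def ..
    then show ?thesis unfolding DB relabel_def image_Un by (simp add: f0 fq fr)
  qed
  have rD': "rot (m - p) D' = relabel f B \<union> {(1, f q, \<epsilon>, m12), (0, f r + 1, opposite \<epsilon>, m13), (f q + 1, f r, \<epsilon>, m23)}"
  proof -
    have "rot (m - p) D' = relabel f D'" unfolding rot_def cD' f_def ..
    then show ?thesis unfolding DB' relabel_def image_Un by (simp add: f0 fq fr)
  qed
  have "invariant n \<gamma> G = (\<Sum>S\<in>Pow (rot (m - p) D). state_value n \<gamma> S)"
    unfolding G(1) abs_diagram_rot[OF D, of "m - p", symmetric] by (rule invariant_abs[OF wf_rot[OF D]])
  also have "\<dots> = (\<Sum>S\<in>Pow (rot (m - p) D'). state_value n \<gamma> S)"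
    by (rule R3_at_origin[OF nz K fdist tri' wf_rot[OF D] rD wf_rot[OF D'] rD'])
  also have "\<dots> = invariant n \<gamma> G'"
    unfolding G(2) abs_diagram_rot[OF D', of "m - p", symmetric] by (rule invariant_abs[OF wf_rot[OF D'], symmetric])
  finally show ?thesis .
qed

theorem theorem3p9:
  fixes n :: nat and \<gamma> :: "nat \<Rightarrow> int" and K :: int
  assumes "\<forall>i\<in>{1..n + 1}. \<gamma> i \<noteq> 0"
    and "K = (\<Sum>i = 1..n + 1. \<gamma> i)"
  shows "Phi n \<gamma> \<in> arrow_space n \<and>
    (\<forall>A. AP1 K A \<longrightarrow> pairing (Phi n \<gamma>) (Poly_Mapping.single A 1) = 0) \<and>
    (\<forall>A. AP2 n A \<longrightarrow> pairing (Phi n \<gamma>) (Poly_Mapping.single A 1) = 0) \<and>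
    (\<forall>G G'. R1 K G G' \<or> R2 G G' \<or> R3 K G G' \<longrightarrow>
      pairing (S_map (Phi n \<gamma>)) (I_map (Poly_Mapping.single G 1)) =
      pairing (S_map (Phi n \<gamma>)) (I_map (Poly_Mapping.single G' 1)))"
proof (intro conjI allI impI)
  show "Phi n \<gamma> \<in> arrow_space n" by (rule Phi_in_arrow_space)
  show "pairing (Phi n \<gamma>) (Poly_Mapping.single A 1) = 0" if "AP1 K A" for A
    by (rule AP1_vanishes[OF assms that])
  show "pairing (Phi n \<gamma>) (Poly_Mapping.single A 1) = 0" if "AP2 n A" for A
    by (rule AP2_vanishes[OF assms(1) that])
  fix G G' assume R: "R1 K G G' \<or> R2 G G' \<or> R3 K G G'"
  have "invariant n \<gamma> G = invariant n \<gamma> G'"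
    using R R1_invariant[OF assms] R2_invariant[OF assms(1)] R3_invariant[OF assms] by blast
  then show "pairing (S_map (Phi n \<gamma>)) (I_map (Poly_Mapping.single G 1)) =
      pairing (S_map (Phi n \<gamma>)) (I_map (Poly_Mapping.single G' 1))" unfolding invariant_def .
qed

end
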